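(* Let $A$ be a Dedekind domain of characteristic zero such that for each height one prime ideal $\mathfrak{p}$ of $A$ the local ring $A_{\mathfrak{p}}$ has mixed characteristic with finite residue field. Let $R=A[X_1,\ldots,X_n]$ be standard $\mathbb{N}^n$-graded, let $I$ be a $\mathfrak{C}$-monomial ideal of $R$, let $c\ge 0$, and let $M=H^c_I(R)=\bigoplus_{\underline{u}\in\mathbb{Z}^n}M_{\underline{u}}$. Fix a prime ideal $\mathfrak{p}\subseteq A$ and an integer $i\ge 0$. Then for each subset $U\subseteq\{1,\ldots,n\}$ the function $\underline{u}\mapsto\mu_i(\mathfrak{p},M_{\underline{u}})$ is constant on the block $\mathcal{B}(U)$.
   Context: Standard $\mathbb{N}^n$-grading: $\deg a=\underline{0}$ for $a\in A$ and $\deg X_j=e_j$, the $j$-th standard basis vector. An ideal $I$ of $R$ is $\mathfrak{C}$-monomial if it can be generated by elements of the form $a\,m$, where $a\in A$ (not necessarily a unit) and $m$ is a monomial in $X_1,\ldots,X_n$. For such $I$ the local cohomology module $H^c_I(R)$ carries a natural $\mathbb{Z}^n$-grading, and $M_{\underline{u}}$ denotes its component (an $A$-module) of degree $\underline{u}$. The Bass number of an $A$-module $N$ is $\mu_i(\mathfrak{p},N)=\dim_{k(\mathfrak{p})}\operatorname{Ext}^i_{A_{\mathfrak{p}}}(k(\mathfrak{p}),N_{\mathfrak{p}})$, where $k(\mathfrak{p})=A_{\mathfrak{p}}/\mathfrak{p}A_{\mathfrak{p}}$. Recalled from earlier work: these Bass numbers of $M_{\underline{u}}$ are finite. Blocks: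 for $U\subseteq\{1,\ldots,n\}$, $\mathcal{B}(U)=\{\underline{u}\in\mathbb{Z}^n: u_k\ge 0\text{ if }k\in U,\ u_k\le -1\text{ if }k\notin U\}$. *)

theory Defs
  imports
    "HOL-Algebra.Algebra"
    "HOL-Algebra.Algebraic_Closure_Type"
    "HOL-Computational_Algebra.Fraction_Field"
    "HOL-Computational_Algebra.Polynomial"
    "HOL-Library.Poly_Mapping"
    "HOL-Library.Extended_Nat"
begin

section \<open>Modules and homological algebra\<close>

text \<open>
  The type \<^typ>\<open>('r, 'm) module\<close> extends the type of rings. For a module that is not an algebra
  the fields \<^const>\<open>monoid.mult\<close> and \<^const>\<open>monoid.one\<close> are irrelevant.
\<close>

definition self_module :: "('r, 'x) ring_scheme \<Rightarrow> ('r, 'r) module" where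
  "self_module R = \<lparr>carrier = carrier R, monoid.mult = monoid.mult R, monoid.one = monoid.one R,
     ring.zero = ring.zero R, add = add R, module.smult = monoid.mult R\<rparr>"

definition restrict_scalars :: "('a \<Rightarrow> 'r) \<Rightarrow> ('r, 'm) module \<Rightarrow> ('a, 'm) module" where
  "restrict_scalars h M = \<lparr>carrier = carrier M, monoid.mult = monoid.mult M, monoid.one = monoid.one M,
     ring.zero = ring.zero M, add = add M, module.smult = (\<lambda>a. module.smult M (h a))\<rparr>"

definition quot_module :: "('r, 'm) module \<Rightarrow> 'm set \<Rightarrow> ('r, 'm set) module" where
  "quot_module M N = \<lparr>carrier = a_rcosets\<^bsub>M\<^esub> N, monoid.mult = undefined, monoid.one = undefined,
     ring.zero = N, add = set_add M, module.smult = (\<lambda>r Q. \<Union>x\<in>Q. N +>\<^bsub>M\<^esub> (r \<odot>\<^bsub>M\<^esub> x))\<rparr>"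

definition mod_hom :: "('r, 'x) ring_scheme \<Rightarrow> ('r, 'm) module \<Rightarrow> ('r, 'k) module \<Rightarrow> ('m \<Rightarrow> 'k) set"
  where "mod_hom R M N = {f \<in> carrier M \<rightarrow> carrier N.
     (\<forall>x\<in>carrier M. \<forall>y\<in>carrier M. f (x \<oplus>\<^bsub>M\<^esub> y) = f x \<oplus>\<^bsub>N\<^esub> f y) \<and>
     (\<forall>r\<in>carrier R. \<forall>x\<in>carrier M. f (r \<odot>\<^bsub>M\<^esub> x) = r \<odot>\<^bsub>N\<^esub> f x)}"

definition Hom_module ::
  "('r, 'x) ring_scheme \<Rightarrow> ('r, 'm) module \<Rightarrow> ('r, 'k) module \<Rightarrow> ('r, 'm \<Rightarrow> 'k) module"
  where "Hom_module R M N = \<lparr>carrier = mod_hom R M N \<inter> extensional (carrier M),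
     monoid.mult = undefined, monoid.one = undefined,
     ring.zero = (\<lambda>x\<in>carrier M. \<zero>\<^bsub>N\<^esub>),
     add = (\<lambda>f g. \<lambda>x\<in>carrier M. f x \<oplus>\<^bsub>N\<^esub> g x),
     module.smult = (\<lambda>r f. \<lambda>x\<in>carrier M. r \<odot>\<^bsub>N\<^esub> f x)\<rparr>"

definition free_module :: "('r, 'x) ring_scheme \<Rightarrow> nat \<Rightarrow> ('r, nat \<Rightarrow> 'r) module" where
  "free_module R b = \<lparr>carrier = {..<b} \<rightarrow>\<^sub>E carrier R,
     monoid.mult = undefined, monoid.one = undefined,
     ring.zero = (\<lambda>k\<in>{..<b}. \<zero>\<^bsub>R\<^esub>),
     add = (\<lambda>f g. \<lambda>k\<in>{..<b}. f k \<oplus>\<^bsub>R\<^esub> g k),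
     module.smult = (\<lambda>r f. \<lambda>k\<in>{..<b}. r \<otimes>\<^bsub>R\<^esub> f k)\<rparr>"

text \<open>
  Cohomology of a cochain complex \<open>C 0 \<rightarrow> C 1 \<rightarrow> \<dots>\<close>, where \<open>d j\<close> maps \<open>C j\<close> to \<open>C (j + 1)\<close>.
\<close>

definition cocycles :: "(nat \<Rightarrow> ('r, 'm) module) \<Rightarrow> (nat \<Rightarrow> 'm \<Rightarrow> 'm) \<Rightarrow> nat \<Rightarrow> 'm set" where
  "cocycles C d j = a_kernel (C j) (C (Suc j)) (d j)"

definition coboundaries :: "(nat \<Rightarrow> ('r, 'm) module) \<Rightarrow> (nat \<Rightarrow> 'm \<Rightarrow> 'm) \<Rightarrow> nat \<Rightarrow> 'm set" where
  "coboundaries C d j = (case j of 0 \<Rightarrow> {\<zero>\<^bsub>C 0\<^esub>} | Suc k \<Rightarrow> d k ` carrier (C k))"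

definition cohomology ::
  "(nat \<Rightarrow> ('r, 'm) module) \<Rightarrow> (nat \<Rightarrow> 'm \<Rightarrow> 'm) \<Rightarrow> nat \<Rightarrow> ('r, 'm set) module" where
  "cohomology C d j = quot_module ((C j)\<lparr>carrier := cocycles C d j\<rparr>) (coboundaries C d j)"

text \<open>
  \<open>\<dots> \<rightarrow> R\<^sup>b\<^sup>2 \<rightarrow> R\<^sup>b\<^sup>1 \<rightarrow> R\<^sup>b\<^sup>0 \<rightarrow> M \<rightarrow> 0\<close> is exact. Over a Noetherian ring every finitely generated module
  has such a resolution; \<open>Ext_module\<close> is meant for such first arguments only. It does not depend
  on the chosen resolution up to isomorphism.
\<close>

definition free_resolution :: "('r, 'x) ring_scheme \<Rightarrow> ('r, 'm) module \<Rightarrow> (nat \<Rightarrow> nat) \<Rightarrow>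
    (nat \<Rightarrow> (nat \<Rightarrow> 'r) \<Rightarrow> nat \<Rightarrow> 'r) \<Rightarrow> ((nat \<Rightarrow> 'r) \<Rightarrow> 'm) \<Rightarrow> bool" where
  "free_resolution R M b \<delta> \<epsilon> \<longleftrightarrow>
     \<epsilon> \<in> mod_hom R (free_module R (b 0)) M \<and>
     \<epsilon> ` carrier (free_module R (b 0)) = carrier M \<and>
     (\<forall>j. \<delta> j \<in> mod_hom R (free_module R (b (Suc j))) (free_module R (b j))) \<and>
     a_kernel (free_module R (b 0)) M \<epsilon> = \<delta> 0 ` carrier (free_module R (b 1)) \<and>
     (\<forall>j. a_kernel (free_module R (b (Suc j))) (free_module R (b j)) (\<delta> j) =
          \<delta> (Suc j) ` carrier (free_module R (b (Suc (Suc j)))))"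

definition Ext_module :: "('r, 'x) ring_scheme \<Rightarrow> nat \<Rightarrow> ('r, 'm) module \<Rightarrow> ('r, 'k) module \<Rightarrow>
    ('r, ((nat \<Rightarrow> 'r) \<Rightarrow> 'k) set) module" where
  "Ext_module R i M N =
     (let (b, \<delta>, \<epsilon>) = (SOME (b, \<delta>, \<epsilon>). free_resolution R M b \<delta> \<epsilon>)
      in cohomology (\<lambda>j. Hom_module R (free_module R (b j)) N)
           (\<lambda>j f. \<lambda>x\<in>carrier (free_module R (b (Suc j))). f (\<delta> j x)) i)"


section \<open>Localization and Bass numbers\<close>

text \<open>The fraction \<open>m / s\<close> in \<open>S\<^sup>-\<^sup>1 M\<close>, as an equivalence class of pairs.\<close>

definition frac_rel :: "'r set \<Rightarrow> ('r, 'm) module \<Rightarrow> (('m \<times> 'r) \<times> ('m \<times> 'r)) set" where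
  "frac_rel S M = {((m, s), (m', s')). m \<in> carrier M \<and> m' \<in> carrier M \<and> s \<in> S \<and> s' \<in> S \<and>
     (\<exists>t\<in>S. t \<odot>\<^bsub>M\<^esub> (s' \<odot>\<^bsub>M\<^esub> m) = t \<odot>\<^bsub>M\<^esub> (s \<odot>\<^bsub>M\<^esub> m'))}"

definition frac :: "'r set \<Rightarrow> ('r, 'm) module \<Rightarrow> 'm \<Rightarrow> 'r \<Rightarrow> ('m \<times> 'r) set" where
  "frac S M m s = frac_rel S M `` {(m, s)}"

text \<open>
  The unions below run over all representatives of the two classes, and all members of each union
  are equal. For \<open>M = R\<close> the multiplication makes the result the ring \<open>S\<^sup>-\<^sup>1 R\<close>.
\<close>

definition localization :: "('r, 'x) ring_scheme \<Rightarrow> 'r set \<Rightarrow> ('r, 'm) module \<Rightarrow>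
    (('r \<times> 'r) set, ('m \<times> 'r) set) module" where
  "localization R S M = \<lparr>carrier = {frac S M m s | m s. m \<in> carrier M \<and> s \<in> S},
     monoid.mult = (\<lambda>P Q. \<Union>(m, s)\<in>P. \<Union>(n, t)\<in>Q. frac S M (m \<otimes>\<^bsub>M\<^esub> n) (s \<otimes>\<^bsub>R\<^esub> t)),
     monoid.one = frac S M \<one>\<^bsub>M\<^esub> \<one>\<^bsub>R\<^esub>,
     ring.zero = frac S M \<zero>\<^bsub>M\<^esub> \<one>\<^bsub>R\<^esub>,
     add = (\<lambda>P Q. \<Union>(m, s)\<in>P. \<Union>(n, t)\<in>Q.
              frac S M ((t \<odot>\<^bsub>M\<^esub> m) \<oplus>\<^bsub>M\<^esub> (s \<odot>\<^bsub>M\<^esub> n)) (s \<otimes>\<^bsub>R\<^esub> t)),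
     module.smult = (\<lambda>P Q. \<Union>(a, s)\<in>P. \<Union>(m, t)\<in>Q. frac S M (a \<odot>\<^bsub>M\<^esub> m) (s \<otimes>\<^bsub>R\<^esub> t))\<rparr>"

definition local_ring_at ::
  "('r, 'x) ring_scheme \<Rightarrow> 'r set \<Rightarrow> (('r \<times> 'r) set, ('r \<times> 'r) set) module" where
  "local_ring_at R p = localization R (carrier R - p) (self_module R)"

definition local_max_ideal :: "('r, 'x) ring_scheme \<Rightarrow> 'r set \<Rightarrow> ('r \<times> 'r) set set" where
  "local_max_ideal R p =
     {frac (carrier R - p) (self_module R) a s | a s. a \<in> p \<and> s \<in> carrier R - p}"

definition residue_field :: "('r, 'x) ring_scheme \<Rightarrow> 'r set \<Rightarrow> ('r \<times> 'r) set set ring" where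
  "residue_field R p = local_ring_at R p Quot local_max_ideal R p"

definition residue_module ::
  "('r, 'x) ring_scheme \<Rightarrow> 'r set \<Rightarrow> (('r \<times> 'r) set, ('r \<times> 'r) set set) module" where
  "residue_module R p = quot_module (self_module (local_ring_at R p))
     (local_max_ideal R p)"

definition is_basis :: "('k, 'x) ring_scheme \<Rightarrow> ('k, 'v) module \<Rightarrow> 'v set \<Rightarrow> bool" where
  "is_basis K V B \<longleftrightarrow> B \<subseteq> carrier V \<and> finite B \<and>
     (\<forall>v\<in>carrier V. \<exists>!c. c \<in> B \<rightarrow>\<^sub>E carrier K \<and> v = finsum V (\<lambda>b. c b \<odot>\<^bsub>V\<^esub> b) B)"

text \<open>All bases have the same size; without a finite basis the dimension is \<^term>\<open>\<infinity> :: enat\<close>.\<close>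

definition vs_dim :: "('k, 'x) ring_scheme \<Rightarrow> ('k, 'v) module \<Rightarrow> enat" where
  "vs_dim K V = Inf {enat (card B) | B. is_basis K V B}"

text \<open>
  \<open>Ext\<^sup>i (k(p), N\<^sub>p)\<close> is annihilated by the maximal ideal, so \<open>k(p)\<close> acts on it through arbitrary
  representatives of its elements.
\<close>

definition bass_number :: "('a, 'x) ring_scheme \<Rightarrow> 'a set \<Rightarrow> nat \<Rightarrow> ('a, 'm) module \<Rightarrow> enat" where
  "bass_number A p i N = vs_dim (residue_field A p)
     (restrict_scalars (\<lambda>C. SOME r. r \<in> C)
       (Ext_module (local_ring_at A p) i (residue_module A p) (localization A (carrier A - p) N)))"


section \<open>Hypotheses on the base ring\<close>

abbreviation base_ring :: "'a::idom ring" where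
  "base_ring \<equiv> ring_of_type_algebra"

text \<open>Noetherian, integrally closed in the field of fractions, of dimension at most one.\<close>

definition dedekind_domain :: "'a::idom itself \<Rightarrow> bool" where
  "dedekind_domain _ \<longleftrightarrow>
     noetherian_domain (base_ring :: 'a ring) \<and>
     (\<forall>x :: 'a fract. (\<exists>f :: 'a poly. lead_coeff f = 1 \<and> poly (map_poly (\<lambda>a. Fract a 1) f) x = 0)
        \<longrightarrow> (\<exists>a. x = Fract a 1)) \<and>
     (\<forall>P. primeideal P (base_ring :: 'a ring) \<and> P \<noteq> {0} \<longrightarrow> maximalideal P (base_ring :: 'a ring))"

definition height_one_prime :: "'r set \<Rightarrow> ('r, 'x) ring_scheme \<Rightarrow> bool" where
  "height_one_prime p R \<longleftrightarrow> primeideal p R \<and> (\<exists>q. primeideal q R \<and> q \<subset> p) \<and>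
     \<not> (\<exists>q q'. primeideal q R \<and> primeideal q' R \<and> q \<subset> q' \<and> q' \<subset> p)"

definition ring_char :: "('r, 'x) ring_scheme \<Rightarrow> nat" where
  "ring_char R = (if \<exists>k::nat. k > 0 \<and> [k] \<cdot>\<^bsub>R\<^esub> \<one>\<^bsub>R\<^esub> = \<zero>\<^bsub>R\<^esub>
     then LEAST k. k > 0 \<and> [k] \<cdot>\<^bsub>R\<^esub> \<one>\<^bsub>R\<^esub> = \<zero>\<^bsub>R\<^esub> else 0)"

definition mixed_characteristic_at :: "('r, 'x) ring_scheme \<Rightarrow> 'r set \<Rightarrow> bool" where
  "mixed_characteristic_at R p \<longleftrightarrow>
     ring_char (local_ring_at R p) = 0 \<and> ring_char (residue_field R p) > 0"


section \<open>The polynomial ring and its multigraded modules\<close>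

text \<open>
  The variables are indexed by a finite type \<open>'n\<close>, so \<open>n = CARD('n)\<close>. The monomial \<open>a X\<^sup>m\<close> is
  \<^term>\<open>Poly_Mapping.single m a\<close>.
\<close>

type_synonym ('n, 'a) mpoly = "('n \<Rightarrow>\<^sub>0 nat) \<Rightarrow>\<^sub>0 'a"

abbreviation poly_ring :: "('n, 'a::idom) mpoly ring" where
  "poly_ring \<equiv> ring_of_type_algebra"

definition poly_component :: "('n \<Rightarrow> int) \<Rightarrow> ('n, 'a::idom) mpoly set" where
  "poly_component u = {f. \<forall>m\<in>Poly_Mapping.keys f. \<forall>k. int (Poly_Mapping.lookup m k) = u k}"

definition C_monomial_ideal :: "('n, 'a::idom) mpoly set \<Rightarrow> bool" where
  "C_monomial_ideal I \<longleftrightarrow>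
     (\<exists>Q \<subseteq> {Poly_Mapping.single m a | m a. True}. I = genideal poly_ring Q)"

definition graded_module ::
  "(('n, 'a::idom) mpoly, 'e) module \<Rightarrow> (('n \<Rightarrow> int) \<Rightarrow> 'e set) \<Rightarrow> bool" where
  "graded_module M G \<longleftrightarrow>
     module poly_ring M \<and>
     (\<forall>u. subgroup (G u) (add_monoid M)) \<and>
     (\<forall>w u. \<forall>r\<in>poly_component w. \<forall>x\<in>G u. r \<odot>\<^bsub>M\<^esub> x \<in> G (\<lambda>k. w k + u k)) \<and>
     (\<forall>x\<in>carrier M. \<exists>!c. (\<forall>u. c u \<in> G u) \<and> finite {u. c u \<noteq> \<zero>\<^bsub>M\<^esub>} \<and>
        x = finsum M c {u. c u \<noteq> \<zero>\<^bsub>M\<^esub>})"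

definition graded_hom ::
  "(('n, 'a::idom) mpoly, 'e) module \<Rightarrow> (('n \<Rightarrow> int) \<Rightarrow> 'e set) \<Rightarrow>
   (('n, 'a) mpoly, 'f) module \<Rightarrow> (('n \<Rightarrow> int) \<Rightarrow> 'f set) \<Rightarrow> ('e \<Rightarrow> 'f) set" where
  "graded_hom M G N H = {f \<in> mod_hom poly_ring M N. \<forall>u. f ` G u \<subseteq> H u}"

text \<open>
  Injectivity in the category of multigraded modules. HOL cannot quantify over the types of the
  test modules \<open>N' \<subseteq> N\<close>; by Baer's criterion it is enough to let \<open>N\<close> range over the modules whose
  elements live in the type of polynomials, since these include all degree shifts of the
  polynomial ring.
\<close>

definition graded_injective ::
  "(('n, 'a::idom) mpoly, 'e) module \<Rightarrow> (('n \<Rightarrow> int) \<Rightarrow> 'e set) \<Rightarrow> bool" where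
  "graded_injective E G \<longleftrightarrow>
     (\<forall>(N :: (('n, 'a) mpoly, ('n, 'a) mpoly) module) H N' \<phi>.
        graded_module N H \<longrightarrow> submodule N' poly_ring N \<longrightarrow>
        graded_module (N\<lparr>carrier := N'\<rparr>) (\<lambda>u. H u \<inter> N') \<longrightarrow>
        \<phi> \<in> graded_hom (N\<lparr>carrier := N'\<rparr>) (\<lambda>u. H u \<inter> N') E G \<longrightarrow>
        (\<exists>\<psi>\<in>graded_hom N H E G. \<forall>x\<in>N'. \<psi> x = \<phi> x))"

text \<open>
  \<open>0 \<rightarrow> R \<rightarrow> E 0 \<rightarrow> E 1 \<rightarrow> \<dots>\<close> is an injective resolution in the category of multigraded modules. It exists
  as soon as the type \<open>'e\<close> is large enough.
\<close>

definition graded_injective_resolution ::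
  "(nat \<Rightarrow> (('n, 'a::idom) mpoly, 'e) module) \<Rightarrow> (nat \<Rightarrow> ('n \<Rightarrow> int) \<Rightarrow> 'e set) \<Rightarrow>
   (nat \<Rightarrow> 'e \<Rightarrow> 'e) \<Rightarrow> (('n, 'a) mpoly \<Rightarrow> 'e) \<Rightarrow> bool" where
  "graded_injective_resolution E G d \<eta> \<longleftrightarrow>
     (\<forall>j. graded_module (E j) (G j) \<and> graded_injective (E j) (G j)) \<and>
     \<eta> \<in> graded_hom (self_module poly_ring) poly_component (E 0) (G 0) \<and> inj \<eta> \<and>
     (\<forall>j. d j \<in> graded_hom (E j) (G j) (E (Suc j)) (G (Suc j))) \<and>
     a_kernel (E 0) (E 1) (d 0) = range \<eta> \<and>
     (\<forall>j. a_kernel (E (Suc j)) (E (Suc (Suc j))) (d (Suc j)) = d j ` carrier (E j))"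


section \<open>Local cohomology\<close>

text \<open>The functor \<open>\<Gamma>\<^sub>I\<close>: the elements killed by some power of \<open>I\<close>.\<close>

definition torsion_functor ::
  "('n, 'a::idom) mpoly set \<Rightarrow> (('n, 'a) mpoly, 'e) module \<Rightarrow> (('n, 'a) mpoly, 'e) module" where
  "torsion_functor I M = M\<lparr>carrier :=
     {x \<in> carrier M. \<exists>t::nat. \<forall>r \<in> I [^]\<^bsub>ideals_set poly_ring\<^esub> t. r \<odot>\<^bsub>M\<^esub> x = \<zero>\<^bsub>M\<^esub>}\<rparr>"

text \<open>
  \<open>H\<^sup>c\<^sub>I(R)\<close> as the value at \<open>R\<close> of the \<open>c\<close>-th right derived functor of \<open>\<Gamma>\<^sub>I\<close>, computed from a
  multigraded injective resolution \<open>(E, d)\<close> of \<open>R\<close>. For a homogeneous ideal \<open>I\<close> of a Noetherian ring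
  the multigraded injective modules are \<open>\<Gamma>\<^sub>I\<close>-acyclic, so this is the usual local cohomology module;
  the multigrading of the resolution induces its natural grading.
\<close>

definition local_cohomology ::
  "('n, 'a::idom) mpoly set \<Rightarrow> (nat \<Rightarrow> (('n, 'a) mpoly, 'e) module) \<Rightarrow> (nat \<Rightarrow> 'e \<Rightarrow> 'e) \<Rightarrow> nat \<Rightarrow>
   (('n, 'a) mpoly, 'e set) module" where
  "local_cohomology I E d c = cohomology (\<lambda>j. torsion_functor I (E j)) d c"

text \<open>
  The degree \<open>u\<close> component consists of the classes of the cocycles of degree \<open>u\<close>, and \<open>A\<close> acts on it
  through the constant polynomials.
\<close>

definition local_cohomology_component ::
  "('n, 'a::idom) mpoly set \<Rightarrow> (nat \<Rightarrow> (('n, 'a) mpoly, 'e) module) \<Rightarrow>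
   (nat \<Rightarrow> ('n \<Rightarrow> int) \<Rightarrow> 'e set) \<Rightarrow> (nat \<Rightarrow> 'e \<Rightarrow> 'e) \<Rightarrow> nat \<Rightarrow> ('n \<Rightarrow> int) \<Rightarrow> ('a, 'e set) module" where
  "local_cohomology_component I E G d c u =
     restrict_scalars (Poly_Mapping.single 0)
       ((local_cohomology I E d c)\<lparr>carrier :=
          {coboundaries (\<lambda>j. torsion_functor I (E j)) d c +>\<^bsub>E c\<^esub> z | z.
             z \<in> cocycles (\<lambda>j. torsion_functor I (E j)) d c \<inter> G c u}\<rparr>)"

definition block :: "'n set \<Rightarrow> ('n \<Rightarrow> int) set" where
  "block U = {u. (\<forall>k\<in>U. u k \<ge> 0) \<and> (\<forall>k. k \<notin> U \<longrightarrow> u k \<le> -1)}"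

end

theory Submission imports Defs begin

text \<open>
  Multiplication by \<open>X\<^sub>k\<close> is an isomorphism from \<open>M\<^sub>u\<close> to the component of degree \<open>u + e\<^sub>k\<close>
  whenever \<open>u\<^sub>k \<noteq> -1\<close>, and such steps connect any two points of a block. Call a multigraded
  complex straight if its cohomology has this property. The resolution \<open>E\<close> is straight, since its
  only cohomology is \<open>R\<close>. Choose finitely many monomial generators \<open>f\<^sub>1, \<dots>, f\<^sub>r\<close> of \<open>I\<close>; then
  \<open>\<Gamma>\<^sub>I\<close> is obtained by passing to the \<open>f\<^sub>j\<close>-power torsion one generator after the other, and
  straightness survives each step. For a torsion subcomplex \<open>F\<close> of \<open>E\<close> the map \<open>F \<rightarrow> F\<^sub>f\<close> is onto
  because \<open>E\<close> is injective and ascending chains of annihilators of homogeneous elements become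
  stationary, so one may compare \<open>H(F)\<close> with its localization \<open>H(F)\<^sub>f\<close>, on which \<open>X\<^sub>k\<close> is
  bijective as well: either \<open>f\<close> does not involve \<open>X\<^sub>k\<close>, or \<open>X\<^sub>k\<close> is invertible there. The
  five lemma argument is carried out on elements, with denominators cleared.
\<close>

section \<open>Cohomology, Ext and dimension under isomorphism\<close>

section \<open>Modules and cohomology\<close>

text \<open>Over R itself, multiplication by X_k from degree u to degree u + e_k fails to be
  bijective only for u_k = -1, where it goes from 0 to a component that may be nonzero; this is the
  origin of the exceptional value. Two obstacles shape the argument. First, a quotient of x by f has
  to be found not only in the injective module but inside the torsion subcomplex F, so it must be
  annihilated by everything that annihilates x. In general such a y exists only up to f-torsion, in
  the form f^(t+1) y = f^t x, and this is exactly what surjectivity of F -> F_f requires. Second,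
  clearing denominators multiplies by f^s and moves the degree, possibly onto u_k = -1, so s has to
  be chosen with care. The chain conditions involve only terms a X^m: Dickson's lemma for the
  exponents is combined with Noetherianity of A for the coefficients. A separate strand is the
  invariance of Bass numbers under isomorphism, where the definition of Ext by a selected resolution
  makes the existence of resolutions indispensable.\<close>

definition mod_iso :: "('r, 'x) ring_scheme \<Rightarrow> ('r, 'm) module \<Rightarrow> ('r, 'k) module \<Rightarrow> ('m \<Rightarrow> 'k) set"
  where "mod_iso R M N = {f \<in> mod_hom R M N. bij_betw f (carrier M) (carrier N)}"

lemma mod_homI:
  assumes "\<And>x. x \<in> carrier M \<Longrightarrow> f x \<in> carrier N"
    and "\<And>x y. x \<in> carrier M \<Longrightarrow> y \<in> carrier M \<Longrightarrow> f (x \<oplus>\<^bsub>M\<^esub> y) = f x \<oplus>\<^bsub>N\<^esub> f y"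
    and "\<And>r x. r \<in> carrier R \<Longrightarrow> x \<in> carrier M \<Longrightarrow> f (r \<odot>\<^bsub>M\<^esub> x) = r \<odot>\<^bsub>N\<^esub> f x"
  shows "f \<in> mod_hom R M N"
  using assms by (auto simp: mod_hom_def)

lemma mod_homD:
  assumes "f \<in> mod_hom R M N"
  shows "x \<in> carrier M \<Longrightarrow> f x \<in> carrier N"
    and "x \<in> carrier M \<Longrightarrow> y \<in> carrier M \<Longrightarrow> f (x \<oplus>\<^bsub>M\<^esub> y) = f x \<oplus>\<^bsub>N\<^esub> f y"
    and "r \<in> carrier R \<Longrightarrow> x \<in> carrier M \<Longrightarrow> f (r \<odot>\<^bsub>M\<^esub> x) = r \<odot>\<^bsub>N\<^esub> f x"
  using assms by (auto simp: mod_hom_def)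

lemma mod_isoD:
  assumes "f \<in> mod_iso R M N"
  shows "f \<in> mod_hom R M N" "inj_on f (carrier M)" "f ` carrier M = carrier N"
  using assms by (auto simp: mod_iso_def bij_betw_def)

lemma mod_isoI:
  assumes "f \<in> mod_hom R M N" "inj_on f (carrier M)" "carrier N \<subseteq> f ` carrier M"
  shows "f \<in> mod_iso R M N"
  using assms mod_homD(1)[OF assms(1)] by (auto simp: mod_iso_def bij_betw_def)

lemma mod_hom_zero:
  assumes "module R M" "module R N" "f \<in> mod_hom R M N"
  shows "f \<zero>\<^bsub>M\<^esub> = \<zero>\<^bsub>N\<^esub>"
proof -
  interpret M: module R M by fact
  interpret N: module R N by fact
  show ?thesis using mod_homD(3)[OF assms(3), of "\<zero>\<^bsub>R\<^esub>" "\<zero>\<^bsub>M\<^esub>"] mod_homD(1)[OF assms(3)]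
    by simp
qed

lemma mod_hom_minus:
  assumes "module R M" "module R N" "f \<in> mod_hom R M N" "x \<in> carrier M"
  shows "f (\<ominus>\<^bsub>M\<^esub> x) = \<ominus>\<^bsub>N\<^esub> f x"
proof -
  interpret M: module R M by fact
  interpret N: module R N by fact
  show ?thesis using mod_homD(3)[OF assms(3), of "\<ominus>\<^bsub>R\<^esub> \<one>\<^bsub>R\<^esub>" x] mod_homD(1)[OF assms(3)] assms(4)
    by (simp add: M.smult_l_minus N.smult_l_minus)
qed

lemma mod_hom_diff:
  assumes "module R M" "module R N" "f \<in> mod_hom R M N" "x \<in> carrier M" "y \<in> carrier M"
  shows "f (x \<ominus>\<^bsub>M\<^esub> y) = f x \<ominus>\<^bsub>N\<^esub> f y"
proof -
  interpret M: module R M by fact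
  interpret N: module R N by fact
  show ?thesis using assms by (simp add: a_minus_def mod_homD(2)[OF assms(3)] mod_hom_minus)
qed

lemma mod_hom_finsum:
  assumes "module R M" "module R N" "f \<in> mod_hom R M N" "g \<in> A \<rightarrow> carrier M"
  shows "f (finsum M g A) = finsum N (\<lambda>a. f (g a)) A"
proof (cases "finite A")
  case True
  interpret M: module R M by fact
  interpret N: module R N by fact
  note fc = mod_homD(1)[OF assms(3)]
  from True assms(4) show ?thesis
  proof (induction A)
    case (insert a A)
    then have "f (g a \<oplus>\<^bsub>M\<^esub> finsum M g A) = f (g a) \<oplus>\<^bsub>N\<^esub> f (finsum M g A)"
      by (intro mod_homD(2)[OF assms(3)]) auto
    moreover have "(\<lambda>a. f (g a)) \<in> A \<rightarrow> carrier N" using fc insert.prems by auto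
    ultimately show ?case using insert by (auto simp: Pi_def fc)
  qed (simp add: mod_hom_zero[OF assms(1-3)])
next
  case False
  then show ?thesis using assms
    by (simp add: finsum_def finprod_def mod_hom_zero)
qed

lemma a_kernel_eq: "a_kernel M N f = {x \<in> carrier M. f x = \<zero>\<^bsub>N\<^esub>}"
  by (simp add: a_kernel_def kernel_def)

lemma submodule_a_kernel:
  assumes "module R M" "module R N" "f \<in> mod_hom R M N"
  shows "submodule (a_kernel M N f) R M"
proof -
  interpret M: module R M by fact
  interpret N: module R N by fact
  show ?thesis
    by (rule M.submoduleI)
      (auto simp: a_kernel_eq mod_homD(2,3)[OF assms(3)] mod_hom_zero[OF assms]
        mod_hom_minus[OF assms])
qed

lemma submodule_image:
  assumes "module R M" "module R N" "f \<in> mod_hom R M N"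
  shows "submodule (f ` carrier M) R N"
proof -
  interpret M: module R M by fact
  interpret N: module R N by fact
  show ?thesis
  proof (rule N.submoduleI)
    show "\<zero>\<^bsub>N\<^esub> \<in> f ` carrier M"
      using mod_hom_zero[OF assms] by (metis M.M.zero_closed imageI)
    show "\<ominus>\<^bsub>N\<^esub> a \<in> f ` carrier M" if "a \<in> f ` carrier M" for a
      using that by (auto simp flip: mod_hom_minus[OF assms])
    show "a \<oplus>\<^bsub>N\<^esub> b \<in> f ` carrier M" if "a \<in> f ` carrier M" "b \<in> f ` carrier M" for a b
      using that by (auto simp flip: mod_homD(2)[OF assms(3)])
    show "a \<odot>\<^bsub>N\<^esub> b \<in> f ` carrier M" if "a \<in> carrier R" "b \<in> f ` carrier M" for a b
      using that by (auto simp flip: mod_homD(3)[OF assms(3)])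
  qed (auto simp: mod_homD(1)[OF assms(3)])
qed

lemma submodule_of_sub:
  assumes "module R M" "submodule N R M" "submodule L R M" "L \<subseteq> N"
  shows "submodule L R (M\<lparr>carrier := N\<rparr>)"
proof -
  interpret M: module R M by fact
  interpret N: module R "M\<lparr>carrier := N\<rparr>"
    using assms(1,2) submodule.submodule_is_module by blast
  have "module R (M\<lparr>carrier := L\<rparr>)"
    using assms(1,3) submodule.submodule_is_module by blast
  then show ?thesis
    using assms(4) by (intro N.module_incl_imp_submodule) simp_all
qed

lemma submodule_abelian_subgroup:
  assumes "module R M" "submodule N R M"
  shows "abelian_subgroup N M"
proof -
  interpret M: module R M by fact
  show ?thesis
    by (intro abelian_subgroupI3 additive_subgroup.intro M.abelian_group_axioms
        submodule.axioms(1)[OF assms(2)])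
qed

text \<open>The module records of this development copy or rebuild the additive fields of a known
  group; comparing these three fields transfers the group axioms across different record
  types.\<close>

lemma abelian_group_if_comm_group:
  assumes "comm_group G" "carrier M = carrier G" "add M = monoid.mult G" "ring.zero M = one G"
  shows "abelian_group M"
proof -
  interpret G: comm_group G by fact
  show ?thesis
    by (rule abelian_groupI)
      (auto simp: assms G.m_ac intro: bexI[of _ "inv\<^bsub>G\<^esub> _"])
qed

lemma quot_module_simps [simp]:
  "carrier (quot_module M N) = a_rcosets\<^bsub>M\<^esub> N"
  "\<zero>\<^bsub>quot_module M N\<^esub> = N"
  "add (quot_module M N) = set_add M"
  by (simp_all add: quot_module_def)

lemma mem_a_rcosets: "Q \<in> a_rcosets\<^bsub>M\<^esub> N \<longleftrightarrow> (\<exists>x\<in>carrier M. Q = N +>\<^bsub>M\<^esub> x)"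
  by (auto simp: A_RCOSETS_def')

text \<open>Multiplication by r maps N into N, so all members of the union in
  \<open>quot_module\<close> are one and the same coset.\<close>

lemma quot_module_smult:
  assumes "module R M" "submodule N R M" "r \<in> carrier R" "x \<in> carrier M"
  shows "r \<odot>\<^bsub>quot_module M N\<^esub> (N +>\<^bsub>M\<^esub> x) = N +>\<^bsub>M\<^esub> (r \<odot>\<^bsub>M\<^esub> x)"
proof -
  interpret M: module R M by fact
  interpret N: abelian_subgroup N M using submodule_abelian_subgroup[OF assms(1,2)] .
  interpret S: submodule N R M by fact
  have "N +>\<^bsub>M\<^esub> (r \<odot>\<^bsub>M\<^esub> y) = N +>\<^bsub>M\<^esub> (r \<odot>\<^bsub>M\<^esub> x)" if "y \<in> N +>\<^bsub>M\<^esub> x" for y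
  proof -
    from that obtain n where n: "n \<in> N" "y = n \<oplus>\<^bsub>M\<^esub> x" by (auto simp: a_r_coset_def')
    have "n \<in> carrier M" using n by simp
    then have "r \<odot>\<^bsub>M\<^esub> y = r \<odot>\<^bsub>M\<^esub> n \<oplus>\<^bsub>M\<^esub> r \<odot>\<^bsub>M\<^esub> x"
      using n assms(3,4) by (simp add: M.smult_r_distr)
    then have "r \<odot>\<^bsub>M\<^esub> y \<in> N +>\<^bsub>M\<^esub> (r \<odot>\<^bsub>M\<^esub> x)"
      using S.smult_closed[OF assms(3) n(1)] by (auto simp: a_r_coset_def')
    then show ?thesis
      using assms(3,4) by (metis M.smult_closed N.a_repr_independence')
  qed
  moreover have "x \<in> N +>\<^bsub>M\<^esub> x" using assms(4) by (rule N.a_rcos_self)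
  ultimately have "(\<Union>y\<in>N +>\<^bsub>M\<^esub> x. N +>\<^bsub>M\<^esub> (r \<odot>\<^bsub>M\<^esub> y)) = N +>\<^bsub>M\<^esub> (r \<odot>\<^bsub>M\<^esub> x)"
    by blast
  then show ?thesis by (simp add: quot_module_def)
qed

lemma quot_module_add:
  assumes "module R M" "submodule N R M" "x \<in> carrier M" "y \<in> carrier M"
  shows "(N +>\<^bsub>M\<^esub> x) <+>\<^bsub>M\<^esub> (N +>\<^bsub>M\<^esub> y) = N +>\<^bsub>M\<^esub> (x \<oplus>\<^bsub>M\<^esub> y)"
proof -
  interpret N: abelian_subgroup N M using submodule_abelian_subgroup[OF assms(1,2)] .
  show ?thesis using N.a_rcos_sum[OF assms(3,4)] .
qed

lemma coset_eq_iff: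
  assumes "module R M" "submodule N R M" "x \<in> carrier M" "y \<in> carrier M"
  shows "N +>\<^bsub>M\<^esub> x = N +>\<^bsub>M\<^esub> y \<longleftrightarrow> x \<ominus>\<^bsub>M\<^esub> y \<in> N"
proof -
  interpret M: module R M by fact
  interpret N: abelian_subgroup N M using submodule_abelian_subgroup[OF assms(1,2)] .
  have "N +>\<^bsub>M\<^esub> x = N +>\<^bsub>M\<^esub> y \<longleftrightarrow> x \<in> N +>\<^bsub>M\<^esub> y"
    using assms by (metis N.a_rcos_self N.a_repr_independence')
  also have "\<dots> \<longleftrightarrow> x \<ominus>\<^bsub>M\<^esub> y \<in> N"
    using N.a_rcos_module[OF assms(4,3)] by (simp add: a_minus_def)
  finally show ?thesis .
qed

lemma module_quot_module:
  assumes "module R M" "submodule N R M"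
  shows "module R (quot_module M N)"
proof -
  interpret M: module R M by fact
  interpret N: abelian_subgroup N M using submodule_abelian_subgroup[OF assms] .
  interpret S: submodule N R M by fact
  note sm = quot_module_smult[OF assms] and ad = quot_module_add[OF assms]
  show ?thesis
  proof (rule moduleI)
    show "cring R" by (rule M.R.is_cring)
    have "comm_group (M A_Mod N)" by (rule N.a_factorgroup_is_comm_group)
    then show "abelian_group (quot_module M N)"
      by (rule abelian_group_if_comm_group)
        (simp_all add: A_FactGroup_def FactGroup_def A_RCOSETS_def set_add_def)
  next
    fix x assume "x \<in> carrier (quot_module M N)"
    then show "\<one>\<^bsub>R\<^esub> \<odot>\<^bsub>quot_module M N\<^esub> x = x" by (auto simp: mem_a_rcosets sm)
  qed (auto simp: mem_a_rcosets sm ad M.smult_l_distr M.smult_r_distr M.smult_assoc1)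
qed

lemma module_restrict_scalars:
  assumes "cring A" "module R M" "h \<in> ring_hom A R"
  shows "module A (restrict_scalars h M)"
proof -
  interpret M: module R M by fact
  interpret A: cring A by fact
  show ?thesis
  proof (rule moduleI)
    show "abelian_group (restrict_scalars h M)"
      by (rule abelian_group_if_comm_group[OF M.a_comm_group]) (simp_all add: restrict_scalars_def)
  qed (use assms in \<open>auto simp: restrict_scalars_def M.smult_l_distr M.smult_r_distr M.smult_assoc1
        ring_hom_closed ring_hom_add ring_hom_mult ring_hom_one\<close>)
qed

section \<open>Cohomology of isomorphic complexes\<close>

definition cochain_complex :: "('r, 'x) ring_scheme \<Rightarrow> (nat \<Rightarrow> ('r, 'm) module) \<Rightarrow> (nat \<Rightarrow> 'm \<Rightarrow> 'm) \<Rightarrow> bool"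
  where "cochain_complex R C d \<longleftrightarrow> (\<forall>j. module R (C j) \<and> d j \<in> mod_hom R (C j) (C (Suc j)) \<and>
     (\<forall>x\<in>carrier (C j). d (Suc j) (d j x) = \<zero>\<^bsub>C (Suc (Suc j))\<^esub>))"

lemma submodule_zero:
  assumes "module R M" shows "submodule {\<zero>\<^bsub>M\<^esub>} R M"
proof -
  interpret M: module R M by fact
  show ?thesis by (rule M.submoduleI) auto
qed

lemma cocycles_eq: "cocycles C d j = {x \<in> carrier (C j). d j x = \<zero>\<^bsub>C (Suc j)\<^esub>}"
  by (simp add: cocycles_def a_kernel_eq)

lemma
  assumes "cochain_complex R C d"
  shows submodule_cocycles: "submodule (cocycles C d j) R (C j)"
    and submodule_coboundaries: "submodule (coboundaries C d j) R (C j)"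
    and coboundaries_le_cocycles: "coboundaries C d j \<subseteq> cocycles C d j"
proof -
  have *: "module R (C j)" "d j \<in> mod_hom R (C j) (C (Suc j))"
     "x \<in> carrier (C j) \<Longrightarrow> d (Suc j) (d j x) = \<zero>\<^bsub>C (Suc (Suc j))\<^esub>" for j x
    using assms by (auto simp: cochain_complex_def)
  show "submodule (cocycles C d j) R (C j)"
    unfolding cocycles_def by (intro submodule_a_kernel *)
  show "submodule (coboundaries C d j) R (C j)"
    unfolding coboundaries_def by (cases j) (simp_all add: submodule_image submodule_zero *)
  interpret C: module R "C j" by (rule *)
  show "coboundaries C d j \<subseteq> cocycles C d j"
    unfolding coboundaries_def cocycles_eq
    using *(3) C.M.zero_closed mod_homD(1)[OF *(2)] mod_hom_zero[OF *(1,1,2)]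
    by (cases j) auto
qed

text \<open>A coset depends on the addition only, so classes of cocycles may be written as cosets in
  \<open>C j\<close> although the quotient is formed inside the cocycles.\<close>

lemma coset_carrier_update: "N +>\<^bsub>M\<lparr>carrier := Z\<rparr>\<^esub> x = N +>\<^bsub>M\<^esub> x"
  by (simp add: a_r_coset_def')

lemma carrier_cohomology:
  "carrier (cohomology C d j) = {coboundaries C d j +>\<^bsub>C j\<^esub> z | z. z \<in> cocycles C d j}"
  by (auto simp: cohomology_def mem_a_rcosets coset_carrier_update)

lemma
  assumes "cochain_complex R C d"
  shows module_cohomology: "module R (cohomology C d j)"
    and cohomology_add: "x \<in> cocycles C d j \<Longrightarrow> y \<in> cocycles C d j \<Longrightarrow>
      (coboundaries C d j +>\<^bsub>C j\<^esub> x) \<oplus>\<^bsub>cohomology C d j\<^esub> (coboundaries C d j +>\<^bsub>C j\<^esub> y)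
     = coboundaries C d j +>\<^bsub>C j\<^esub> (x \<oplus>\<^bsub>C j\<^esub> y)"
    and cohomology_smult: "r \<in> carrier R \<Longrightarrow> x \<in> cocycles C d j \<Longrightarrow>
      r \<odot>\<^bsub>cohomology C d j\<^esub> (coboundaries C d j +>\<^bsub>C j\<^esub> x)
     = coboundaries C d j +>\<^bsub>C j\<^esub> (r \<odot>\<^bsub>C j\<^esub> x)"
proof -
  have C: "module R (C j)" using assms by (simp add: cochain_complex_def)
  define Z where "Z = (C j)\<lparr>carrier := cocycles C d j\<rparr>"
  have Z: "carrier Z = cocycles C d j" "add Z = add (C j)" "module.smult Z = module.smult (C j)"
    by (simp_all add: Z_def)
  have Zm: "module R Z"
    using submodule.submodule_is_module[OF submodule_cocycles[OF assms] C] by (simp add: Z_def)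
  have Bm: "submodule (coboundaries C d j) R Z"
    unfolding Z_def by (rule submodule_of_sub[OF C submodule_cocycles[OF assms]
        submodule_coboundaries[OF assms] coboundaries_le_cocycles[OF assms]])
  have eq: "cohomology C d j = quot_module Z (coboundaries C d j)"
    by (simp add: cohomology_def Z_def)
  show "module R (cohomology C d j)" unfolding eq by (rule module_quot_module[OF Zm Bm])
  have cos: "coboundaries C d j +>\<^bsub>C j\<^esub> z = coboundaries C d j +>\<^bsub>Z\<^esub> z" for z
    by (simp add: a_r_coset_def' Z)
  show "(coboundaries C d j +>\<^bsub>C j\<^esub> x) \<oplus>\<^bsub>cohomology C d j\<^esub> (coboundaries C d j +>\<^bsub>C j\<^esub> y)
     = coboundaries C d j +>\<^bsub>C j\<^esub> (x \<oplus>\<^bsub>C j\<^esub> y)" if "x \<in> cocycles C d j" "y \<in> cocycles C d j"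
    using quot_module_add[OF Zm Bm, of x y] that by (simp add: eq cos Z)
  show "r \<odot>\<^bsub>cohomology C d j\<^esub> (coboundaries C d j +>\<^bsub>C j\<^esub> x)
     = coboundaries C d j +>\<^bsub>C j\<^esub> (r \<odot>\<^bsub>C j\<^esub> x)" if "r \<in> carrier R" "x \<in> cocycles C d j"
    using quot_module_smult[OF Zm Bm that(1), of x] that(2) by (simp add: eq cos Z)
qed

lemma image_coset:
  assumes "f \<in> mod_hom R M M'" "N \<subseteq> carrier M" "x \<in> carrier M"
  shows "f ` (N +>\<^bsub>M\<^esub> x) = (f ` N) +>\<^bsub>M'\<^esub> f x"
proof -
  have "f (n \<oplus>\<^bsub>M\<^esub> x) = f n \<oplus>\<^bsub>M'\<^esub> f x" if "n \<in> N" for n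
    using assms that by (intro mod_homD(2)[OF assms(1)]) auto
  then show ?thesis by (simp add: a_r_coset_def' image_UN)
qed

text \<open>A chain isomorphism carries cocycles onto cocycles and coboundaries onto coboundaries.
  Classes are sets of cochains, so the induced map can be taken to be the direct image of cosets,
  and it is injective because direct images under an injective map are.\<close>

lemma cohomology_iso:
  assumes "cochain_complex R C d" "cochain_complex R C' d'"
    and iso: "\<And>j. \<phi> j \<in> mod_iso R (C j) (C' j)"
    and comm: "\<And>j x. x \<in> carrier (C j) \<Longrightarrow> \<phi> (Suc j) (d j x) = d' j (\<phi> j x)"
  shows "(\<lambda>Q. \<phi> j ` Q) \<in> mod_iso R (cohomology C d j) (cohomology C' d' j)"
proof -
  note hom = mod_isoD(1)[OF iso] and inj = mod_isoD(2)[OF iso] and surj = mod_isoD(3)[OF iso]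
  have C: "module R (C j)" "d j \<in> mod_hom R (C j) (C (Suc j))" for j
    using assms(1) by (auto simp: cochain_complex_def)
  have C': "module R (C' j)" for j using assms(2) by (auto simp: cochain_complex_def)
  have Z: "\<phi> j ` cocycles C d j = cocycles C' d' j"
  proof -
    interpret C: module R "C (Suc j)" by (rule C)
    have "d j x = \<zero>\<^bsub>C (Suc j)\<^esub> \<longleftrightarrow> d' j (\<phi> j x) = \<zero>\<^bsub>C' (Suc j)\<^esub>" if "x \<in> carrier (C j)" for x
      using comm[OF that] mod_hom_zero[OF C(1) C' hom, of "Suc j"] inj[of "Suc j"]
        mod_homD(1)[OF C(2) that]
      by (metis C.M.zero_closed inj_onD)
    then show ?thesis unfolding cocycles_eq surj[of j, symmetric] by auto
  qed
  have B: "\<phi> j ` coboundaries C d j = coboundaries C' d' j"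
  proof (cases j)
    case 0 then show ?thesis by (simp add: coboundaries_def mod_hom_zero[OF C(1) C' hom])
  next
    case (Suc k)
    then show ?thesis
      using comm[of _ k] by (force simp: coboundaries_def surj[of k, symmetric] image_image)
  qed
  let ?B = "coboundaries C d j" and ?B' = "coboundaries C' d' j"
  have Bsub: "?B \<subseteq> carrier (C j)" and Zsub: "cocycles C d j \<subseteq> carrier (C j)"
    using coboundaries_le_cocycles[OF assms(1), of j] by (auto simp: cocycles_eq)
  have coset: "\<phi> j ` (?B +>\<^bsub>C j\<^esub> z) = ?B' +>\<^bsub>C' j\<^esub> \<phi> j z" if "z \<in> cocycles C d j" for z
    using image_coset[OF hom Bsub] that Zsub B by auto
  have sub: "?B +>\<^bsub>C j\<^esub> z \<subseteq> carrier (C j)" if "z \<in> cocycles C d j" for z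
  proof -
    interpret C: module R "C j" by (rule C)
    show ?thesis using that Zsub Bsub by (auto simp: a_r_coset_def')
  qed
  interpret ZZ: submodule "cocycles C d j" R "C j" by (rule submodule_cocycles[OF assms(1)])
  show ?thesis
  proof (rule mod_isoI[OF mod_homI])
    show "\<phi> j ` x \<in> carrier (cohomology C' d' j)" if "x \<in> carrier (cohomology C d j)" for x
    proof -
      from that obtain z where z: "z \<in> cocycles C d j" "x = ?B +>\<^bsub>C j\<^esub> z"
        by (auto simp: carrier_cohomology)
      then have "\<phi> j z \<in> cocycles C' d' j" using Z by blast
      then show ?thesis using z by (auto simp: carrier_cohomology coset)
    qed
    show "\<phi> j ` (x \<oplus>\<^bsub>cohomology C d j\<^esub> y) = \<phi> j ` x \<oplus>\<^bsub>cohomology C' d' j\<^esub> \<phi> j ` y"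
      if xy: "x \<in> carrier (cohomology C d j)" "y \<in> carrier (cohomology C d j)" for x y
    proof -
      from xy obtain a b where ab: "a \<in> cocycles C d j" "b \<in> cocycles C d j"
        "x = ?B +>\<^bsub>C j\<^esub> a" "y = ?B +>\<^bsub>C j\<^esub> b" by (auto simp: carrier_cohomology)
      have "a \<oplus>\<^bsub>C j\<^esub> b \<in> cocycles C d j" using ab(1,2) ZZ.m_closed by simp
      moreover have "\<phi> j a \<in> cocycles C' d' j" "\<phi> j b \<in> cocycles C' d' j" using ab Z by auto
      ultimately show ?thesis
        using ab Zsub by (simp add: cohomology_add[OF assms(1)] cohomology_add[OF assms(2)] coset
            mod_homD(2)[OF hom] subsetD[OF Zsub])
    qed
    show "\<phi> j ` (r \<odot>\<^bsub>cohomology C d j\<^esub> x) = r \<odot>\<^bsub>cohomology C' d' j\<^esub> \<phi> j ` x"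
      if rx: "r \<in> carrier R" "x \<in> carrier (cohomology C d j)" for r x
    proof -
      from rx obtain a where a: "a \<in> cocycles C d j" "x = ?B +>\<^bsub>C j\<^esub> a"
        by (auto simp: carrier_cohomology)
      have "r \<odot>\<^bsub>C j\<^esub> a \<in> cocycles C d j" using a rx by simp
      moreover have "\<phi> j a \<in> cocycles C' d' j" using a Z by auto
      ultimately show ?thesis
        using a rx by (simp add: cohomology_smult[OF assms(1)] cohomology_smult[OF assms(2)] coset
            mod_homD(3)[OF hom] subsetD[OF Zsub])
    qed
    show "inj_on ((`) (\<phi> j)) (carrier (cohomology C d j))"
    proof (rule inj_onI)
      fix x y assume "x \<in> carrier (cohomology C d j)" "y \<in> carrier (cohomology C d j)"
      then have "x \<subseteq> carrier (C j)" "y \<subseteq> carrier (C j)" using sub by (auto simp: carrier_cohomology)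
      then show "\<phi> j ` x = \<phi> j ` y \<Longrightarrow> x = y" using inj_on_image_eq_iff[OF inj] by blast
    qed
    show "carrier (cohomology C' d' j) \<subseteq> (`) (\<phi> j) ` carrier (cohomology C d j)"
    proof
      fix y assume "y \<in> carrier (cohomology C' d' j)"
      then obtain w where "w \<in> cocycles C' d' j" "y = ?B' +>\<^bsub>C' j\<^esub> w"
        by (auto simp: carrier_cohomology)
      moreover from this Z obtain z where "z \<in> cocycles C d j" "w = \<phi> j z" by blast
      ultimately have z: "z \<in> cocycles C d j" "y = \<phi> j ` (?B +>\<^bsub>C j\<^esub> z)" by (auto simp: coset)
      then show "y \<in> (`) (\<phi> j) ` carrier (cohomology C d j)" using z(1) by (auto simp: carrier_cohomology)
    qed
  qed
qed

section \<open>Ext modules and dimension under isomorphism\<close>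

lemma mod_iso_inv:
  assumes "module R M" "module R N" "f \<in> mod_iso R M N"
  shows "inv_into (carrier M) f \<in> mod_iso R N M"
proof -
  interpret M: module R M by fact
  interpret N: module R N by fact
  note f = mod_isoD[OF assms(3)]
  let ?g = "inv_into (carrier M) f"
  have g: "?g y \<in> carrier M" "f (?g y) = y" if "y \<in> carrier N" for y
    using that f(3) by (auto simp: inv_into_into f_inv_into_f)
  have gf: "?g (f x) = x" if "x \<in> carrier M" for x using that f(2) by (rule inv_into_f_f[rotated])
  show ?thesis
  proof (rule mod_isoI[OF mod_homI])
    fix x y assume xy: "x \<in> carrier N" "y \<in> carrier N"
    have "x \<oplus>\<^bsub>N\<^esub> y = f (?g x \<oplus>\<^bsub>M\<^esub> ?g y)" using xy g by (simp add: mod_homD(2)[OF f(1)])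
    then show "?g (x \<oplus>\<^bsub>N\<^esub> y) = ?g x \<oplus>\<^bsub>M\<^esub> ?g y" using xy g gf by simp
  next
    fix r x assume rx: "r \<in> carrier R" "x \<in> carrier N"
    have "r \<odot>\<^bsub>N\<^esub> x = f (r \<odot>\<^bsub>M\<^esub> ?g x)" using rx g by (simp add: mod_homD(3)[OF f(1)])
    then show "?g (r \<odot>\<^bsub>N\<^esub> x) = r \<odot>\<^bsub>M\<^esub> ?g x" using rx g gf by simp
  next
    show "inj_on ?g (carrier N)" using g(2) by (rule inj_on_inverseI)
    show "carrier M \<subseteq> ?g ` carrier N" using gf f(3) by (metis image_eqI subsetI)
  qed (use g in auto)
qed

lemma finsum_restrict_scalars: "finsum (restrict_scalars h V) f B = finsum V f B"
  by (simp add: finsum_def finprod_def restrict_scalars_def)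

lemma restrict_scalars_simps [simp]:
  "carrier (restrict_scalars h V) = carrier V"
  "add (restrict_scalars h V) = add V"
  "\<zero>\<^bsub>restrict_scalars h V\<^esub> = \<zero>\<^bsub>V\<^esub>"
  "a \<odot>\<^bsub>restrict_scalars h V\<^esub> x = h a \<odot>\<^bsub>V\<^esub> x"
  by (simp_all add: restrict_scalars_def)

text \<open>The function \<open>h\<close> only picks representatives and need not be a homomorphism.
  The argument rests on \<phi> commuting with each scalar \<open>h C\<close> and with finite sums:
  coordinates of v with respect to B correspond to coordinates of \<phi> v with respect to the image
  of B by reindexing along \<phi>.\<close>

lemma is_basis_iso:
  assumes "module R V" "module R W" "\<phi> \<in> mod_iso R V W"
    and h: "\<And>C. C \<in> carrier K \<Longrightarrow> h C \<in> carrier R"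
    and B: "is_basis K (restrict_scalars h V) B"
  shows "is_basis K (restrict_scalars h W) (\<phi> ` B)"
proof -
  interpret V: module R V by fact
  interpret W: module R W by fact
  note f = mod_isoD[OF assms(3)]
  note fV = mod_homD[OF f(1)]
  have BV: "B \<subseteq> carrier V" "finite B"
    and basis: "\<And>v. v \<in> carrier V \<Longrightarrow> \<exists>!c. c \<in> B \<rightarrow>\<^sub>E carrier K \<and> v = finsum V (\<lambda>b. h (c b) \<odot>\<^bsub>V\<^esub> b) B"
    using B by (simp_all add: is_basis_def finsum_restrict_scalars)
  have inj: "inj_on \<phi> B" using inj_on_subset[OF f(2) BV(1)] .
  have sum: "finsum W (\<lambda>b. h (c' b) \<odot>\<^bsub>W\<^esub> b) (\<phi> ` B) = \<phi> (finsum V (\<lambda>b. h (c' (\<phi> b)) \<odot>\<^bsub>V\<^esub> b) B)"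
    and sum_closed: "finsum V (\<lambda>b. h (c' (\<phi> b)) \<odot>\<^bsub>V\<^esub> b) B \<in> carrier V"
    if "\<And>b. b \<in> B \<Longrightarrow> c' (\<phi> b) \<in> carrier K" for c'
  proof -
    have *: "(\<lambda>b. h (c' (\<phi> b)) \<odot>\<^bsub>V\<^esub> b) \<in> B \<rightarrow> carrier V" using that h BV by auto
    then show "finsum V (\<lambda>b. h (c' (\<phi> b)) \<odot>\<^bsub>V\<^esub> b) B \<in> carrier V" by (rule V.finsum_closed)
    have "finsum W (\<lambda>b. h (c' b) \<odot>\<^bsub>W\<^esub> b) (\<phi> ` B) = finsum W (\<lambda>b. h (c' (\<phi> b)) \<odot>\<^bsub>W\<^esub> \<phi> b) B"
      using that h BV fV(1) by (intro W.finsum_reindex inj) auto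
    also have "\<dots> = finsum W (\<lambda>b. \<phi> (h (c' (\<phi> b)) \<odot>\<^bsub>V\<^esub> b)) B"
      using that h BV fV(1,3) by (intro W.finsum_cong') auto
    also have "\<dots> = \<phi> (finsum V (\<lambda>b. h (c' (\<phi> b)) \<odot>\<^bsub>V\<^esub> b) B)"
      using mod_hom_finsum[OF assms(1,2) f(1) *] by simp
    finally show "finsum W (\<lambda>b. h (c' b) \<odot>\<^bsub>W\<^esub> b) (\<phi> ` B) = \<dots>" .
  qed
  have "\<exists>!c. c \<in> \<phi> ` B \<rightarrow>\<^sub>E carrier K \<and> w = finsum W (\<lambda>b. h (c b) \<odot>\<^bsub>W\<^esub> b) (\<phi> ` B)"
    if w: "w \<in> carrier W" for w
  proof -
    obtain v where v: "v \<in> carrier V" "w = \<phi> v" using w f(3) by auto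
    obtain c where c: "c \<in> B \<rightarrow>\<^sub>E carrier K" "v = finsum V (\<lambda>b. h (c b) \<odot>\<^bsub>V\<^esub> b) B"
      and uniq: "\<And>c'. c' \<in> B \<rightarrow>\<^sub>E carrier K \<Longrightarrow> v = finsum V (\<lambda>b. h (c' b) \<odot>\<^bsub>V\<^esub> b) B \<Longrightarrow> c' = c"
      using basis[OF v(1)] by auto
    \<comment> \<open>The old coordinates, reindexed along the inverse of \<phi>; the restriction
      makes the function extensional, as uniqueness in \<open>is_basis\<close> demands.\<close>
    define c1 where "c1 = (\<lambda>w\<in>\<phi> ` B. c (inv_into B \<phi> w))"
    have c1: "c1 (\<phi> b) = c b" if "b \<in> B" for b using that inj by (simp add: c1_def)
    show ?thesis
    proof (rule ex1I[of _ c1], intro conjI)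
      show "c1 \<in> \<phi> ` B \<rightarrow>\<^sub>E carrier K" using c(1) by (auto simp: c1_def inj)
      have cK: "c1 (\<phi> b) \<in> carrier K" if "b \<in> B" for b using c1[OF that] c(1) that by auto
      have "finsum V (\<lambda>b. h (c1 (\<phi> b)) \<odot>\<^bsub>V\<^esub> b) B = v"
        unfolding c(2) using h c(1) BV c1 by (intro V.finsum_cong') auto
      then show "w = finsum W (\<lambda>b. h (c1 b) \<odot>\<^bsub>W\<^esub> b) (\<phi> ` B)"
        using sum[of c1, OF cK] v(2) by simp
    next
      fix c' assume c': "c' \<in> \<phi> ` B \<rightarrow>\<^sub>E carrier K \<and> w = finsum W (\<lambda>b. h (c' b) \<odot>\<^bsub>W\<^esub> b) (\<phi> ` B)"
      then have cK: "c' (\<phi> b) \<in> carrier K" if "b \<in> B" for b using that by auto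
      have "\<phi> v = \<phi> (finsum V (\<lambda>b. h (c' (\<phi> b)) \<odot>\<^bsub>V\<^esub> b) B)"
        using sum[of c', OF cK] c' v(2) by simp
      then have "v = finsum V (\<lambda>b. h (c' (\<phi> b)) \<odot>\<^bsub>V\<^esub> b) B"
        using inj_onD[OF f(2)] v(1) sum_closed[of c', OF cK] by blast
      also have "\<dots> = finsum V (\<lambda>b. h ((\<lambda>b\<in>B. c' (\<phi> b)) b) \<odot>\<^bsub>V\<^esub> b) B"
        using h cK BV by (intro V.finsum_cong') auto
      finally have "(\<lambda>b\<in>B. c' (\<phi> b)) = c" using cK by (intro uniq) auto
      then have eq: "c b = c' (\<phi> b)" if "b \<in> B" for b using that by auto
      show "c' = c1"
      proof
        fix x
        show "c' x = c1 x"
        proof (cases "x \<in> \<phi> ` B")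
          case True
          then obtain b where "b \<in> B" "x = \<phi> b" by blast
          then show ?thesis using c1 eq by simp
        next
          case False
          then show ?thesis using c' by (auto simp: c1_def PiE_iff extensional_def)
        qed
      qed
    qed
  qed
  moreover have "\<phi> ` B \<subseteq> carrier W" using BV fV(1) by auto
  ultimately show ?thesis
    using BV by (simp add: is_basis_def finsum_restrict_scalars)
qed

lemma vs_dim_iso:
  assumes "module R V" "module R W" "\<phi> \<in> mod_iso R V W"
    and "\<And>C. C \<in> carrier K \<Longrightarrow> h C \<in> carrier R"
  shows "vs_dim K (restrict_scalars h V) = vs_dim K (restrict_scalars h W)"
proof -
  \<comment> \<open>Stated for fresh element types, so that it can be applied both to \<phi> and to
    its inverse.\<close>
  have *: "\<exists>B'. card B = card B' \<and> is_basis K (restrict_scalars h W) B'"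
    if "is_basis K (restrict_scalars h V) B" "module R V" "module R W" "\<phi> \<in> mod_iso R V W"
    for V :: "('a, 'g) module" and W :: "('a, 'h) module" and \<phi> B
  proof -
    have "B \<subseteq> carrier V" using that(1) by (simp add: is_basis_def)
    then have "card (\<phi> ` B) = card B"
      using mod_isoD(2)[OF that(4)] by (intro card_image) (rule inj_on_subset)
    then show ?thesis using is_basis_iso[OF that(2,3,4) assms(4) that(1)] by metis
  qed
  have "{enat (card B) | B. is_basis K (restrict_scalars h V) B} =
        {enat (card B) | B. is_basis K (restrict_scalars h W) B}"
    using *[OF _ assms(1-3)] *[OF _ assms(2,1) mod_iso_inv[OF assms(1-3)]] by (auto; metis)
  then show ?thesis by (simp add: vs_dim_def)
qed

section \<open>Free modules, Hom modules and Ext\<close>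

lemma free_module_simps [simp]:
  "carrier (free_module R b) = {..<b} \<rightarrow>\<^sub>E carrier R"
  "\<zero>\<^bsub>free_module R b\<^esub> = (\<lambda>k\<in>{..<b}. \<zero>\<^bsub>R\<^esub>)"
  "f \<oplus>\<^bsub>free_module R b\<^esub> g = (\<lambda>k\<in>{..<b}. f k \<oplus>\<^bsub>R\<^esub> g k)"
  "r \<odot>\<^bsub>free_module R b\<^esub> f = (\<lambda>k\<in>{..<b}. r \<otimes>\<^bsub>R\<^esub> f k)"
  by (simp_all add: free_module_def)

lemma module_free_module:
  assumes "cring R"
  shows "module R (free_module R b)"
proof -
  interpret R: cring R by fact
  let ?F = "free_module R b"
  have mem: "f k \<in> carrier R" if "f \<in> carrier ?F" "k < b" for f k
    using that by auto
  have id: "(\<lambda>k\<in>{..<b}. f k) = f" if "f \<in> carrier ?F" for f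
    using that by (simp add: PiE_iff extensional_restrict)
  show ?thesis
  proof (rule moduleI)
    show "abelian_group ?F"
    proof (rule abelian_groupI)
      show "\<exists>y\<in>carrier ?F. y \<oplus>\<^bsub>?F\<^esub> x = \<zero>\<^bsub>?F\<^esub>" if "x \<in> carrier ?F" for x
        using mem[OF that]
        by (intro bexI[of _ "\<lambda>k\<in>{..<b}. \<ominus>\<^bsub>R\<^esub> x k"]) (auto intro!: restrict_ext simp: R.l_neg)
      show "x \<oplus>\<^bsub>?F\<^esub> y \<oplus>\<^bsub>?F\<^esub> z = x \<oplus>\<^bsub>?F\<^esub> (y \<oplus>\<^bsub>?F\<^esub> z)"
        if "x \<in> carrier ?F" "y \<in> carrier ?F" "z \<in> carrier ?F" for x y z
        using mem[OF that(1)] mem[OF that(2)] mem[OF that(3)]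
        by (auto intro!: restrict_ext simp: R.a_assoc)
      show "x \<oplus>\<^bsub>?F\<^esub> y = y \<oplus>\<^bsub>?F\<^esub> x" if "x \<in> carrier ?F" "y \<in> carrier ?F" for x y
        using mem[OF that(1)] mem[OF that(2)] by (auto intro!: restrict_ext simp: R.a_comm)
      show "\<zero>\<^bsub>?F\<^esub> \<oplus>\<^bsub>?F\<^esub> x = x" if "x \<in> carrier ?F" for x
      proof -
        have "\<zero>\<^bsub>?F\<^esub> \<oplus>\<^bsub>?F\<^esub> x = (\<lambda>k\<in>{..<b}. x k)"
          using mem[OF that] by (auto intro!: restrict_ext)
        then show ?thesis using id[OF that] by simp
      qed
      show "x \<oplus>\<^bsub>?F\<^esub> y \<in> carrier ?F" if "x \<in> carrier ?F" "y \<in> carrier ?F" for x y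
        using mem[OF that(1)] mem[OF that(2)] by simp
    qed simp
  next
    fix r s x y assume rx: "r \<in> carrier R" "s \<in> carrier R" "x \<in> carrier ?F" "y \<in> carrier ?F"
    note mm = rx(1,2) mem[OF rx(3)] mem[OF rx(4)]
    show "(r \<oplus>\<^bsub>R\<^esub> s) \<odot>\<^bsub>?F\<^esub> x = r \<odot>\<^bsub>?F\<^esub> x \<oplus>\<^bsub>?F\<^esub> s \<odot>\<^bsub>?F\<^esub> x"
      using mm by (auto intro!: restrict_ext simp: R.l_distr)
    show "r \<odot>\<^bsub>?F\<^esub> (x \<oplus>\<^bsub>?F\<^esub> y) = r \<odot>\<^bsub>?F\<^esub> x \<oplus>\<^bsub>?F\<^esub> r \<odot>\<^bsub>?F\<^esub> y"
      using mm by (auto intro!: restrict_ext simp: R.r_distr)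
    show "(r \<otimes>\<^bsub>R\<^esub> s) \<odot>\<^bsub>?F\<^esub> x = r \<odot>\<^bsub>?F\<^esub> (s \<odot>\<^bsub>?F\<^esub> x)"
      using mm by (auto intro!: restrict_ext simp: R.m_assoc)
    show "r \<odot>\<^bsub>?F\<^esub> x \<in> carrier ?F" using mm by simp
  next
    fix x assume x: "x \<in> carrier ?F"
    have "\<one>\<^bsub>R\<^esub> \<odot>\<^bsub>?F\<^esub> x = (\<lambda>k\<in>{..<b}. x k)"
      using mem[OF x] by (auto intro!: restrict_ext)
    then show "\<one>\<^bsub>R\<^esub> \<odot>\<^bsub>?F\<^esub> x = x" using id[OF x] by simp
  qed (rule R.is_cring)
qed

lemma Hom_module_simps [simp]:
  "carrier (Hom_module R M N) = mod_hom R M N \<inter> extensional (carrier M)"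
  "\<zero>\<^bsub>Hom_module R M N\<^esub> = (\<lambda>x\<in>carrier M. \<zero>\<^bsub>N\<^esub>)"
  "f \<oplus>\<^bsub>Hom_module R M N\<^esub> g = (\<lambda>x\<in>carrier M. f x \<oplus>\<^bsub>N\<^esub> g x)"
  "r \<odot>\<^bsub>Hom_module R M N\<^esub> f = (\<lambda>x\<in>carrier M. r \<odot>\<^bsub>N\<^esub> f x)"
  by (simp_all add: Hom_module_def)

lemma module_Hom_module:
  assumes "module R M" "module R N"
  shows "module R (Hom_module R M N)"
proof -
  interpret M: module R M by fact
  interpret N: module R N by fact
  let ?H = "Hom_module R M N"
  have ext: "f \<in> extensional (carrier M)" "g \<in> extensional (carrier M)" 
    "(\<And>x. x \<in> carrier M \<Longrightarrow> f x = g x) \<Longrightarrow> f = g"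
    if "f \<in> carrier ?H" "g \<in> carrier ?H" for f g
    using that by (auto intro: extensionalityI)
  have homD: "f x \<in> carrier N" if "f \<in> mod_hom R M N" "x \<in> carrier M" for f x
    using mod_homD(1) that by metis
  have sm: "(\<lambda>x\<in>carrier M. r \<odot>\<^bsub>N\<^esub> f x) \<in> mod_hom R M N" if "r \<in> carrier R" "f \<in> mod_hom R M N" for r f
    using that homD[OF that(2)]
    by (intro mod_homI) (simp_all add: mod_homD(2,3)[OF that(2)] N.smult_r_distr N.smult_assoc1[symmetric] M.R.m_comm)
  have ad: "(\<lambda>x\<in>carrier M. f x \<oplus>\<^bsub>N\<^esub> g x) \<in> mod_hom R M N" if "f \<in> mod_hom R M N" "g \<in> mod_hom R M N" for f g
    using homD[OF that(1)] homD[OF that(2)]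
    by (intro mod_homI) (simp_all add: mod_homD(2,3)[OF that(1)] mod_homD(2,3)[OF that(2)] N.smult_r_distr N.M.a_ac)
  have ze: "(\<lambda>x\<in>carrier M. \<zero>\<^bsub>N\<^esub>) \<in> mod_hom R M N"
    by (intro mod_homI) simp_all
  show ?thesis
  proof (rule moduleI)
    show "abelian_group ?H"
    proof (rule abelian_groupI)
      fix f assume f: "f \<in> carrier ?H"
      then show "\<exists>g\<in>carrier ?H. g \<oplus>\<^bsub>?H\<^esub> f = \<zero>\<^bsub>?H\<^esub>"
        using sm[of "\<ominus>\<^bsub>R\<^esub> \<one>\<^bsub>R\<^esub>" f]
        by (intro bexI[of _ "\<lambda>x\<in>carrier M. \<ominus>\<^bsub>R\<^esub> \<one>\<^bsub>R\<^esub> \<odot>\<^bsub>N\<^esub> f x"])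
          (auto intro!: restrict_ext simp: N.smult_l_minus homD N.M.l_neg)
    next
      fix f g k assume "f \<in> carrier ?H" "g \<in> carrier ?H" "k \<in> carrier ?H"
      then show "f \<oplus>\<^bsub>?H\<^esub> g \<oplus>\<^bsub>?H\<^esub> k = f \<oplus>\<^bsub>?H\<^esub> (g \<oplus>\<^bsub>?H\<^esub> k)"
        by (auto intro!: restrict_ext simp: homD N.M.a_assoc)
      show "f \<oplus>\<^bsub>?H\<^esub> g = g \<oplus>\<^bsub>?H\<^esub> f" using \<open>f \<in> carrier ?H\<close> \<open>g \<in> carrier ?H\<close>
        by (auto intro!: restrict_ext simp: homD N.M.a_comm)
      show "\<zero>\<^bsub>?H\<^esub> \<oplus>\<^bsub>?H\<^esub> f = f" using \<open>f \<in> carrier ?H\<close>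
        by (auto intro!: extensionalityI[of _ "carrier M"] simp: homD)
    qed (use ad ze in auto)
    show "\<one>\<^bsub>R\<^esub> \<odot>\<^bsub>?H\<^esub> f = f" if "f \<in> carrier ?H" for f
      using that by (auto intro!: extensionalityI[of _ "carrier M"] simp: homD)
  qed (use sm in \<open>auto intro!: restrict_ext simp: homD N.smult_l_distr N.smult_r_distr N.smult_assoc1 M.R.is_cring\<close>)
qed

lemma precomp_mod_hom:
  assumes "module R L" "module R M" "module R N" "\<delta> \<in> mod_hom R L M"
  shows "(\<lambda>f. \<lambda>x\<in>carrier L. f (\<delta> x)) \<in> mod_hom R (Hom_module R M N) (Hom_module R L N)"
proof -
  interpret L: module R L by fact
  show ?thesis
    by (rule mod_homI) (auto intro!: mod_homI restrict_ext simp: mod_homD[OF assms(4)] mod_homD)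
qed

lemma postcomp_mod_iso:
  assumes "module R M" "module R N" "module R N'" "\<phi> \<in> mod_iso R N N'"
  shows "(\<lambda>f. \<lambda>x\<in>carrier M. \<phi> (f x)) \<in> mod_iso R (Hom_module R M N) (Hom_module R M N')"
proof -
  interpret M: module R M by fact
  \<comment> \<open>Stated for an arbitrary homomorphism, so that it also covers composition with
    the inverse of \<phi>.\<close>
  have hom: "(\<lambda>f. \<lambda>x\<in>carrier M. \<phi> (f x)) \<in> mod_hom R (Hom_module R M N) (Hom_module R M N')"
    if "\<phi> \<in> mod_hom R N N'" for \<phi> and N :: "('a, 'h) module" and N' :: "('a, 'i) module"
    by (rule mod_homI) (auto intro!: mod_homI restrict_ext simp: mod_homD[OF that] mod_homD)
  note f = mod_isoD[OF assms(4)] and g = mod_isoD[OF mod_iso_inv[OF assms(2-4)]]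
  show ?thesis
  proof (rule mod_isoI)
    show "inj_on (\<lambda>f. \<lambda>x\<in>carrier M. \<phi> (f x)) (carrier (Hom_module R M N))"
    proof (rule inj_onI)
      fix a b assume ab: "a \<in> carrier (Hom_module R M N)" "b \<in> carrier (Hom_module R M N)"
        "(\<lambda>x\<in>carrier M. \<phi> (a x)) = (\<lambda>x\<in>carrier M. \<phi> (b x))"
      have "a x = b x" if "x \<in> carrier M" for x
      proof -
        have "\<phi> (a x) = \<phi> (b x)" using fun_cong[OF ab(3), of x] that by simp
        then show ?thesis using ab(1,2) that mod_homD(1) inj_onD[OF f(2)] by fastforce
      qed
      then show "a = b" using ab(1,2) by (auto intro: extensionalityI)
    qed
    show "carrier (Hom_module R M N') \<subseteq>
      (\<lambda>f. \<lambda>x\<in>carrier M. \<phi> (f x)) ` carrier (Hom_module R M N)"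
    proof
      fix b assume b: "b \<in> carrier (Hom_module R M N')"
      let ?a = "\<lambda>x\<in>carrier M. inv_into (carrier N) \<phi> (b x)"
      have "?a \<in> carrier (Hom_module R M N)" using mod_homD(1)[OF hom[OF g(1)] b] by simp
      moreover have "b = (\<lambda>x\<in>carrier M. \<phi> (?a x))"
        using b by (auto intro!: extensionalityI[of _ "carrier M"] simp: f_inv_into_f f(3) mod_homD)
      ultimately show "b \<in> (\<lambda>f. \<lambda>x\<in>carrier M. \<phi> (f x)) ` carrier (Hom_module R M N)" by blast
    qed
  qed (rule hom[OF f(1)])
qed

lemma Ext_complex:
  assumes "cring R" "module R N" "free_resolution R M b \<delta> \<epsilon>"
  shows "cochain_complex R (\<lambda>j. Hom_module R (free_module R (b j)) N)
           (\<lambda>j f. \<lambda>x\<in>carrier (free_module R (b (Suc j))). f (\<delta> j x))"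
proof -
  note F = module_free_module[OF assms(1)]
  have \<delta>: "\<delta> j \<in> mod_hom R (free_module R (b (Suc j))) (free_module R (b j))" for j
    using assms(3) by (simp add: free_resolution_def)
  have "a_kernel (free_module R (b (Suc j))) (free_module R (b j)) (\<delta> j) =
          \<delta> (Suc j) ` carrier (free_module R (b (Suc (Suc j))))" for j
    using assms(3) by (simp add: free_resolution_def)
  then have zero: "\<delta> j (\<delta> (Suc j) x) = \<zero>\<^bsub>free_module R (b j)\<^esub>"
    if "x \<in> carrier (free_module R (b (Suc (Suc j))))" for j x
    using that unfolding a_kernel_eq by blast
  show ?thesis
    unfolding cochain_complex_def
  proof (intro allI conjI ballI)
    fix j f assume f: "f \<in> carrier (Hom_module R (free_module R (b j)) N)"
    then have "f \<zero>\<^bsub>free_module R (b j)\<^esub> = \<zero>\<^bsub>N\<^esub>"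
      by (intro mod_hom_zero[OF F assms(2)]) simp
    then show "(\<lambda>x\<in>carrier (free_module R (b (Suc (Suc j)))).
             (\<lambda>x\<in>carrier (free_module R (b (Suc j))). f (\<delta> j x)) (\<delta> (Suc j) x)) =
           \<zero>\<^bsub>Hom_module R (free_module R (b (Suc (Suc j)))) N\<^esub>"
      using mod_homD(1)[OF \<delta>] zero
      unfolding Hom_module_simps by (intro restrict_ext) (simp del: free_module_simps)
  qed (intro module_Hom_module precomp_mod_hom F assms \<delta>)+
qed

text \<open>The choice in \<open>Ext_module\<close> depends on R and M but not on the coefficient
  module, so both sides use the same resolution, and composition with \<phi> is an isomorphism of
  Hom complexes. Without a resolution the chosen data would be arbitrary, hence the last
  assumption.\<close>

lemma Ext_module_iso:
  assumes "cring R" "module R N" "module R N'" "\<phi> \<in> mod_iso R N N'"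
    and "\<exists>b \<delta> \<epsilon>. free_resolution R M b \<delta> \<epsilon>"
  shows "module R (Ext_module R i M N) \<and> module R (Ext_module R i M N') \<and>
    (\<exists>\<Phi>. \<Phi> \<in> mod_iso R (Ext_module R i M N) (Ext_module R i M N'))"
proof -
  obtain b \<delta> \<epsilon> where eq: "(SOME (b, \<delta>, \<epsilon>). free_resolution R M b \<delta> \<epsilon>) = (b, \<delta>, \<epsilon>)"
    by (metis prod_cases3)
  have "case (SOME (b, \<delta>, \<epsilon>). free_resolution R M b \<delta> \<epsilon>) of (b, \<delta>, \<epsilon>) \<Rightarrow> free_resolution R M b \<delta> \<epsilon>"
    by (rule someI_ex) (use assms(5) in auto)
  then have res: "free_resolution R M b \<delta> \<epsilon>" by (simp add: eq)
  note C = Ext_complex[OF assms(1,2) res] and C' = Ext_complex[OF assms(1,3) res]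
  have Ext: "Ext_module R i M N = cohomology (\<lambda>j. Hom_module R (free_module R (b j)) N)
      (\<lambda>j f. \<lambda>x\<in>carrier (free_module R (b (Suc j))). f (\<delta> j x)) i" for N :: "('a, 'g) module"
    by (simp add: Ext_module_def eq)
  have Ext': "Ext_module R i M N = cohomology (\<lambda>j. Hom_module R (free_module R (b j)) N)
      (\<lambda>j f. \<lambda>x\<in>carrier (free_module R (b (Suc j))). f (\<delta> j x)) i" for N :: "('a, 'h) module"
    by (simp add: Ext_module_def eq)
  have \<delta>: "\<delta> j \<in> mod_hom R (free_module R (b (Suc j))) (free_module R (b j))" for j
    using res by (simp add: free_resolution_def)
  have "(\<lambda>Q. (\<lambda>f. \<lambda>x\<in>carrier (free_module R (b i)). \<phi> (f x)) ` Q)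
    \<in> mod_iso R (Ext_module R i M N) (Ext_module R i M N')"
    unfolding Ext Ext'
    by (rule cohomology_iso[OF C C', where \<phi> = "\<lambda>j f. \<lambda>x\<in>carrier (free_module R (b j)). \<phi> (f x)"])
      (use mod_homD(1)[OF \<delta>] in \<open>auto intro!: restrict_ext postcomp_mod_iso module_free_module assms
         simp del: free_module_simps\<close>)
  then show ?thesis
    using module_cohomology[OF C] module_cohomology[OF C'] unfolding Ext Ext' by blast
qed

section \<open>Localization, free resolutions and Bass numbers\<close>

section \<open>Localization\<close>

locale localized_module = M: module R M for R and M :: "('r, 'm) module" (structure) +
  fixes S
  assumes S_subset: "S \<subseteq> carrier R"
    and S_one: "\<one>\<^bsub>R\<^esub> \<in> S"
    and S_mult: "s \<in> S \<Longrightarrow> t \<in> S \<Longrightarrow> s \<otimes>\<^bsub>R\<^esub> t \<in> S"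
begin

lemma S_carrier: "s \<in> S \<Longrightarrow> s \<in> carrier R"
  using S_subset by blast

lemma smult_left_commute:
  "\<lbrakk>a \<in> carrier R; b \<in> carrier R; x \<in> carrier M\<rbrakk> \<Longrightarrow> a \<odot> (b \<odot> x) = b \<odot> (a \<odot> x)"
  by (simp add: M.smult_assoc1[symmetric] M.R.m_comm)

lemma mem_frac:
  "m \<in> carrier M \<Longrightarrow> s \<in> S \<Longrightarrow> (m', s') \<in> frac S M m s \<longleftrightarrow>
     m' \<in> carrier M \<and> s' \<in> S \<and> (\<exists>t\<in>S. t \<odot> (s' \<odot> m) = t \<odot> (s \<odot> m'))"
  by (auto simp: frac_def frac_rel_def)

lemma frac_self: "m \<in> carrier M \<Longrightarrow> s \<in> S \<Longrightarrow> (m, s) \<in> frac S M m s"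
  using S_one by (auto simp: mem_frac)

text \<open>The product of both multipliers and of the middle denominator witnesses the composite of
  two relations between fractions, which gives transitivity. The middle denominator has to enter
  because it cannot be cancelled.\<close>

lemma frac_eqI:
  assumes "(m', s') \<in> frac S M m s" "m \<in> carrier M" "s \<in> S"
  shows "frac S M m' s' = frac S M m s"
proof -
  have sub: "frac S M m' s' \<subseteq> frac S M m s"
    if ms: "(m', s') \<in> frac S M m s" "m \<in> carrier M" "s \<in> S" for m s m' s'
  proof (rule subrelI)
    fix m'' s'' assume "(m'', s'') \<in> frac S M m' s'"
    with ms obtain t t' where t: "t \<in> S" "t \<odot> (s' \<odot> m) = t \<odot> (s \<odot> m')"
      and t': "t' \<in> S" "t' \<odot> (s'' \<odot> m') = t' \<odot> (s' \<odot> m'')"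
      and car: "m' \<in> carrier M" "s' \<in> S" "m'' \<in> carrier M" "s'' \<in> S"
      by (auto simp: mem_frac)
    note c = S_carrier[OF t(1)] S_carrier[OF t'(1)] S_carrier[OF car(2)] S_carrier[OF car(4)]
      S_carrier[OF ms(3)] car ms(2)
    have "(t \<otimes>\<^bsub>R\<^esub> t' \<otimes>\<^bsub>R\<^esub> s') \<odot> (s'' \<odot> m) = t' \<odot> (s'' \<odot> (t \<odot> (s' \<odot> m)))"
      using c by (simp add: M.smult_assoc1 smult_left_commute)
    also have "\<dots> = t \<odot> (s \<odot> (t' \<odot> (s'' \<odot> m')))"
      unfolding t(2) using c by (simp add: smult_left_commute)
    also have "\<dots> = (t \<otimes>\<^bsub>R\<^esub> t' \<otimes>\<^bsub>R\<^esub> s') \<odot> (s \<odot> m'')"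
      unfolding t'(2) using c by (simp add: M.smult_assoc1 smult_left_commute)
    finally show "(m'', s'') \<in> frac S M m s"
      using car ms t(1) t'(1) S_mult by (auto simp: mem_frac)
  qed
  have "(m, s) \<in> frac S M m' s'"
    using assms by (auto simp: mem_frac intro: sym)
  moreover have "m' \<in> carrier M" "s' \<in> S" using assms by (auto simp: mem_frac)
  ultimately show ?thesis using sub assms by blast
qed

lemma frac_eqI1:
  assumes "m \<in> carrier M" "s \<in> S" "m' \<in> carrier M" "s' \<in> S" "s \<odot> m' = s' \<odot> m"
  shows "frac S M m' s' = frac S M m s"
  using assms S_one by (intro frac_eqI) (auto simp: mem_frac)

lemma frac_cancel:
  assumes "m \<in> carrier M" "s \<in> S" "t \<in> S"
  shows "frac S M (t \<odot> m) (t \<otimes>\<^bsub>R\<^esub> s) = frac S M m s"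
proof (rule frac_eqI1)
  show "s \<odot> (t \<odot> m) = (t \<otimes>\<^bsub>R\<^esub> s) \<odot> m"
    using assms S_carrier by (simp add: M.smult_assoc1 smult_left_commute)
qed (use assms S_mult S_carrier in simp_all)

lemma frac_eqD:
  assumes "frac S M m s = frac S M m' s'" "m \<in> carrier M" "s \<in> S" "m' \<in> carrier M" "s' \<in> S"
  shows "\<exists>t\<in>S. t \<odot> (s' \<odot> m) = t \<odot> (s \<odot> m')"
proof -
  have "(m', s') \<in> frac S M m s" using frac_self[OF assms(4,5)] by (simp add: assms(1))
  then show ?thesis using assms(2,3) by (simp add: mem_frac)
qed

lemma carrier_localization: "carrier (localization R S M) = {frac S M m s | m s. m \<in> carrier M \<and> s \<in> S}"
  by (simp add: localization_def)

lemma frac_in_localization: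
  "m \<in> carrier M \<Longrightarrow> s \<in> S \<Longrightarrow> frac S M m s \<in> carrier (localization R S M)"
  by (auto simp: localization_def)

lemma zero_localization: "\<zero>\<^bsub>localization R S M\<^esub> = frac S M \<zero> \<one>\<^bsub>R\<^esub>"
  by (simp add: localization_def)

text \<open>The operations on fractions are unions over all representatives; once the value is
  independent of the representative, the union is that value, since there is at least one
  representative.\<close>

lemma UN_frac_const:
  fixes F :: "'m \<Rightarrow> 'r \<Rightarrow> 'z set"
  assumes "m \<in> carrier M" "s \<in> S" "\<And>m' s'. (m', s') \<in> frac S M m s \<Longrightarrow> F m' s' = Z"
  shows "(\<Union>(m', s')\<in>frac S M m s. F m' s') = Z"
  using frac_self[OF assms(1,2)] assms(3) by blast

lemma add_localization:
  assumes "m \<in> carrier M" "s \<in> S" "n \<in> carrier M" "t \<in> S"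
  shows "frac S M m s \<oplus>\<^bsub>localization R S M\<^esub> frac S M n t
    = frac S M ((t \<odot> m) \<oplus> (s \<odot> n)) (s \<otimes>\<^bsub>R\<^esub> t)"
proof -
  have "frac S M ((t' \<odot> m') \<oplus> (s' \<odot> n')) (s' \<otimes>\<^bsub>R\<^esub> t') = frac S M ((t \<odot> m) \<oplus> (s \<odot> n)) (s \<otimes>\<^bsub>R\<^esub> t)"
    if "(m', s') \<in> frac S M m s" "(n', t') \<in> frac S M n t" for m' s' n' t'
  proof -
    from that assms obtain a b where a: "a \<in> S" "a \<odot> (s' \<odot> m) = a \<odot> (s \<odot> m')"
      and b: "b \<in> S" "b \<odot> (t' \<odot> n) = b \<odot> (t \<odot> n')"
      and car: "m' \<in> carrier M" "s' \<in> S" "n' \<in> carrier M" "t' \<in> S"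
      by (auto simp: mem_frac)
    note c = assms car S_carrier[OF a(1)] S_carrier[OF b(1)] S_carrier[OF car(2)] S_carrier[OF car(4)]
      S_carrier[OF assms(2)] S_carrier[OF assms(4)]
    have "(a \<otimes>\<^bsub>R\<^esub> b) \<odot> ((s' \<otimes>\<^bsub>R\<^esub> t') \<odot> ((t \<odot> m) \<oplus> (s \<odot> n)))
      = b \<odot> (t \<odot> (t' \<odot> (a \<odot> (s' \<odot> m)))) \<oplus> a \<odot> (s \<odot> (s' \<odot> (b \<odot> (t' \<odot> n))))"
      using c by (simp add: M.smult_assoc1 M.smult_r_distr smult_left_commute)
    also have "\<dots> = (a \<otimes>\<^bsub>R\<^esub> b) \<odot> ((s \<otimes>\<^bsub>R\<^esub> t) \<odot> ((t' \<odot> m') \<oplus> (s' \<odot> n')))"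
      unfolding a(2) b(2) using c by (simp add: M.smult_assoc1 M.smult_r_distr smult_left_commute)
    finally show ?thesis
      using c S_mult a b by (intro frac_eqI) (auto simp: mem_frac)
  qed
  then show ?thesis
    using assms by (simp add: localization_def) (intro UN_frac_const; simp)
qed

end

locale localized_ring = R: cring R for R (structure) +
  fixes S
  assumes S_subset: "S \<subseteq> carrier R"
    and S_one: "\<one> \<in> S"
    and S_mult: "s \<in> S \<Longrightarrow> t \<in> S \<Longrightarrow> s \<otimes> t \<in> S"

context cring begin

lemma self_module_simps:
  "carrier (self_module R) = carrier R" "x \<odot>\<^bsub>self_module R\<^esub> y = x \<otimes> y"
  "add (self_module R) = add R" "\<zero>\<^bsub>self_module R\<^esub> = \<zero>" "x \<otimes>\<^bsub>self_module R\<^esub> y = x \<otimes> y"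
  "\<one>\<^bsub>self_module R\<^esub> = \<one>"
  by (simp_all add: self_module_def)

lemma module_self_module: "module R (self_module R)"
proof (rule moduleI)
  show "abelian_group (self_module R)"
    by (rule abelian_group_if_comm_group[OF a_comm_group]) (simp_all add: self_module_simps)
qed (simp_all add: self_module_simps is_cring l_distr r_distr m_assoc)

end

context localized_ring begin

abbreviation "L \<equiv> localization R S (self_module R)"
abbreviation "fr \<equiv> frac S (self_module R)"

sublocale self: localized_module R "self_module R" S
  by (intro localized_module.intro localized_module_axioms.intro R.module_self_module S_subset S_one S_mult)

lemma S_carrier: "s \<in> S \<Longrightarrow> s \<in> carrier R"
  using S_subset by blast

lemma localized_moduleI: "module R M \<Longrightarrow> localized_module R M S"
  by (intro localized_module.intro localized_module_axioms.intro S_subset S_one S_mult)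

lemma smult_localization:
  assumes "module R M" "a \<in> carrier R" "s \<in> S" "m \<in> carrier M" "t \<in> S"
  shows "fr a s \<odot>\<^bsub>localization R S M\<^esub> frac S M m t = frac S M (a \<odot>\<^bsub>M\<^esub> m) (s \<otimes> t)"
proof -
  interpret M: localized_module R M S by (rule localized_moduleI[OF assms(1)])
  have "frac S M (a' \<odot>\<^bsub>M\<^esub> m') (s' \<otimes> t') = frac S M (a \<odot>\<^bsub>M\<^esub> m) (s \<otimes> t)"
    if "(a', s') \<in> fr a s" "(m', t') \<in> frac S M m t" for a' s' m' t'
  proof -
    from that assms obtain x y where x: "x \<in> S" "x \<otimes> (s' \<otimes> a) = x \<otimes> (s \<otimes> a')"
      and y: "y \<in> S" "y \<odot>\<^bsub>M\<^esub> (t' \<odot>\<^bsub>M\<^esub> m) = y \<odot>\<^bsub>M\<^esub> (t \<odot>\<^bsub>M\<^esub> m')"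
      and car: "a' \<in> carrier R" "s' \<in> S" "m' \<in> carrier M" "t' \<in> S"
      by (auto simp: M.mem_frac self.mem_frac R.self_module_simps)
    note c = assms car S_carrier[OF x(1)] S_carrier[OF y(1)] S_carrier[OF car(2)] S_carrier[OF car(4)]
      S_carrier[OF assms(3)] S_carrier[OF assms(5)]
    have "(x \<otimes> y) \<odot>\<^bsub>M\<^esub> ((s' \<otimes> t') \<odot>\<^bsub>M\<^esub> (a \<odot>\<^bsub>M\<^esub> m)) = (x \<otimes> (s' \<otimes> a)) \<odot>\<^bsub>M\<^esub> (y \<odot>\<^bsub>M\<^esub> (t' \<odot>\<^bsub>M\<^esub> m))"
      using c by (simp add: M.M.smult_assoc1 M.smult_left_commute)
    also have "\<dots> = (x \<otimes> y) \<odot>\<^bsub>M\<^esub> ((s \<otimes> t) \<odot>\<^bsub>M\<^esub> (a' \<odot>\<^bsub>M\<^esub> m'))"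
      unfolding x(2) y(2) using c by (simp add: M.M.smult_assoc1 M.smult_left_commute)
    finally show ?thesis
      using c S_mult x y by (intro M.frac_eqI) (auto simp: M.mem_frac)
  qed
  then show ?thesis
    using assms
    by (simp add: localization_def) (intro M.UN_frac_const self.UN_frac_const; simp add: R.self_module_simps)
qed

lemma mult_localization:
  assumes "a \<in> carrier R" "s \<in> S" "b \<in> carrier R" "t \<in> S"
  shows "fr a s \<otimes>\<^bsub>L\<^esub> fr b t = fr (a \<otimes> b) (s \<otimes> t)"
proof -
  have "fr a s \<otimes>\<^bsub>L\<^esub> fr b t = fr a s \<odot>\<^bsub>L\<^esub> fr b t"
    by (simp add: localization_def R.self_module_simps)
  then show ?thesis
    using smult_localization[OF R.module_self_module, of a s b t] assms by (simp add: R.self_module_simps)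
qed

lemma abelian_group_localization:
  assumes "module R M"
  shows "abelian_group (localization R S M)"
proof -
  interpret M: localized_module R M S by (rule localized_moduleI[OF assms])
  note c = S_carrier S_mult
  show ?thesis
  proof (rule abelian_groupI, unfold M.carrier_localization M.zero_localization; clarsimp)
    show "\<exists>k r. frac S M m s \<oplus>\<^bsub>localization R S M\<^esub> frac S M n t = frac S M k r \<and> k \<in> carrier M \<and> r \<in> S"
      if "m \<in> carrier M" "s \<in> S" "n \<in> carrier M" "t \<in> S" for m s n t
      using that c by (auto simp: M.add_localization intro!: exI)
    show "\<exists>k r. frac S M \<zero>\<^bsub>M\<^esub> \<one> = frac S M k r \<and> k \<in> carrier M \<and> r \<in> S"
      using S_one by blast
    show "frac S M m s \<oplus>\<^bsub>localization R S M\<^esub> frac S M n t \<oplus>\<^bsub>localization R S M\<^esub> frac S M k r =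
       frac S M m s \<oplus>\<^bsub>localization R S M\<^esub> (frac S M n t \<oplus>\<^bsub>localization R S M\<^esub> frac S M k r)"
      if "m \<in> carrier M" "s \<in> S" "n \<in> carrier M" "t \<in> S" "k \<in> carrier M" "r \<in> S" for m s n t k r
      using that c by (simp add: M.add_localization M.M.smult_r_distr M.M.smult_assoc1 M.smult_left_commute M.M.M.a_assoc R.m_assoc)
    show "frac S M m s \<oplus>\<^bsub>localization R S M\<^esub> frac S M n t =
       frac S M n t \<oplus>\<^bsub>localization R S M\<^esub> frac S M m s"
      if "m \<in> carrier M" "s \<in> S" "n \<in> carrier M" "t \<in> S" for m s n t
      using that c by (simp add: M.add_localization M.M.M.a_comm R.m_comm)
    show "frac S M \<zero>\<^bsub>M\<^esub> \<one> \<oplus>\<^bsub>localization R S M\<^esub> frac S M m s = frac S M m s"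
      if "m \<in> carrier M" "s \<in> S" for m s
      using that c S_one by (simp add: M.add_localization)
    show "\<exists>x. (\<exists>k r. x = frac S M k r \<and> k \<in> carrier M \<and> r \<in> S) \<and>
        x \<oplus>\<^bsub>localization R S M\<^esub> frac S M m s = frac S M \<zero>\<^bsub>M\<^esub> \<one>"
      if "m \<in> carrier M" "s \<in> S" for m s
    proof (intro exI conjI)
      show "frac S M (\<ominus>\<^bsub>M\<^esub> m) s = frac S M (\<ominus>\<^bsub>M\<^esub> m) s" "\<ominus>\<^bsub>M\<^esub> m \<in> carrier M" "s \<in> S"
        using that by auto
      show "frac S M (\<ominus>\<^bsub>M\<^esub> m) s \<oplus>\<^bsub>localization R S M\<^esub> frac S M m s = frac S M \<zero>\<^bsub>M\<^esub> \<one>"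
        using that c S_one M.frac_eqI1[of "\<zero>\<^bsub>M\<^esub>" \<one> "\<zero>\<^bsub>M\<^esub>" "s \<otimes> s"]
        by (simp add: M.add_localization M.M.smult_r_minus M.M.M.l_neg)
    qed
  qed
qed

lemma cring_localization: "cring L"
proof (rule cringI)
  note c = S_carrier S_mult
  note s = R.self_module_simps
  show "abelian_group L" by (rule abelian_group_localization[OF R.module_self_module])
  have one: "\<one>\<^bsub>L\<^esub> = fr \<one> \<one>" by (simp add: localization_def s)
  show "Group.comm_monoid L"
  proof (rule comm_monoidI, unfold self.carrier_localization s one; clarsimp)
    show "\<exists>m r. fr a s \<otimes>\<^bsub>L\<^esub> fr b t = fr m r \<and> m \<in> carrier R \<and> r \<in> S"
      if "a \<in> carrier R" "s \<in> S" "b \<in> carrier R" "t \<in> S" for a s b t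
      using that c by (auto simp: mult_localization intro!: exI)
    show "\<exists>m s. fr \<one> \<one> = fr m s \<and> m \<in> carrier R \<and> s \<in> S"
      using S_one by blast
  qed (use c S_one in \<open>simp_all add: mult_localization R.m_ac\<close>)
  fix x y z assume "x \<in> carrier L" "y \<in> carrier L" "z \<in> carrier L"
  then obtain a s b t d u where x: "x = fr a s" "a \<in> carrier R" "s \<in> S"
    "y = fr b t" "b \<in> carrier R" "t \<in> S" "z = fr d u" "d \<in> carrier R" "u \<in> S"
    by (auto simp: self.carrier_localization s)
  \<comment> \<open>The two sides of the distributive law differ by a factor u in numerator and
    denominator, so the left one is extended by u.\<close>
  have "fr ((t \<otimes> a \<oplus> s \<otimes> b) \<otimes> d) (s \<otimes> t \<otimes> u)
    = fr (u \<otimes> ((t \<otimes> a \<oplus> s \<otimes> b) \<otimes> d)) (u \<otimes> (s \<otimes> t \<otimes> u))"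
    using self.frac_cancel[of "(t \<otimes> a \<oplus> s \<otimes> b) \<otimes> d" "s \<otimes> t \<otimes> u" u] x c by (simp add: s)
  also have "u \<otimes> ((t \<otimes> a \<oplus> s \<otimes> b) \<otimes> d) = (t \<otimes> u) \<otimes> (a \<otimes> d) \<oplus> (s \<otimes> u) \<otimes> (b \<otimes> d)"
    using x c by (simp add: R.l_distr R.r_distr R.m_ac)
  also have "u \<otimes> (s \<otimes> t \<otimes> u) = s \<otimes> u \<otimes> (t \<otimes> u)"
    using x c by (simp add: R.m_ac)
  finally show "(x \<oplus>\<^bsub>L\<^esub> y) \<otimes>\<^bsub>L\<^esub> z = x \<otimes>\<^bsub>L\<^esub> z \<oplus>\<^bsub>L\<^esub> y \<otimes>\<^bsub>L\<^esub> z"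
    using x c self.add_localization by (simp add: s mult_localization)
qed

lemma module_localization:
  assumes "module R M"
  shows "module L (localization R S M)"
proof -
  interpret M: localized_module R M S by (rule localized_moduleI[OF assms])
  note c = S_carrier S_mult
  note s = R.self_module_simps
  note sm = smult_localization[OF assms]
  let ?LM = "localization R S M"
  show ?thesis
  proof (rule moduleI)
    fix P Q V W assume "P \<in> carrier L" "Q \<in> carrier L" "V \<in> carrier ?LM" "W \<in> carrier ?LM"
    then obtain a s b t m u n v where x: "P = fr a s" "a \<in> carrier R" "s \<in> S"
      "Q = fr b t" "b \<in> carrier R" "t \<in> S" "V = frac S M m u" "m \<in> carrier M" "u \<in> S"
      "W = frac S M n v" "n \<in> carrier M" "v \<in> S"
      by (auto simp: self.carrier_localization M.carrier_localization s)
    show "P \<odot>\<^bsub>?LM\<^esub> V \<in> carrier ?LM"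
      using x c by (simp add: sm M.frac_in_localization)
    show "(P \<otimes>\<^bsub>L\<^esub> Q) \<odot>\<^bsub>?LM\<^esub> V = P \<odot>\<^bsub>?LM\<^esub> (Q \<odot>\<^bsub>?LM\<^esub> V)"
      using x c by (simp add: sm mult_localization M.M.smult_assoc1 R.m_assoc)
    have "frac S M ((t \<otimes> a \<oplus> s \<otimes> b) \<odot>\<^bsub>M\<^esub> m) (s \<otimes> t \<otimes> u)
      = frac S M (u \<odot>\<^bsub>M\<^esub> ((t \<otimes> a \<oplus> s \<otimes> b) \<odot>\<^bsub>M\<^esub> m)) (u \<otimes> (s \<otimes> t \<otimes> u))"
      using M.frac_cancel[of "(t \<otimes> a \<oplus> s \<otimes> b) \<odot>\<^bsub>M\<^esub> m" "s \<otimes> t \<otimes> u" u] x c by simp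
    also have "u \<odot>\<^bsub>M\<^esub> ((t \<otimes> a \<oplus> s \<otimes> b) \<odot>\<^bsub>M\<^esub> m) = (t \<otimes> u) \<odot>\<^bsub>M\<^esub> (a \<odot>\<^bsub>M\<^esub> m) \<oplus>\<^bsub>M\<^esub> (s \<otimes> u) \<odot>\<^bsub>M\<^esub> (b \<odot>\<^bsub>M\<^esub> m)"
      using x c by (simp add: M.M.smult_l_distr M.M.smult_r_distr M.M.smult_assoc1 M.smult_left_commute)
    also have "u \<otimes> (s \<otimes> t \<otimes> u) = s \<otimes> u \<otimes> (t \<otimes> u)"
      using x c by (simp add: R.m_ac)
    finally show "(P \<oplus>\<^bsub>L\<^esub> Q) \<odot>\<^bsub>?LM\<^esub> V = P \<odot>\<^bsub>?LM\<^esub> V \<oplus>\<^bsub>?LM\<^esub> Q \<odot>\<^bsub>?LM\<^esub> V"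
      using x c self.add_localization by (simp add: s sm M.add_localization)
    have "frac S M (a \<odot>\<^bsub>M\<^esub> (v \<odot>\<^bsub>M\<^esub> m \<oplus>\<^bsub>M\<^esub> u \<odot>\<^bsub>M\<^esub> n)) (s \<otimes> (u \<otimes> v))
      = frac S M (s \<odot>\<^bsub>M\<^esub> (a \<odot>\<^bsub>M\<^esub> (v \<odot>\<^bsub>M\<^esub> m \<oplus>\<^bsub>M\<^esub> u \<odot>\<^bsub>M\<^esub> n))) (s \<otimes> (s \<otimes> (u \<otimes> v)))"
      using M.frac_cancel[of "a \<odot>\<^bsub>M\<^esub> (v \<odot>\<^bsub>M\<^esub> m \<oplus>\<^bsub>M\<^esub> u \<odot>\<^bsub>M\<^esub> n)" "s \<otimes> (u \<otimes> v)" s] x c by simp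
    also have "s \<odot>\<^bsub>M\<^esub> (a \<odot>\<^bsub>M\<^esub> (v \<odot>\<^bsub>M\<^esub> m \<oplus>\<^bsub>M\<^esub> u \<odot>\<^bsub>M\<^esub> n)) = (s \<otimes> v) \<odot>\<^bsub>M\<^esub> (a \<odot>\<^bsub>M\<^esub> m) \<oplus>\<^bsub>M\<^esub> (s \<otimes> u) \<odot>\<^bsub>M\<^esub> (a \<odot>\<^bsub>M\<^esub> n)"
      using x c by (simp add: M.M.smult_r_distr M.M.smult_assoc1 M.smult_left_commute)
    also have "s \<otimes> (s \<otimes> (u \<otimes> v)) = (s \<otimes> u) \<otimes> (s \<otimes> v)"
      using x c by (simp add: R.m_ac)
    finally show "P \<odot>\<^bsub>?LM\<^esub> (V \<oplus>\<^bsub>?LM\<^esub> W) = P \<odot>\<^bsub>?LM\<^esub> V \<oplus>\<^bsub>?LM\<^esub> P \<odot>\<^bsub>?LM\<^esub> W"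
      using x c by (simp add: sm M.add_localization)
  next
    fix V assume "V \<in> carrier ?LM"
    moreover have "\<one>\<^bsub>L\<^esub> = fr \<one> \<one>" by (simp add: localization_def s)
    ultimately show "\<one>\<^bsub>L\<^esub> \<odot>\<^bsub>?LM\<^esub> V = V"
      using S_one c by (auto simp: M.carrier_localization sm)
  qed (intro cring_localization abelian_group_localization assms)+
qed

lemma localization_iso:
  assumes "module R M" "module R N" "f \<in> mod_iso R M N"
  shows "\<exists>g. g \<in> mod_iso L (localization R S M) (localization R S N)"
proof -
  interpret M: localized_module R M S by (rule localized_moduleI[OF assms(1)])
  interpret N: localized_module R N S by (rule localized_moduleI[OF assms(2)])
  note c = S_carrier S_mult
  note f = mod_isoD[OF assms(3)]
  note fh = mod_homD[OF f(1)]
  define g where "g = (\<lambda>P. \<Union>(m, s)\<in>P. frac S N (f m) s)"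
  have g: "g (frac S M m s) = frac S N (f m) s" if ms: "m \<in> carrier M" "s \<in> S" for m s
    unfolding g_def
  proof (rule M.UN_frac_const[OF ms])
    fix m' s' assume "(m', s') \<in> frac S M m s"
    then obtain t where t: "m' \<in> carrier M" "s' \<in> S" "t \<in> S" "t \<odot>\<^bsub>M\<^esub> (s' \<odot>\<^bsub>M\<^esub> m) = t \<odot>\<^bsub>M\<^esub> (s \<odot>\<^bsub>M\<^esub> m')"
      using ms by (auto simp: M.mem_frac)
    have "t \<odot>\<^bsub>N\<^esub> (s' \<odot>\<^bsub>N\<^esub> f m) = t \<odot>\<^bsub>N\<^esub> (s \<odot>\<^bsub>N\<^esub> f m')"
      using arg_cong[OF t(4), of f] t(1-3) ms c by (simp add: fh)
    then show "frac S N (f m') s' = frac S N (f m) s"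
      using t ms fh(1) by (intro N.frac_eqI) (auto simp: N.mem_frac)
  qed
  have "g \<in> mod_iso L (localization R S M) (localization R S N)"
  proof (rule mod_isoI[OF mod_homI])
    fix V W assume V: "V \<in> carrier (localization R S M)" "W \<in> carrier (localization R S M)"
    then obtain m u n v where x: "V = frac S M m u" "m \<in> carrier M" "u \<in> S"
      "W = frac S M n v" "n \<in> carrier M" "v \<in> S" by (auto simp: M.carrier_localization)
    then show "g V \<in> carrier (localization R S N)" by (simp add: g N.frac_in_localization fh)
    show "g (V \<oplus>\<^bsub>localization R S M\<^esub> W) = g V \<oplus>\<^bsub>localization R S N\<^esub> g W"
      using x c by (simp add: g M.add_localization N.add_localization fh)
  next
    fix P V assume "P \<in> carrier L" "V \<in> carrier (localization R S M)"
    then obtain a s m u where x: "P = fr a s" "a \<in> carrier R" "s \<in> S"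
      "V = frac S M m u" "m \<in> carrier M" "u \<in> S"
      by (auto simp: self.carrier_localization M.carrier_localization R.self_module_simps)
    then show "g (P \<odot>\<^bsub>localization R S M\<^esub> V) = P \<odot>\<^bsub>localization R S N\<^esub> g V"
      using c by (simp add: g fh smult_localization[OF assms(1)] smult_localization[OF assms(2)])
  next
    show "inj_on g (carrier (localization R S M))"
    proof (rule inj_onI)
      fix V W assume V: "V \<in> carrier (localization R S M)" "W \<in> carrier (localization R S M)" "g V = g W"
      then obtain m u n v where x: "V = frac S M m u" "m \<in> carrier M" "u \<in> S"
        "W = frac S M n v" "n \<in> carrier M" "v \<in> S" by (auto simp: M.carrier_localization)
      have "frac S N (f m) u = frac S N (f n) v" using V(3) x by (simp add: g)
      then obtain t where t: "t \<in> S" "t \<odot>\<^bsub>N\<^esub> (v \<odot>\<^bsub>N\<^esub> f m) = t \<odot>\<^bsub>N\<^esub> (u \<odot>\<^bsub>N\<^esub> f n)"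
        using N.frac_eqD[of "f m" u "f n" v] x fh(1) by auto
      then have "f (t \<odot>\<^bsub>M\<^esub> (v \<odot>\<^bsub>M\<^esub> m)) = f (t \<odot>\<^bsub>M\<^esub> (u \<odot>\<^bsub>M\<^esub> n))"
        using x c by (simp add: fh)
      then have "t \<odot>\<^bsub>M\<^esub> (v \<odot>\<^bsub>M\<^esub> m) = t \<odot>\<^bsub>M\<^esub> (u \<odot>\<^bsub>M\<^esub> n)"
        using x c t by (intro inj_onD[OF f(2)]) auto
      then have "frac S M n v = frac S M m u"
        using x t by (intro M.frac_eqI) (auto simp: M.mem_frac)
      then show "V = W" using x by simp
    qed
    show "carrier (localization R S N) \<subseteq> g ` carrier (localization R S M)"
    proof
      fix W assume "W \<in> carrier (localization R S N)"
      then obtain n s where n: "n \<in> carrier N" "s \<in> S" "W = frac S N n s"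
        by (auto simp: N.carrier_localization)
      then obtain m where m: "m \<in> carrier M" "n = f m" using f(3) by blast
      then have "W = g (frac S M m s)" using n g by simp
      then show "W \<in> g ` carrier (localization R S M)"
        using m(1) n(2) M.frac_in_localization by blast
    qed
  qed
  then show ?thesis by blast
qed

end

section \<open>Free resolutions over Noetherian rings\<close>

lemma submodule_image_sub:
  assumes "module R M" "module R N" "f \<in> mod_hom R M N" "submodule H R M"
  shows "submodule (f ` H) R N"
proof -
  interpret M: module R M by fact
  have "H \<subseteq> carrier M" using M.submoduleE(1)[OF assms(4)] .
  then have "f \<in> mod_hom R (M\<lparr>carrier := H\<rparr>) N" 
    by (intro mod_homI) (auto simp: mod_homD[OF assms(3)] subset_iff)
  then show ?thesis
    using submodule_image[of R "M\<lparr>carrier := H\<rparr>" N f] submodule.submodule_is_module[OF assms(4,1)] assms(2) by simp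
qed

lemma submodule_Int:
  assumes "module R M" "submodule H R M" "submodule K R M"
  shows "submodule (H \<inter> K) R M"
proof -
  interpret M: module R M by fact
  interpret H: submodule H R M by fact
  interpret K: submodule K R M by fact
  show ?thesis
    using M.submoduleE[OF assms(2)] M.submoduleE[OF assms(3)] H.one_closed K.one_closed
    by (intro M.submoduleI) auto
qed

lemma (in module) finsum_in_submodule:
  assumes "submodule N R M" "\<And>j. j \<in> A \<Longrightarrow> h j \<in> N"
  shows "finsum M h A \<in> N"
proof (cases "finite A")
  case True
  then show ?thesis using assms(2)
  proof (induction A)
    case (insert a A)
    then have "h \<in> insert a A \<rightarrow> carrier M" using submoduleE(1)[OF assms(1)] by blast
    then have "finsum M h (insert a A) = h a \<oplus>\<^bsub>M\<^esub> finsum M h A"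
      using insert.hyps by (intro M.finsum_insert) auto
    then show ?case using insert submoduleE(5)[OF assms(1)] by simp
  qed (use subgroup.one_closed[OF submodule.axioms(1)[OF assms(1)]] in simp)
qed (use subgroup.one_closed[OF submodule.axioms(1)[OF assms(1)]] in \<open>simp add: M.finsum_infinite\<close>)

context cring begin

lemma submodule_self_imp_ideal:
  assumes "submodule I R (self_module R)"
  shows "ideal I R"
proof -
  interpret M: module R "self_module R" by (rule module_self_module)
  note I = M.submoduleE[OF assms, unfolded self_module_simps]
  show ?thesis
  proof (rule idealI[OF ring_axioms])
    show "subgroup I (add_monoid R)"
    proof (rule add.subgroupI)
      fix a assume a: "a \<in> I"
      have "\<ominus> \<one> \<otimes> a \<in> I" using I(4)[OF _ a] by blast
      moreover have "\<ominus> \<one> \<otimes> a = \<ominus> a" using a I(1) by (simp add: l_minus subset_iff)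
      ultimately show "\<ominus> a \<in> I" by simp
    qed (use I in auto)
    fix a x assume a: "a \<in> I" "x \<in> carrier R"
    then show "x \<otimes> a \<in> I" using I(4) by blast
    then show "a \<otimes> x \<in> I" using a I(1) m_comm[of a x] by auto
  qed
qed

lemma ideal_imp_submodule_self:
  assumes "ideal I R"
  shows "submodule I R (self_module R)"
proof -
  interpret M: module R "self_module R" by (rule module_self_module)
  interpret I: ideal I R by fact
  show ?thesis
  proof (rule M.submoduleI)
    fix a assume a: "a \<in> I"
    then have "a \<in> carrier R" by simp
    then have "\<ominus>\<^bsub>self_module R\<^esub> a = \<ominus> \<one> \<otimes> a"
      using M.smult_l_minus[of \<one> a] by (simp add: self_module_simps)
    then show "\<ominus>\<^bsub>self_module R\<^esub> a \<in> I" using a by (simp add: I.I_l_closed)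
  qed (auto simp: self_module_simps I.I_l_closed)
qed

lemma coord_mod_hom:
  "j < b \<Longrightarrow> (\<lambda>f. f j) \<in> mod_hom R (free_module R b) (self_module R)"
  by (rule mod_homI) (auto simp: self_module_simps)

end

text \<open>Filter N by \<open>L i\<close>, the elements whose coordinates from i on vanish. The
  i-th coordinates of \<open>L (Suc i)\<close> form an ideal, and finitely many elements of
  \<open>L (Suc i)\<close> realize generators of it; added to generators for \<open>L i\<close> they
  account for \<open>L (Suc i)\<close>. Generation is phrased through the submodules that contain T,
  which avoids writing down linear combinations.\<close>

lemma (in noetherian_ring) submodule_free_fg:
  assumes "cring R" "submodule N R (free_module R b)"
  shows "\<exists>T. finite T \<and> T \<subseteq> N \<and> (\<forall>N'. submodule N' R (free_module R b) \<and> T \<subseteq> N' \<longrightarrow> N \<subseteq> N')"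
proof -
  interpret cring R by fact
  let ?F = "free_module R b"
  interpret F: module R ?F using module_free_module[OF assms(1)] .
  interpret self: module R "self_module R" by (rule module_self_module)
  define L where "L i = {f \<in> N. \<forall>j. i \<le> j \<and> j < b \<longrightarrow> f j = \<zero>}" for i
  have Nc: "f \<in> carrier ?F" if "f \<in> N" for f
    using F.submoduleE(1)[OF assms(2)] that by blast
  have co: "f j \<in> carrier R" "(f \<ominus>\<^bsub>?F\<^esub> g) j = f j \<ominus>\<^bsub>self_module R\<^esub> g j" "(f \<oplus>\<^bsub>?F\<^esub> g) j = f j \<oplus> g j"
     "(\<ominus>\<^bsub>?F\<^esub> f) j = \<ominus>\<^bsub>self_module R\<^esub> f j" "(r \<odot>\<^bsub>?F\<^esub> f) j = r \<otimes> f j"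
    if "f \<in> carrier ?F" "g \<in> carrier ?F" "j < b" for f g j r
    using that mod_hom_diff[OF F.module_axioms self.module_axioms coord_mod_hom[OF that(3)] that(1,2)]
      mod_hom_minus[OF F.module_axioms self.module_axioms coord_mod_hom[OF that(3)] that(1)]
    by auto
  have self0: "\<ominus>\<^bsub>self_module R\<^esub> \<zero> = \<zero>"
  proof -
    have "\<ominus>\<^bsub>self_module R\<^esub> \<zero>\<^bsub>self_module R\<^esub> = \<zero>\<^bsub>self_module R\<^esub>"
      by (metis self.M.l_zero self.M.r_neg self.M.zero_closed self.M.a_inv_closed)
    then show ?thesis by (simp add: self_module_simps(4))
  qed
  have Ls: "submodule (L i) R ?F" for i
    unfolding L_def using F.submoduleE[OF assms(2)] co Nc subgroup.one_closed[OF submodule.axioms(1)[OF assms(2)]]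
    by (intro F.submoduleI) (auto simp: self0)
  have "\<exists>T. finite T \<and> T \<subseteq> N \<and> (\<forall>N'. submodule N' R ?F \<and> T \<subseteq> N' \<longrightarrow> L i \<subseteq> N')" if "i \<le> b" for i
    using that
  proof (induction i)
    case 0
    have "L 0 \<subseteq> N'" if "submodule N' R ?F" for N'
    proof
      fix f assume f: "f \<in> L 0"
      then have "f = \<zero>\<^bsub>?F\<^esub>"
        using Nc by (intro extensionalityI[of _ "{..<b}"]) (auto simp: L_def PiE_def)
      then show "f \<in> N'" using subgroup.one_closed[OF submodule.axioms(1)[OF that]] by simp
    qed
    then show ?case by (intro exI[of _ "{}"]) auto
  next
    case (Suc i)
    then obtain T where T: "finite T" "T \<subseteq> N" "\<And>N'. submodule N' R ?F \<Longrightarrow> T \<subseteq> N' \<Longrightarrow> L i \<subseteq> N'"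
      by auto
    have i: "i < b" using Suc.prems by simp
    have idl: "ideal ((\<lambda>f. f i) ` H) R" if "submodule H R ?F" for H
      by (rule submodule_self_imp_ideal[OF submodule_image_sub[OF F.module_axioms self.module_axioms
              coord_mod_hom[OF i] that]])
    obtain A where A: "A \<subseteq> carrier R" "finite A" "(\<lambda>f. f i) ` L (Suc i) = Idl A"
      using finetely_gen[OF idl[OF Ls]] by blast
    have "A \<subseteq> (\<lambda>f. f i) ` L (Suc i)" using genideal_self[OF A(1)] A(3) by simp
    then have "\<forall>a\<in>A. \<exists>f. f \<in> L (Suc i) \<and> f i = a" by auto
    then obtain g where g: "\<And>a. a \<in> A \<Longrightarrow> g a \<in> L (Suc i) \<and> g a i = a"
      using bchoice[of A "\<lambda>a f. f \<in> L (Suc i) \<and> f i = a"] by blast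
    show ?case
    proof (intro exI[of _ "T \<union> g ` A"] conjI allI impI)
      fix N' assume N': "submodule N' R ?F \<and> T \<union> g ` A \<subseteq> N'"
      \<comment> \<open>The i-th coordinates of the elements common to \<open>L (Suc i)\<close> and
        \<open>N'\<close> form an ideal too, and it contains the generators A. So every f in
        \<open>L (Suc i)\<close> agrees in coordinate i with some h in this intersection, and f - h
        drops to \<open>L i\<close>.\<close>
      have "A \<subseteq> (\<lambda>f. f i) ` (L (Suc i) \<inter> N')"
      proof
        fix a assume "a \<in> A"
        then show "a \<in> (\<lambda>f. f i) ` (L (Suc i) \<inter> N')"
          using g[of a] N' by (intro image_eqI[of _ _ "g a"]) auto
      qed
      then have "Idl A \<subseteq> (\<lambda>f. f i) ` (L (Suc i) \<inter> N')"
        by (intro genideal_minimal idl submodule_Int F.module_axioms Ls) (use N' in auto)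
      show "L (Suc i) \<subseteq> N'"
      proof
        fix f assume f: "f \<in> L (Suc i)"
        then have "f i \<in> Idl A" using A(3) by blast
        then obtain h where h: "h \<in> L (Suc i)" "h \<in> N'" "h i = f i"
          using \<open>Idl A \<subseteq> _\<close> by auto
        have c: "f \<in> carrier ?F" "h \<in> carrier ?F" using f h(1) Nc by (auto simp: L_def)
        have "f \<ominus>\<^bsub>?F\<^esub> h \<in> L i"
          unfolding L_def
        proof (intro CollectI conjI allI impI)
          show "f \<ominus>\<^bsub>?F\<^esub> h \<in> N"
            using f h(1) F.submoduleE(3,5)[OF assms(2)] by (simp add: a_minus_def L_def)
          fix j assume j: "i \<le> j \<and> j < b"
          then have "f j = h j" using f h by (cases "j = i") (auto simp: L_def)
          then show "(f \<ominus>\<^bsub>?F\<^esub> h) j = \<zero>"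
            using co(2)[OF c, of j] j self.M.r_neg[of "h j"] co(1)[OF c(2,1), of j]
            by (simp add: self_module_simps a_minus_def)
        qed
        then have "f \<ominus>\<^bsub>?F\<^esub> h \<in> N'" using T(3) N' by blast
        then have "(f \<ominus>\<^bsub>?F\<^esub> h) \<oplus>\<^bsub>?F\<^esub> h \<in> N'" using F.submoduleE(5) N' h(2) by blast
        moreover have "(f \<ominus>\<^bsub>?F\<^esub> h) \<oplus>\<^bsub>?F\<^esub> h = f"
          using c by (simp add: a_minus_def F.M.a_assoc F.M.l_neg del: free_module_simps)
        ultimately show "f \<in> N'" by simp
      qed
    qed (use T A g in \<open>auto simp: L_def\<close>)
  qed
  from this[of b] have "\<exists>T. finite T \<and> T \<subseteq> N \<and> (\<forall>N'. submodule N' R ?F \<and> T \<subseteq> N' \<longrightarrow> L b \<subseteq> N')"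
    by simp
  moreover have "L b = N" by (auto simp: L_def)
  ultimately show ?thesis by simp
qed

text \<open>Send the j-th unit vector to the j-th generator; the image is a submodule containing all
  generators. Applied to a kernel, this is one step of a free resolution.\<close>

lemma (in noetherian_ring) submodule_free_cover:
  assumes "cring R" "submodule N R (free_module R b)"
  shows "\<exists>k \<delta>. \<delta> \<in> mod_hom R (free_module R k) (free_module R b) \<and>
    \<delta> ` carrier (free_module R k) = N"
proof -
  interpret cring R by fact
  let ?F = "free_module R b"
  interpret F: module R ?F using module_free_module[OF assms(1)] .
  obtain T where "finite T \<and> T \<subseteq> N \<and> (\<forall>N'. submodule N' R ?F \<and> T \<subseteq> N' \<longrightarrow> N \<subseteq> N')"
    using submodule_free_fg[OF assms] by (rule exE)
  then have T: "finite T" "T \<subseteq> N" "\<And>N'. submodule N' R ?F \<Longrightarrow> T \<subseteq> N' \<Longrightarrow> N \<subseteq> N'"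
    by simp_all
  obtain g and k :: nat where g: "T = g ` {..<k}"
    using T(1) by (metis finite_imp_nat_seg_image_inj_on lessThan_def)
  define \<delta> where "\<delta> = (\<lambda>f. finsum ?F (\<lambda>j. f j \<odot>\<^bsub>?F\<^esub> g j) {..<k})"
  let ?G = "free_module R k"
  interpret G: module R ?G using module_free_module[OF assms(1)] .
  have gN: "g j \<in> N" if "j < k" for j using g T(2) that by auto
  have gc: "g j \<in> carrier ?F" if "j < k" for j using F.submoduleE(1)[OF assms(2)] gN[OF that] by blast
  have mem: "f j \<in> carrier R" if "f \<in> carrier ?G" "j < k" for f j using that by auto
  have pi: "(\<lambda>j. f j \<odot>\<^bsub>?F\<^esub> g j) \<in> {..<k} \<rightarrow> carrier ?F" if "f \<in> carrier ?G" for f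
    using mem[OF that] gc F.smult_closed by (auto simp del: free_module_simps)
  have \<delta>: "\<delta> \<in> mod_hom R ?G ?F"
  proof (rule mod_homI)
    show "\<delta> f \<in> carrier ?F" if "f \<in> carrier ?G" for f
      unfolding \<delta>_def by (rule F.M.finsum_closed[OF pi[OF that]])
    show "\<delta> (f \<oplus>\<^bsub>?G\<^esub> h) = \<delta> f \<oplus>\<^bsub>?F\<^esub> \<delta> h" if "f \<in> carrier ?G" "h \<in> carrier ?G" for f h
      unfolding \<delta>_def F.M.finsum_addf[OF pi[OF that(1)] pi[OF that(2)], symmetric]
    proof (rule F.M.finsum_cong')
      show "(\<lambda>j. f j \<odot>\<^bsub>?F\<^esub> g j \<oplus>\<^bsub>?F\<^esub> h j \<odot>\<^bsub>?F\<^esub> g j) \<in> {..<k} \<rightarrow> carrier ?F"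
        using pi[OF that(1)] pi[OF that(2)] by (blast intro: F.M.a_closed)
      show "(f \<oplus>\<^bsub>?G\<^esub> h) j \<odot>\<^bsub>?F\<^esub> g j = f j \<odot>\<^bsub>?F\<^esub> g j \<oplus>\<^bsub>?F\<^esub> h j \<odot>\<^bsub>?F\<^esub> g j" if "j \<in> {..<k}" for j
        using that mem[OF \<open>f \<in> _\<close>] mem[OF \<open>h \<in> _\<close>] gc F.smult_l_distr[of "f j" "h j" "g j"]
        by (simp add: free_module_def)
    qed simp
    show "\<delta> (r \<odot>\<^bsub>?G\<^esub> f) = r \<odot>\<^bsub>?F\<^esub> \<delta> f" if "r \<in> carrier R" "f \<in> carrier ?G" for r f
      unfolding \<delta>_def F.finsum_smult_ldistr[OF finite_lessThan that(1) pi[OF that(2)]]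
    proof (rule F.M.finsum_cong')
      show "(\<lambda>j. r \<odot>\<^bsub>?F\<^esub> (f j \<odot>\<^bsub>?F\<^esub> g j)) \<in> {..<k} \<rightarrow> carrier ?F"
        using pi[OF that(2)] that(1) by (blast intro: F.smult_closed)
      show "(r \<odot>\<^bsub>?G\<^esub> f) j \<odot>\<^bsub>?F\<^esub> g j = r \<odot>\<^bsub>?F\<^esub> (f j \<odot>\<^bsub>?F\<^esub> g j)" if "j \<in> {..<k}" for j
        using that mem[OF \<open>f \<in> _\<close>] gc \<open>r \<in> _\<close> F.smult_assoc1[of r "f j" "g j"]
        by (simp add: free_module_def)
    qed simp
  qed
  have im: "submodule (\<delta> ` carrier ?G) R ?F"
    by (rule submodule_image[OF G.module_axioms F.module_axioms \<delta>])
  have "T \<subseteq> \<delta> ` carrier ?G"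
  proof
    fix t assume "t \<in> T"
    then obtain j where j: "j < k" "t = g j" using g by auto
    let ?e = "\<lambda>l\<in>{..<k}. if j = l then \<one> else \<zero>"
    have "\<delta> ?e = finsum ?F (\<lambda>l. if j = l then g l else \<zero>\<^bsub>?F\<^esub>) {..<k}"
      unfolding \<delta>_def
      by (rule F.M.finsum_cong') (use gc in \<open>auto simp del: free_module_simps\<close>)
    also have "\<dots> = t"
      unfolding j(2) by (rule F.M.finsum_singleton) (use gc j in \<open>auto simp del: free_module_simps\<close>)
    finally show "t \<in> \<delta> ` carrier ?G" by (intro image_eqI[of _ _ ?e]) auto
  qed
  then have "N \<subseteq> \<delta> ` carrier ?G" using T(3)[OF im] by blast
  moreover have "\<delta> ` carrier ?G \<subseteq> N"
  proof -
    have "\<delta> f \<in> N" if "f \<in> carrier ?G" for f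
      unfolding \<delta>_def
    proof (rule F.finsum_in_submodule[OF assms(2)])
      show "f j \<odot>\<^bsub>?F\<^esub> g j \<in> N" if "j \<in> {..<k}" for j
        using that mem[OF \<open>f \<in> _\<close>] gN F.submoduleE(4)[OF assms(2)] by blast
    qed
    then show ?thesis by blast
  qed
  ultimately show ?thesis using \<delta> by blast
qed

text \<open>
  \<^const>\<open>Ext_module\<close> selects a resolution with \<open>SOME\<close>, so that nothing could be said about it
  if there were none.
\<close>

lemma (in noetherian_ring) free_resolution_exists:
  assumes "cring R" "ideal I R"
  shows "\<exists>b \<delta> \<epsilon>. free_resolution R (quot_module (self_module R) I) b \<delta> \<epsilon>"
proof -
  interpret cring R by fact
  let ?F = "free_module R" and ?Q = "quot_module (self_module R) I"
  note F = module_free_module[OF assms(1)]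
  note S = module_self_module
  note I = ideal_imp_submodule_self[OF assms(2)]
  note Q = module_quot_module[OF S I]
  \<comment> \<open>R / I is cyclic, so the resolution starts with a free module of rank one, and a
    vector is sent to the class of its only coordinate.\<close>
  define \<epsilon> where "\<epsilon> = (\<lambda>f::nat \<Rightarrow> 'a. I +>\<^bsub>self_module R\<^esub> f 0)"
  have \<epsilon>: "\<epsilon> \<in> mod_hom R (?F 1) ?Q"
  proof (rule mod_homI)
    fix f g assume "f \<in> carrier (?F 1)" "g \<in> carrier (?F 1)"
    then have fg: "f 0 \<in> carrier (self_module R)" "g 0 \<in> carrier (self_module R)"
      by (auto simp: self_module_simps)
    then show "\<epsilon> f \<in> carrier ?Q" unfolding \<epsilon>_def quot_module_simps mem_a_rcosets by blast
    show "\<epsilon> (f \<oplus>\<^bsub>?F 1\<^esub> g) = \<epsilon> f \<oplus>\<^bsub>?Q\<^esub> \<epsilon> g"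
      using quot_module_add[OF S I fg] by (simp add: \<epsilon>_def self_module_simps)
  next
    fix r f assume rf: "r \<in> carrier R" "f \<in> carrier (?F 1)"
    then have "f 0 \<in> carrier (self_module R)"
      by (auto simp: self_module_simps)
    then show "\<epsilon> (r \<odot>\<^bsub>?F 1\<^esub> f) = r \<odot>\<^bsub>?Q\<^esub> \<epsilon> f"
      using quot_module_smult[OF S I rf(1)] by (simp add: \<epsilon>_def self_module_simps)
  qed
  have surj: "\<epsilon> ` carrier (?F 1) = carrier ?Q"
  proof
    show "\<epsilon> ` carrier (?F 1) \<subseteq> carrier ?Q" using mod_homD(1)[OF \<epsilon>] by blast
    show "carrier ?Q \<subseteq> \<epsilon> ` carrier (?F 1)"
    proof
      fix q assume "q \<in> carrier ?Q"
      then obtain x where x: "x \<in> carrier R" "q = I +>\<^bsub>self_module R\<^esub> x"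
        by (auto simp: mem_a_rcosets self_module_simps)
      then have "q = \<epsilon> (\<lambda>k\<in>{..<1}. x)" by (simp add: \<epsilon>_def)
      then show "q \<in> \<epsilon> ` carrier (?F 1)" using x(1) by (intro image_eqI[of _ _ "\<lambda>k\<in>{..<1}. x"]) auto
    qed
  qed
  \<comment> \<open>A state (b, b', \<delta>) stands for a map from the free module of rank b' to
    that of rank b. \<open>P\<close> makes the first map cover the kernel of \<epsilon>,
    \<open>Y\<close> makes each later map cover the kernel of its predecessor, and dependent choice
    produces the whole sequence.\<close>
  define P where "P n x = (case x of (b, b', \<delta>) \<Rightarrow> \<delta> \<in> mod_hom R (?F b') (?F b) \<and>
     (n = 0 \<longrightarrow> b = 1 \<and> \<delta> ` carrier (?F b') = a_kernel (?F 1) ?Q \<epsilon>))"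
    for n :: nat and x :: "nat \<times> nat \<times> ((nat \<Rightarrow> 'a) \<Rightarrow> nat \<Rightarrow> 'a)"
  define Y where "Y (n::nat) x y = (case x of (b, b', \<delta>) \<Rightarrow> case y of (c, c', \<delta>') \<Rightarrow> c = b' \<and>
     \<delta>' ` carrier (?F c') = a_kernel (?F b') (?F b) \<delta>)"
    for n and x y :: "nat \<times> nat \<times> ((nat \<Rightarrow> 'a) \<Rightarrow> nat \<Rightarrow> 'a)"
  have "\<exists>f. \<forall>n. P n (f n) \<and> Y n (f n) (f (Suc n))"
  proof (rule dependent_nat_choice)
    show "\<exists>x. P 0 x"
    proof -
      obtain k \<delta> where "\<delta> \<in> mod_hom R (?F k) (?F 1) \<and> \<delta> ` carrier (?F k) = a_kernel (?F 1) ?Q \<epsilon>"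
        using submodule_free_cover[OF assms(1) submodule_a_kernel[OF F Q \<epsilon>]] by (elim exE)
      then show ?thesis by (intro exI[of _ "(1, k, \<delta>)"]) (simp add: P_def del: free_module_simps)
    qed
    show "\<exists>y. P (Suc n) y \<and> Y n x y" if "P n x" for x n
    proof (cases x)
      case (fields b b' \<delta>)
      then have "\<delta> \<in> mod_hom R (?F b') (?F b)" using that by (simp add: P_def del: free_module_simps)
      from submodule_free_cover[OF assms(1) submodule_a_kernel[OF F F this]]
      obtain k \<delta>' where "\<delta>' \<in> mod_hom R (?F k) (?F b') \<and>
          \<delta>' ` carrier (?F k) = a_kernel (?F b') (?F b) \<delta>"
        by (elim exE)
      then show ?thesis
        using fields by (intro exI[of _ "(b', k, \<delta>')"]) (simp add: P_def Y_def del: free_module_simps)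
    qed
  qed
  then obtain f where f: "\<And>n. P n (f n)" "\<And>n. Y n (f n) (f (Suc n))" by blast
  define b where "b n = fst (f n)" for n
  define \<delta> where "\<delta> n = snd (snd (f n))" for n
  have feq: "f n = (b n, b (Suc n), \<delta> n)" for n
    using f(2)[of n] unfolding Y_def b_def \<delta>_def by (simp split: prod.splits del: free_module_simps)
  have "free_resolution R ?Q b \<delta> \<epsilon>"
    unfolding free_resolution_def
  proof (intro conjI allI)
    have b0: "b 0 = 1" and k0: "\<delta> 0 ` carrier (?F (b 1)) = a_kernel (?F 1) ?Q \<epsilon>"
      using f(1)[of 0] by (simp_all add: P_def feq del: free_module_simps)
    show "\<epsilon> \<in> mod_hom R (?F (b 0)) ?Q" unfolding b0 by (rule \<epsilon>)
    show "\<epsilon> ` carrier (?F (b 0)) = carrier ?Q" unfolding b0 by (rule surj)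
    show "a_kernel (?F (b 0)) ?Q \<epsilon> = \<delta> 0 ` carrier (?F (b 1))" unfolding b0 by (rule k0[symmetric])
    show "\<delta> j \<in> mod_hom R (?F (b (Suc j))) (?F (b j))" for j
      using f(1)[of j] by (simp add: P_def feq del: free_module_simps)
    show "a_kernel (?F (b (Suc j))) (?F (b j)) (\<delta> j) = \<delta> (Suc j) ` carrier (?F (b (Suc (Suc j))))" for j
      using f(2)[of j] by (simp add: Y_def feq del: free_module_simps)
  qed
  then show ?thesis by blast
qed

section \<open>Invariance of Bass numbers\<close>

context localized_ring begin

text \<open>Contract J to R, take generators there and map them back: a / t = (1 / t)(a / 1) shows
  that their images generate J. Contraction is used a second time, on the ideal generated by these
  images, to see that it contains a / 1 for every a in the contraction of J.\<close>

lemma noetherian_localization: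
  assumes "noetherian_ring R"
  shows "noetherian_ring L"
proof -
  interpret N: noetherian_ring R by fact
  interpret L: cring L by (rule cring_localization)
  note s = R.self_module_simps
  have Lc: "fr a t \<in> carrier L" if "a \<in> carrier R" "t \<in> S" for a t
    using self.frac_in_localization that by (simp add: s)
  have add: "fr a \<one> \<oplus>\<^bsub>L\<^esub> fr b \<one> = fr (a \<oplus> b) \<one>" if "a \<in> carrier R" "b \<in> carrier R" for a b
    using self.add_localization[of a \<one> b \<one>] that S_one by (simp add: s)
  have contract: "ideal {a \<in> carrier R. fr a \<one> \<in> J} R" if J: "ideal J L" for J
  proof -
    interpret J: ideal J L by fact
    have sm: "x \<otimes> a \<in> {a \<in> carrier R. fr a \<one> \<in> J}" if "a \<in> carrier R" "fr a \<one> \<in> J" "x \<in> carrier R" for a x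
      using J.I_l_closed[OF that(2) Lc[OF that(3) S_one]] that S_one by (simp add: mult_localization)
    show ?thesis
    proof (rule idealI[OF R.ring_axioms])
      show "subgroup {a \<in> carrier R. fr a \<one> \<in> J} (add_monoid R)"
      proof (rule R.add.subgroupI)
        have "fr \<zero> \<one> \<in> J" using J.zero_closed by (simp add: self.zero_localization s)
        then show "{a \<in> carrier R. fr a \<one> \<in> J} \<noteq> {}" by blast
        fix a assume a: "a \<in> {a \<in> carrier R. fr a \<one> \<in> J}"
        then have "\<ominus> \<one> \<otimes> a \<in> {a \<in> carrier R. fr a \<one> \<in> J}" by (intro sm) auto
        moreover have "\<ominus> \<one> \<otimes> a = \<ominus> a" using a by (simp add: R.l_minus)
        ultimately show "\<ominus> a \<in> {a \<in> carrier R. fr a \<one> \<in> J}" by simp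
        fix b assume b: "b \<in> {a \<in> carrier R. fr a \<one> \<in> J}"
        then show "a \<oplus> b \<in> {a \<in> carrier R. fr a \<one> \<in> J}"
          using a J.a_closed[of "fr a \<one>" "fr b \<one>"] by (simp add: add)
      qed auto
      fix a x assume "a \<in> {a \<in> carrier R. fr a \<one> \<in> J}" "x \<in> carrier R"
      then show "x \<otimes> a \<in> {a \<in> carrier R. fr a \<one> \<in> J}" using sm by blast
      then show "a \<otimes> x \<in> {a \<in> carrier R. fr a \<one> \<in> J}"
        using R.m_comm \<open>x \<in> carrier R\<close> \<open>a \<in> _\<close> by auto
    qed
  qed
  show ?thesis
  proof (rule L.noetherian_ringI)
    fix J assume J: "ideal J L"
    then interpret J: ideal J L .
    obtain T where T: "T \<subseteq> carrier R" "finite T" "{a \<in> carrier R. fr a \<one> \<in> J} = Idl T"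
      using N.finetely_gen[OF contract[OF J]] by blast
    let ?T = "(\<lambda>a. fr a \<one>) ` T"
    have T': "?T \<subseteq> carrier L" using T(1) Lc S_one by blast
    interpret K: ideal "Idl\<^bsub>L\<^esub> ?T" L by (rule L.genideal_ideal[OF T'])
    have "T \<subseteq> {a \<in> carrier R. fr a \<one> \<in> J}" using T(3) R.genideal_self[OF T(1)] by blast
    then have "Idl\<^bsub>L\<^esub> ?T \<subseteq> J" by (intro L.genideal_minimal J) auto
    moreover have "J \<subseteq> Idl\<^bsub>L\<^esub> ?T"
    proof
      fix x assume x: "x \<in> J"
      then obtain a t where a: "a \<in> carrier R" "t \<in> S" "x = fr a t"
        using J.Icarr[OF x] by (auto simp: self.carrier_localization s)
      have "fr t \<one> \<otimes>\<^bsub>L\<^esub> fr a t = fr a \<one>"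
        using self.frac_cancel[of a \<one> t] a S_carrier S_one by (simp add: mult_localization s)
      moreover have "fr t \<one> \<otimes>\<^bsub>L\<^esub> fr a t \<in> J"
        using J.I_l_closed[OF x Lc[of t \<one>]] a S_carrier S_one by simp
      ultimately have "a \<in> Idl T" using a T(3) by auto
      moreover have "T \<subseteq> {a \<in> carrier R. fr a \<one> \<in> Idl\<^bsub>L\<^esub> ?T}"
        using T(1) L.genideal_self[OF T'] by auto
      ultimately have "fr a \<one> \<in> Idl\<^bsub>L\<^esub> ?T"
        using R.genideal_minimal[OF contract[OF K.ideal_axioms]] by blast
      then have "fr \<one> t \<otimes>\<^bsub>L\<^esub> fr a \<one> \<in> Idl\<^bsub>L\<^esub> ?T"
        using K.I_l_closed Lc[of \<one> t] a by simp
      moreover have "fr \<one> t \<otimes>\<^bsub>L\<^esub> fr a \<one> = x"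
        using a S_carrier S_one by (simp add: mult_localization)
      ultimately show "x \<in> Idl\<^bsub>L\<^esub> ?T" by simp
    qed
    ultimately show "\<exists>A\<subseteq>carrier L. finite A \<and> J = Idl\<^bsub>L\<^esub> A" using T' T(2) by blast
  qed
qed

end

lemma localized_ring_prime:
  assumes "primeideal p A"
  shows "localized_ring A (carrier A - p)"
proof -
  interpret P: primeideal p A by fact
  show ?thesis
  proof (intro localized_ring.intro localized_ring_axioms.intro P.is_cring)
    show "\<one>\<^bsub>A\<^esub> \<in> carrier A - p" using P.I_notcarr P.one_imp_carrier by auto
    show "s \<otimes>\<^bsub>A\<^esub> t \<in> carrier A - p" if "s \<in> carrier A - p" "t \<in> carrier A - p" for s t
      using that P.I_prime[of s t] by auto
  qed auto
qed

lemma ideal_local_max_ideal: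
  assumes "primeideal p A"
  shows "ideal (local_max_ideal A p) (local_ring_at A p)"
proof -
  interpret P: primeideal p A by fact
  interpret localized_ring A "carrier A - p" by (rule localized_ring_prime[OF assms])
  interpret L: cring L by (rule cring_localization)
  interpret LL: module L "self_module L" by (rule L.module_self_module)
  define m where "m = {fr a s | a s. a \<in> p \<and> s \<in> carrier A - p}"
  note s = cring.self_module_simps[OF P.is_cring]
  have mI: "fr a t \<in> m" if "a \<in> p" "t \<in> carrier A - p" for a t
    using that unfolding m_def by blast
  have mE: "\<exists>a t. x = fr a t \<and> a \<in> p \<and> t \<in> carrier A - p" if "x \<in> m" for x
    using that unfolding m_def by blast
  have sub: "m \<subseteq> carrier L"
  proof
    fix x assume "x \<in> m"
    then obtain a t where "x = fr a t" "a \<in> p" "t \<in> carrier A - p" using mE by blast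
    then show "x \<in> carrier L"
      using self.frac_in_localization[of a t] P.Icarr[of a] by (simp add: s)
  qed
  have sm: "x \<otimes>\<^bsub>L\<^esub> y \<in> m" if xy: "x \<in> carrier L" "y \<in> m" for x y
  proof -
    from xy(1) obtain a t where x: "x = fr a t" "a \<in> carrier A" "t \<in> carrier A - p"
      by (auto simp: self.carrier_localization s)
    obtain b u where y: "y = fr b u" "b \<in> p" "u \<in> carrier A - p" using mE[OF xy(2)] by blast
    have "x \<otimes>\<^bsub>L\<^esub> y = fr (a \<otimes>\<^bsub>A\<^esub> b) (t \<otimes>\<^bsub>A\<^esub> u)"
      unfolding x(1) y(1) by (rule mult_localization[OF x(2,3) P.Icarr[OF y(2)] y(3)])
    then show ?thesis using mI[OF P.I_l_closed[OF y(2) x(2)] S_mult[OF x(3) y(3)]] by simp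
  qed
  have "ideal m L"
  proof (rule idealI[OF L.ring_axioms])
    show "subgroup m (add_monoid L)"
    proof (rule L.add.subgroupI[OF sub])
      show "m \<noteq> {}" using mI[OF additive_subgroup.zero_closed[OF P.additive_subgroup_axioms] S_one] by auto
      fix x assume x: "x \<in> m"
      have "\<ominus>\<^bsub>L\<^esub> \<one>\<^bsub>L\<^esub> \<otimes>\<^bsub>L\<^esub> x \<in> m" by (rule sm[OF _ x]) simp
      moreover have "\<ominus>\<^bsub>L\<^esub> \<one>\<^bsub>L\<^esub> \<otimes>\<^bsub>L\<^esub> x = \<ominus>\<^bsub>L\<^esub> x"
        using subsetD[OF sub x] by (simp add: L.l_minus)
      ultimately show "\<ominus>\<^bsub>L\<^esub> x \<in> m" by simp
      fix y assume y: "y \<in> m"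
      obtain a t where a: "x = fr a t" "a \<in> p" "t \<in> carrier A - p" using mE[OF x] by blast
      obtain b u where b: "y = fr b u" "b \<in> p" "u \<in> carrier A - p" using mE[OF y] by blast
      have "x \<oplus>\<^bsub>L\<^esub> y = fr (u \<otimes>\<^bsub>A\<^esub> a \<oplus>\<^bsub>A\<^esub> t \<otimes>\<^bsub>A\<^esub> b) (t \<otimes>\<^bsub>A\<^esub> u)"
        using self.add_localization[of a t b u] a b P.Icarr by (simp add: s)
      moreover have "u \<otimes>\<^bsub>A\<^esub> a \<oplus>\<^bsub>A\<^esub> t \<otimes>\<^bsub>A\<^esub> b \<in> p"
        using a b by (intro additive_subgroup.a_closed[OF P.additive_subgroup_axioms] P.I_l_closed) simp_all
      ultimately show "x \<oplus>\<^bsub>L\<^esub> y \<in> m" using mI S_mult[OF a(3) b(3)] by simp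
    qed
    fix x y assume xy: "x \<in> m" "y \<in> carrier L"
    show "y \<otimes>\<^bsub>L\<^esub> x \<in> m" by (rule sm[OF xy(2,1)])
    then show "x \<otimes>\<^bsub>L\<^esub> y \<in> m"
      using L.m_comm[OF subsetD[OF sub xy(1)] xy(2)] by simp
  qed
  then show ?thesis by (simp add: m_def local_max_ideal_def local_ring_at_def)
qed

text \<open>An isomorphism passes to the localizations, from there to Ext, and finally to bases over
  the residue field. The residue module is the quotient of the Noetherian ring \<open>L\<close> by
  an ideal, so it has a resolution of the kind that \<open>Ext_module\<close> expects.\<close>

lemma bass_number_iso:
  assumes "noetherian_ring A" "primeideal p A" "module A N" "module A N'" "f \<in> mod_iso A N N'"
  shows "bass_number A p i N = bass_number A p i N'"
proof -
  interpret localized_ring A "carrier A - p" by (rule localized_ring_prime[OF assms(2)])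
  have L: "local_ring_at A p = L" by (simp add: local_ring_at_def)
  interpret L: cring L by (rule cring_localization)
  interpret LN: noetherian_ring L by (rule noetherian_localization[OF assms(1)])
  have m: "ideal (local_max_ideal A p) L" using ideal_local_max_ideal[OF assms(2)] by (simp add: L)
  interpret m: ideal "local_max_ideal A p" L by (rule m)
  obtain g where g: "g \<in> mod_iso L (localization A (carrier A - p) N) (localization A (carrier A - p) N')"
    using localization_iso[OF assms(3-5)] by blast
  have res: "\<exists>b \<delta> \<epsilon>. free_resolution L (residue_module A p) b \<delta> \<epsilon>"
    unfolding residue_module_def L by (rule LN.free_resolution_exists[OF L.is_cring m])
  have "module L (Ext_module L i (residue_module A p) (localization A (carrier A - p) N)) \<and>
     module L (Ext_module L i (residue_module A p) (localization A (carrier A - p) N')) \<and>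
    (\<exists>\<Phi>. \<Phi> \<in> mod_iso L (Ext_module L i (residue_module A p) (localization A (carrier A - p) N))
                        (Ext_module L i (residue_module A p) (localization A (carrier A - p) N')))"
    by (rule Ext_module_iso[OF L.is_cring module_localization[OF assms(3)]
          module_localization[OF assms(4)] g res])
  \<comment> \<open>A class in the residue field is a nonempty subset of \<open>L\<close>, so the
    representative picked in it is a legitimate scalar.\<close>
  moreover have "(SOME r. r \<in> C) \<in> carrier L" if C: "C \<in> carrier (residue_field A p)" for C
  proof -
    obtain x where x: "x \<in> carrier L" "C = local_max_ideal A p +>\<^bsub>L\<^esub> x"
      using C by (auto simp: residue_field_def L FactRing_def mem_a_rcosets)
    have "x \<in> C" using x m.a_rcos_self by simp
    then have "(SOME r. r \<in> C) \<in> C" by (rule someI)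
    moreover have "C \<subseteq> carrier L" using x m.Icarr by (auto simp: a_r_coset_def')
    ultimately show ?thesis by blast
  qed
  ultimately show ?thesis
    unfolding bass_number_def L by (blast intro: vs_dim_iso)
qed

section \<open>Chain conditions for terms, homogeneous components and division in graded
  injectives\<close>

section \<open>Noetherianity for monomials\<close>

lemma ring_of_type_algebra_simps [simp]:
  "carrier (ring_of_type_algebra :: 'b::comm_ring_1 ring) = UNIV"
  "x \<otimes>\<^bsub>ring_of_type_algebra\<^esub> y = x * (y :: 'b)"
  "\<one>\<^bsub>ring_of_type_algebra\<^esub> = (1 :: 'b)"
  "\<zero>\<^bsub>ring_of_type_algebra\<^esub> = (0 :: 'b)"
  "x \<oplus>\<^bsub>ring_of_type_algebra\<^esub> y = x + (y :: 'b)"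
  by (simp_all add: ring_of_type_algebra_def)

lemma cring_ring_of_type_algebra: "cring (ring_of_type_algebra :: 'b::comm_ring_1 ring)"
  by (rule cring_from_type_algebra)

lemma ring_of_type_algebra_minus [simp]: "\<ominus>\<^bsub>ring_of_type_algebra\<^esub> x = - (x :: 'b::comm_ring_1)"
proof -
  interpret cring "ring_of_type_algebra :: 'b ring" by (rule cring_ring_of_type_algebra)
  show ?thesis using minus_equality[of "-x" x] by simp
qed

lemma ideal_ring_of_type_algebra_iff:
  "ideal I (ring_of_type_algebra :: 'b::comm_ring_1 ring) \<longleftrightarrow>
     0 \<in> I \<and> (\<forall>x\<in>I. \<forall>y\<in>I. x + y \<in> I) \<and> (\<forall>r. \<forall>x\<in>I. r * x \<in> I)" (is "_ \<longleftrightarrow> ?R")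
proof
  assume "ideal I (ring_of_type_algebra :: 'b::comm_ring_1 ring)"
  then interpret I: ideal I "ring_of_type_algebra :: 'b ring" .
  show ?R
    using additive_subgroup.zero_closed[OF I.additive_subgroup_axioms]
      additive_subgroup.a_closed[OF I.additive_subgroup_axioms] I.I_l_closed by simp
next
  assume R: ?R
  interpret cring "ring_of_type_algebra :: 'b ring" by (rule cring_ring_of_type_algebra)
  show "ideal I (ring_of_type_algebra :: 'b::comm_ring_1 ring)"
  proof (rule idealI[OF ring_axioms])
    show "subgroup I (add_monoid (ring_of_type_algebra :: 'b ring))"
    proof (rule add.subgroupI)
      show "\<ominus>\<^bsub>ring_of_type_algebra\<^esub> a \<in> I" if "a \<in> I" for a
        using R that by (metis ring_of_type_algebra_minus mult_minus1)
    qed (use R in auto)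
    fix a x assume "a \<in> I"
    then have "x * a \<in> I" using R by blast
    then show "x \<otimes>\<^bsub>ring_of_type_algebra\<^esub> a \<in> I" "a \<otimes>\<^bsub>ring_of_type_algebra\<^esub> x \<in> I"
      by (simp_all add: mult.commute)
  qed
qed

text \<open>Every sequence has a monotone subsequence; if that one decreases, it is constant from
  the place on where it takes its minimum.\<close>

lemma nat_seq_incseq_subseq:
  fixes f :: "nat \<Rightarrow> nat"
  shows "\<exists>r. strict_mono r \<and> incseq (\<lambda>i. f (r i))"
proof -
  obtain s where s: "strict_mono s" "monoseq (\<lambda>i. f (s i))"
    using seq_monosub[of f] by auto
  show ?thesis
  proof (cases "incseq (\<lambda>i. f (s i))")
    case False
    then have dec: "decseq (\<lambda>i. f (s i))" using s(2) by (simp add: monoseq_iff)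
    obtain N where N: "\<And>i. f (s N) \<le> f (s i)"
      using ex_has_least_nat[of "\<lambda>_. True" 0 "\<lambda>i. f (s i)"] by auto
    have "f (s (i + N)) = f (s N)" for i
      using N[of "i + N"] decseqD[OF dec, of N "i + N"] by simp
    moreover have "strict_mono (\<lambda>i. s (i + N))" using s(1) by (simp add: strict_mono_def)
    ultimately show ?thesis by (intro exI[of _ "\<lambda>i. s (i + N)"]) (simp add: incseq_def)
  qed (use s in blast)
qed

text \<open>Refine the sequence once for each coordinate; the coordinates treated before stay
  monotone on every further subsequence.\<close>

lemma Dickson_subseq:
  fixes m :: "nat \<Rightarrow> 'n::finite \<Rightarrow> nat"
  shows "\<exists>r. strict_mono r \<and> (\<forall>k. incseq (\<lambda>i. m (r i) k))"
proof -
  have "\<exists>r. strict_mono r \<and> (\<forall>k\<in>K. incseq (\<lambda>i. m (r i) k))" if "finite K" for K :: "'n set"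
    using that
  proof induction
    case empty
    show ?case by (intro exI[of _ id]) (simp add: strict_mono_def)
  next
    case (insert k K)
    then obtain r where r: "strict_mono r" "\<forall>k\<in>K. incseq (\<lambda>i. m (r i) k)" by blast
    obtain s where s: "strict_mono s" "incseq (\<lambda>i. m (r (s i)) k)"
      using nat_seq_incseq_subseq[of "\<lambda>i. m (r i) k"] by blast
    have "incseq (\<lambda>i. m (r (s i)) k')" if "k' \<in> K" for k'
      using r(2) that strict_mono_mono[OF s(1)] by (simp add: incseq_def mono_def)
    moreover have "strict_mono (\<lambda>i. r (s i))" using r(1) s(1) by (simp add: strict_mono_def)
    ultimately show ?case using s(2) by (intro exI[of _ "\<lambda>i. r (s i)"]) simp
  qed
  from this[of UNIV] show ?thesis by simp
qed

text \<open>Along a subsequence whose exponents increase in every coordinate, the ideals generated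
  by the coefficients form an ascending chain in A, which stops. The next coefficient is then a
  combination of earlier ones, and each earlier term reaches the present exponent after
  multiplication by a monomial. This Hilbert basis theorem for sequences of terms serves both for
  the generators of I and for annihilators; it matters that l does not depend on J.\<close>

lemma monomial_sequence_noetherian:
  fixes m :: "nat \<Rightarrow> ('n::finite \<Rightarrow>\<^sub>0 nat)" and a :: "nat \<Rightarrow> 'a::idom"
  assumes "noetherian_ring (base_ring :: 'a ring)"
  shows "\<exists>l. \<forall>J. ideal J poly_ring \<longrightarrow> (\<forall>j<l. Poly_Mapping.single (m j) (a j) \<in> J) \<longrightarrow>
    Poly_Mapping.single (m l) (a l) \<in> J"
proof -
  interpret A: noetherian_ring "base_ring :: 'a ring" by fact
  obtain r where r: "strict_mono r" "\<And>k. incseq (\<lambda>i. Poly_Mapping.lookup (m (r i)) k)"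
    using Dickson_subseq[of "\<lambda>i. Poly_Mapping.lookup (m i)"] by blast
  define J where "J N = genideal base_ring ((\<lambda>i. a (r i)) ` {..<N})" for N :: nat
  have J: "ideal (J N) base_ring" "(\<lambda>i. a (r i)) ` {..<N} \<subseteq> J N" for N
    unfolding J_def by (intro A.genideal_ideal A.genideal_self; simp)+
  have mono: "J N \<subseteq> J N'" if "N \<le> N'" for N N'
    unfolding J_def[of N] using J[of N'] that by (intro A.genideal_minimal) auto
  have "\<Union> (range J) \<in> range J"
  proof (rule A.ideal_chain_is_trivial)
    show "subset.chain {I. ideal I base_ring} (range J)"
    proof -
      have "J N \<subseteq> J N' \<or> J N' \<subseteq> J N" for N N' using mono nat_le_linear by metis
      then show ?thesis using J(1) by (auto simp: subset_chain_def)
    qed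
  qed simp
  then obtain N where N: "\<Union> (range J) = J N" by auto
  \<comment> \<open>This coefficient lies in the next ideal of the chain, hence in the union, which
    is \<open>J N\<close>. So \<open>r N\<close> is the desired index.\<close>
  have "a (r N) \<in> J N" using J(2)[of "Suc N"] N by auto
  show ?thesis
  proof (intro exI[of _ "r N"] allI impI)
    fix I :: "('n, 'a) mpoly set"
    assume I: "ideal I poly_ring" "\<forall>j<r N. Poly_Mapping.single (m j) (a j) \<in> I"
    note I' = I(1)[unfolded ideal_ring_of_type_algebra_iff]
    have K: "ideal {b. Poly_Mapping.single (m (r N)) b \<in> I} base_ring"
      unfolding ideal_ring_of_type_algebra_iff
    proof (intro conjI ballI allI)
      fix s x assume "x \<in> {b. Poly_Mapping.single (m (r N)) b \<in> I}"
      then have "Poly_Mapping.single 0 s * Poly_Mapping.single (m (r N)) x \<in> I" using I' by blast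
      then show "s * x \<in> {b. Poly_Mapping.single (m (r N)) b \<in> I}" by (simp add: mult_single)
    qed (use I' in \<open>auto simp: single_add\<close>)
    have "a (r i) \<in> {b. Poly_Mapping.single (m (r N)) b \<in> I}" if "i < N" for i
    proof -
      \<comment> \<open>The exponents increase along the subsequence, so the truncated subtraction
        is a true difference.\<close>
      have eq: "m (r N) = (m (r N) - m (r i)) + m (r i)"
        using incseqD[OF r(2), of i N] that
        by (intro poly_mapping_eqI) (simp add: lookup_add lookup_minus)
      have "Poly_Mapping.single (m (r N) - m (r i)) 1 * Poly_Mapping.single (m (r i)) (a (r i)) \<in> I"
        using I(2) I' that r(1) by (simp add: strict_mono_less)
      then show ?thesis by (simp add: mult_single flip: eq)
    qed
    then have "J N \<subseteq> {b. Poly_Mapping.single (m (r N)) b \<in> I}"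
      unfolding J_def by (intro A.genideal_minimal K) auto
    then show "Poly_Mapping.single (m (r N)) (a (r N)) \<in> I" using \<open>a (r N) \<in> J N\<close> by blast
  qed
qed

text \<open>If no finite part of Q sufficed, one could forever choose a member of Q outside the
  ideal of the earlier choices, against the chain condition for sequences of terms. Taking the
  generators from Q keeps them terms, hence homogeneous.\<close>

lemma C_monomial_ideal_finite_gens:
  fixes I :: "('n::finite, 'a::idom) mpoly set"
  assumes "noetherian_ring (base_ring :: 'a ring)" "C_monomial_ideal I"
  shows "\<exists>Q. finite Q \<and> Q \<subseteq> {Poly_Mapping.single m a | m a. True} \<and> I = genideal poly_ring Q"
proof -
  interpret R: cring "poly_ring :: ('n, 'a) mpoly ring" by (rule cring_ring_of_type_algebra)
  obtain Q where Q: "Q \<subseteq> {Poly_Mapping.single m a | m a. True}" "I = genideal poly_ring Q"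
    using assms(2) by (auto simp: C_monomial_ideal_def)
  have "\<exists>Q0. finite Q0 \<and> Q0 \<subseteq> Q \<and> Q \<subseteq> genideal poly_ring Q0"
  proof (rule ccontr)
    assume "\<nexists>Q0. finite Q0 \<and> Q0 \<subseteq> Q \<and> Q \<subseteq> genideal poly_ring Q0"
    then have "\<forall>Q0. \<exists>q. finite Q0 \<and> Q0 \<subseteq> Q \<longrightarrow> q \<in> Q \<and> q \<notin> genideal poly_ring Q0" by blast
    then obtain h where h: "\<And>Q0. finite Q0 \<Longrightarrow> Q0 \<subseteq> Q \<Longrightarrow> h Q0 \<in> Q \<and> h Q0 \<notin> genideal poly_ring Q0"
      by metis
    \<comment> \<open>\<open>T n\<close> collects the first n choices, where \<open>h\<close>
      selects an element of Q outside the ideal generated by a given finite part.\<close>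
    define T where "T = rec_nat {} (\<lambda>_ T. insert (h T) T)"
    have T0: "T 0 = {}" and TS: "T (Suc n) = insert (h (T n)) (T n)" for n
      by (simp_all add: T_def)
    have T: "finite (T n) \<and> T n \<subseteq> Q" for n
      by (induction n) (auto simp: T0 TS h)
    have Tmem: "h (T j) \<in> T n" if "j < n" for j n
      using that by (induction n) (auto simp: TS less_Suc_eq)
    have hT: "h (T j) \<in> Q" "h (T j) \<notin> genideal poly_ring (T j)" for j
      using h[of "T j"] T[of j] by simp_all
    have "\<exists>ma. h (T j) = Poly_Mapping.single (fst ma) (snd ma)" for j
    proof -
      obtain m a where "h (T j) = Poly_Mapping.single m a"
        using subsetD[OF Q(1) hT(1)[of j]] by auto
      then show ?thesis by (intro exI[of _ "(m, a)"]) simp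
    qed
    then obtain ma where "\<forall>j. h (T j) = Poly_Mapping.single (fst (ma j)) (snd (ma j))"
      using choice[of "\<lambda>j ma. h (T j) = Poly_Mapping.single (fst ma) (snd ma)"] by blast
    then obtain l where l: "\<And>J. ideal J poly_ring \<Longrightarrow> (\<forall>j<l. h (T j) \<in> J) \<Longrightarrow> h (T l) \<in> J"
      using monomial_sequence_noetherian[OF assms(1), of "\<lambda>j. fst (ma j)" "\<lambda>j. snd (ma j)"] by auto
    have "h (T l) \<in> genideal poly_ring (T l)"
      using R.genideal_ideal[of "T l"] R.genideal_self[of "T l"] Tmem by (intro l) auto
    then show False using hT(2) by contradiction
  qed
  then obtain Q0 where Q0: "finite Q0" "Q0 \<subseteq> Q" "Q \<subseteq> genideal poly_ring Q0" by blast
  have "genideal poly_ring Q = genideal poly_ring Q0"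
    using Q0 R.genideal_self[of Q] by (intro equalityI R.genideal_minimal R.genideal_ideal) auto
  then show ?thesis using Q0 Q by (intro exI[of _ Q0]) auto
qed

section \<open>Homogeneous components\<close>

lemma poly_component_iff:
  "f \<in> poly_component w \<longleftrightarrow> (\<forall>m. Poly_Mapping.lookup f m \<noteq> 0 \<longrightarrow> (\<lambda>k. int (Poly_Mapping.lookup m k)) = w)"
  by (auto simp: poly_component_def in_keys_iff fun_eq_iff)

lemma poly_component_single:
  "(\<lambda>k. int (Poly_Mapping.lookup m k)) = w \<Longrightarrow> Poly_Mapping.single m a \<in> poly_component w"
  by (auto simp: poly_component_iff lookup_single when_def)

text \<open>The multidegree determines the exponent, so homogeneous elements are single terms or
  zero. This is what makes the chain condition for terms applicable to them.\<close>

lemma poly_component_cases: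
  assumes "f \<in> poly_component w"
  shows "f = 0 \<or> (\<exists>m a. f = Poly_Mapping.single m a \<and> (\<lambda>k. int (Poly_Mapping.lookup m k)) = w)"
proof (cases "f = 0")
  case False
  then obtain m where "Poly_Mapping.lookup f m \<noteq> 0"
    by (metis lookup_zero poly_mapping_eqI)
  then have m: "(\<lambda>k. int (Poly_Mapping.lookup m k)) = w" using assms by (auto simp: poly_component_iff)
  have "m' = m" if "Poly_Mapping.lookup f m' \<noteq> 0" for m'
  proof -
    have "(\<lambda>k. int (Poly_Mapping.lookup m' k)) = w" using assms that by (auto simp: poly_component_iff)
    then show ?thesis using m by (auto intro!: poly_mapping_eqI simp: fun_eq_iff) (metis of_nat_eq_iff)
  qed
  then have "f = Poly_Mapping.single m (Poly_Mapping.lookup f m)"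
    by (intro poly_mapping_eqI) (auto simp: lookup_single when_def)
  then show ?thesis using m by blast
qed simp

lemma poly_component_zero [simp]: "0 \<in> poly_component w"
  by (simp add: poly_component_iff)

lemma poly_component_add: "f \<in> poly_component w \<Longrightarrow> g \<in> poly_component w \<Longrightarrow> f + g \<in> poly_component w"
  by (auto simp: poly_component_iff lookup_add) (metis add_0)

lemma poly_component_uminus: "f \<in> poly_component w \<Longrightarrow> - f \<in> poly_component w"
  by (auto simp: poly_component_iff)

lemma poly_component_mult:
  assumes "f \<in> poly_component w" "g \<in> poly_component v"
  shows "f * g \<in> poly_component (\<lambda>k. w k + v k)"
  using poly_component_cases[OF assms(1)] poly_component_cases[OF assms(2)]
  by (auto simp: mult_single lookup_add intro!: poly_component_single)

lemma poly_component_one: "1 \<in> poly_component (\<lambda>k. 0)"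
  using poly_component_single[of 0 "\<lambda>k. 0" 1] by simp

lemma poly_component_power:
  assumes "f \<in> poly_component w"
  shows "f ^ t \<in> poly_component (\<lambda>k. int t * w k)"
proof (induction t)
  case 0 then show ?case using poly_component_one by simp
next
  case (Suc t)
  then show ?case using poly_component_mult[OF assms Suc] by (simp add: algebra_simps)
qed

lift_definition hpart :: "('n, 'a::idom) mpoly \<Rightarrow> ('n \<Rightarrow> int) \<Rightarrow> ('n, 'a) mpoly" is
  "\<lambda>f w m. if (\<lambda>k. int (Poly_Mapping.lookup m k)) = w then f m else 0"
  by (rule finite_subset[rotated], assumption) auto

lemma lookup_hpart:
  "Poly_Mapping.lookup (hpart f w) m =
    (if (\<lambda>k. int (Poly_Mapping.lookup m k)) = w then Poly_Mapping.lookup f m else 0)"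
  by transfer simp

lemma hpart_in: "hpart f w \<in> poly_component w"
  by (auto simp: poly_component_iff lookup_hpart)

definition hcomp :: "('r, 'm) module \<Rightarrow> ('i \<Rightarrow> 'm set) \<Rightarrow> 'm \<Rightarrow> 'i \<Rightarrow> 'm" where
  "hcomp M G x = (THE c. (\<forall>u. c u \<in> G u) \<and> finite {u. c u \<noteq> \<zero>\<^bsub>M\<^esub>} \<and>
        x = finsum M c {u. c u \<noteq> \<zero>\<^bsub>M\<^esub>})"

locale graded =
  fixes M :: "(('n::finite, 'a::idom) mpoly, 'e) module" (structure) and G :: "('n \<Rightarrow> int) \<Rightarrow> 'e set"
  assumes graded: "graded_module M G"
begin

sublocale module poly_ring M
  using graded by (simp add: graded_module_def)

lemma smult_closed_type [simp]: "x \<in> carrier M \<Longrightarrow> r \<odot> x \<in> carrier M"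
  by simp

lemma smult_mult: "x \<in> carrier M \<Longrightarrow> (r * s) \<odot> x = r \<odot> (s \<odot> x)"
  using smult_assoc1[of r s x] by simp

lemma smult_plus: "x \<in> carrier M \<Longrightarrow> (r + s) \<odot> x = r \<odot> x \<oplus> s \<odot> x"
  using smult_l_distr[of r s x] by simp

lemma smult_1: "x \<in> carrier M \<Longrightarrow> 1 \<odot> x = x"
  using smult_one[of x] by simp

lemma smult_0: "x \<in> carrier M \<Longrightarrow> 0 \<odot> x = \<zero>"
  using smult_l_null[of x] by simp

lemma smult_zero [simp]: "r \<odot> \<zero> = \<zero>"
  using smult_r_null[of r] by simp

lemma smult_add: "x \<in> carrier M \<Longrightarrow> y \<in> carrier M \<Longrightarrow> r \<odot> (x \<oplus> y) = r \<odot> x \<oplus> r \<odot> y"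
  using smult_r_distr[of r x y] by simp

lemma smult_uminus: "x \<in> carrier M \<Longrightarrow> r \<odot> (\<ominus> x) = \<ominus> (r \<odot> x)"
  using smult_r_minus[of r x] by simp

lemma smult_diff: "x \<in> carrier M \<Longrightarrow> y \<in> carrier M \<Longrightarrow> r \<odot> (x \<ominus> y) = r \<odot> x \<ominus> r \<odot> y"
  by (simp add: a_minus_def smult_add smult_uminus)

lemma minus_smult: "x \<in> carrier M \<Longrightarrow> (- r) \<odot> x = \<ominus> (r \<odot> x)"
  using smult_l_minus[of r x] by simp

lemma smult_commute: "x \<in> carrier M \<Longrightarrow> r \<odot> (s \<odot> x) = s \<odot> (r \<odot> x)"
  by (simp add: mult.commute flip: smult_mult)

lemma ideal_annihilator: "x \<in> carrier M \<Longrightarrow> ideal {r. r \<odot> x = \<zero>} poly_ring"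
  unfolding ideal_ring_of_type_algebra_iff by (auto simp: smult_plus smult_mult smult_0)

lemma subgr: "subgroup (G u) (add_monoid M)"
  using graded by (simp add: graded_module_def)

lemma G_carrier: "x \<in> G u \<Longrightarrow> x \<in> carrier M"
  using subgroup.mem_carrier[OF subgr] by simp

lemma G_zero [simp]: "\<zero> \<in> G u"
  using subgroup.one_closed[OF subgr] by simp

lemma G_add: "x \<in> G u \<Longrightarrow> y \<in> G u \<Longrightarrow> x \<oplus> y \<in> G u"
  using subgroup.m_closed[OF subgr] by simp

lemma G_uminus: "x \<in> G u \<Longrightarrow> \<ominus> x \<in> G u"
  using subgroup.m_inv_closed[OF subgr] by (simp add: a_inv_def)

lemma G_diff: "x \<in> G u \<Longrightarrow> y \<in> G u \<Longrightarrow> x \<ominus> y \<in> G u"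
  by (simp add: a_minus_def G_add G_uminus)

lemma G_smult: "r \<in> poly_component w \<Longrightarrow> x \<in> G u \<Longrightarrow> v = (\<lambda>k. w k + u k) \<Longrightarrow> r \<odot> x \<in> G v"
  using graded by (simp add: graded_module_def)

lemma hcomp:
  assumes "x \<in> carrier M"
  shows "hcomp M G x u \<in> G u" "finite {u. hcomp M G x u \<noteq> \<zero>}"
    "x = finsum M (hcomp M G x) {u. hcomp M G x u \<noteq> \<zero>}"
proof -
  have ex: "\<exists>!c. (\<forall>u. c u \<in> G u) \<and> finite {u. c u \<noteq> \<zero>} \<and> x = finsum M c {u. c u \<noteq> \<zero>}"
    using graded assms by (simp add: graded_module_def)
  show "hcomp M G x u \<in> G u" "finite {u. hcomp M G x u \<noteq> \<zero>}"
    "x = finsum M (hcomp M G x) {u. hcomp M G x u \<noteq> \<zero>}"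
    using theI'[OF ex] unfolding hcomp_def by simp_all
qed

lemma hcomp_carrier [simp]: "x \<in> carrier M \<Longrightarrow> hcomp M G x u \<in> carrier M"
  by (rule G_carrier[OF hcomp(1)])

lemma hcompI:
  assumes "finite V" "\<And>u. c u \<in> G u" "\<And>u. u \<notin> V \<Longrightarrow> c u = \<zero>" "x = finsum M c V"
  shows "hcomp M G x = c"
proof -
  have c: "c \<in> V \<rightarrow> carrier M" using assms(2) G_carrier by blast
  have sub: "{u. c u \<noteq> \<zero>} \<subseteq> V" using assms(3) by blast
  have "finsum M c {u. c u \<noteq> \<zero>} = finsum M c V"
    using c by (intro M.add.finprod_mono_neutral_cong_left sub assms(1)) auto
  then have "(\<forall>u. c u \<in> G u) \<and> finite {u. c u \<noteq> \<zero>} \<and> x = finsum M c {u. c u \<noteq> \<zero>}"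
    using assms finite_subset[OF sub] by simp
  moreover have "x \<in> carrier M" using c assms(4) by simp
  then have "\<exists>!c. (\<forall>u. c u \<in> G u) \<and> finite {u. c u \<noteq> \<zero>} \<and> x = finsum M c {u. c u \<noteq> \<zero>}"
    using graded by (simp add: graded_module_def)
  ultimately show ?thesis unfolding hcomp_def by (intro the1_equality)
qed

lemma hcomp_homogeneous:
  assumes "x \<in> G u"
  shows "hcomp M G x = (\<lambda>v. if v = u then x else \<zero>)"
  by (rule hcompI[of "{u}"]) (use assms G_carrier[OF assms] in auto)

lemma hcomp_zero: "hcomp M G \<zero> u = \<zero>"
  using hcomp_homogeneous[OF G_zero[of u]] by simp

lemma hcomp_eq_0:
  assumes "x \<in> carrier M" "\<And>u. hcomp M G x u = \<zero>"
  shows "x = \<zero>"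
  using hcomp(3)[OF assms(1)] assms(2) by simp

lemma hcomp_smult:
  assumes "r \<in> poly_component w" "x \<in> carrier M"
  shows "hcomp M G (r \<odot> x) u = r \<odot> hcomp M G x (\<lambda>k. u k - w k)"
proof -
  let ?V = "{u. hcomp M G x u \<noteq> \<zero>}"
  let ?s = "\<lambda>u k. u k + w k"
  let ?c = "\<lambda>u. r \<odot> hcomp M G x (\<lambda>k. u k - w k)"
  have inj: "inj_on ?s ?V" by (auto simp: inj_on_def fun_eq_iff)
  have c: "?c \<in> ?s ` ?V \<rightarrow> carrier M" using assms(2) by simp
  have "hcomp M G (r \<odot> x) = ?c"
  proof (rule hcompI[of "?s ` ?V"])
    show "finite (?s ` ?V)" using hcomp(2)[OF assms(2)] by simp
    show "?c u \<in> G u" for u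
      by (rule G_smult[OF assms(1) hcomp(1)[OF assms(2)]]) simp
    show "?c u = \<zero>" if "u \<notin> ?s ` ?V" for u
    proof -
      have "hcomp M G x (\<lambda>k. u k - w k) = \<zero>"
      proof (rule ccontr)
        assume "hcomp M G x (\<lambda>k. u k - w k) \<noteq> \<zero>"
        then have "?s (\<lambda>k. u k - w k) \<in> ?s ` ?V" by (intro imageI) simp
        then show False using that by simp
      qed
      then show ?thesis by simp
    qed
    have "r \<odot> x = r \<odot> finsum M (hcomp M G x) ?V" using hcomp(3)[OF assms(2)] by simp
    also have "\<dots> = finsum M (\<lambda>u. r \<odot> hcomp M G x u) ?V"
      using assms(2) by (intro finsum_smult_ldistr hcomp(2)) auto
    also have "\<dots> = finsum M ?c (?s ` ?V)"
      using M.finsum_reindex[OF c inj] by simp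
    finally show "r \<odot> x = finsum M ?c (?s ` ?V)" .
  qed
  then show ?thesis by simp
qed

end

text \<open>The image under f of the decomposition of x is a decomposition of f x, and
  decompositions are unique. Later this turns a preimage of a homogeneous element into a homogeneous
  preimage.\<close>

lemma graded_hom_hcomp:
  assumes "graded M G" "graded N H" "f \<in> graded_hom M G N H" "x \<in> carrier M"
  shows "hcomp N H (f x) u = f (hcomp M G x u)"
proof -
  interpret M: graded M G by fact
  interpret N: graded N H by fact
  have f: "f \<in> mod_hom poly_ring M N" "\<And>x u. x \<in> G u \<Longrightarrow> f x \<in> H u"
    using assms(3) by (auto simp: graded_hom_def)
  have "hcomp N H (f x) = (\<lambda>u. f (hcomp M G x u))"
  proof (rule N.hcompI)
    show "finite {u. hcomp M G x u \<noteq> \<zero>\<^bsub>M\<^esub>}" by (rule M.hcomp(2)[OF assms(4)])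
    show "f (hcomp M G x u) \<in> H u" for u by (intro f(2) M.hcomp(1) assms(4))
    show "f (hcomp M G x u) = \<zero>\<^bsub>N\<^esub>" if "u \<notin> {u. hcomp M G x u \<noteq> \<zero>\<^bsub>M\<^esub>}" for u
      using that mod_hom_zero[OF M.module_axioms N.module_axioms f(1)] by simp
    show "f x = finsum N (\<lambda>u. f (hcomp M G x u)) {u. hcomp M G x u \<noteq> \<zero>\<^bsub>M\<^esub>}"
    proof -
      have "f x = f (finsum M (hcomp M G x) {u. hcomp M G x u \<noteq> \<zero>\<^bsub>M\<^esub>})"
        by (rule arg_cong[OF M.hcomp(3)[OF assms(4)]])
      also have "\<dots> = finsum N (\<lambda>u. f (hcomp M G x u)) {u. hcomp M G x u \<noteq> \<zero>\<^bsub>M\<^esub>}"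
        by (rule mod_hom_finsum[OF M.module_axioms N.module_axioms f(1)])
          (use M.hcomp_carrier[OF assms(4)] in blast)
      finally show ?thesis .
    qed
  qed
  then show ?thesis by simp
qed

lemma self_module_of_type_simps [simp]:
  "carrier (self_module (ring_of_type_algebra :: 'b::comm_ring_1 ring)) = UNIV"
  "x \<odot>\<^bsub>self_module ring_of_type_algebra\<^esub> y = x * (y :: 'b)"
  "\<zero>\<^bsub>self_module ring_of_type_algebra\<^esub> = (0 :: 'b)"
  "x \<oplus>\<^bsub>self_module ring_of_type_algebra\<^esub> y = x + (y :: 'b)"
  by (simp_all add: self_module_def)

lemma finsum_self_module:
  fixes c :: "'i \<Rightarrow> 'b::comm_ring_1"
  shows "finite A \<Longrightarrow> finsum (self_module ring_of_type_algebra) c A = sum c A"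
proof (induction A rule: finite_induct)
  case empty
  interpret module "ring_of_type_algebra :: 'b ring" "self_module ring_of_type_algebra"
    by (rule cring.module_self_module[OF cring_ring_of_type_algebra])
  show ?case using M.finsum_empty[of c] by simp
next
  case (insert a A)
  interpret module "ring_of_type_algebra :: 'b ring" "self_module ring_of_type_algebra"
    by (rule cring.module_self_module[OF cring_ring_of_type_algebra])
  show ?case using M.finsum_insert[OF insert.hyps, of c] insert by simp
qed

text \<open>The shifted free module R(-v): its generator 1 sits in degree v, so graded maps out of
  it correspond to elements of degree v.\<close>

definition shifted_grading :: "('n \<Rightarrow> int) \<Rightarrow> ('n \<Rightarrow> int) \<Rightarrow> ('n, 'a::idom) mpoly set" where
  "shifted_grading v w = poly_component (\<lambda>k. w k - v k)"

lemma self_module_of_type_uminus [simp]: "\<ominus>\<^bsub>self_module ring_of_type_algebra\<^esub> x = - (x :: 'b::comm_ring_1)"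
proof -
  interpret module "ring_of_type_algebra :: 'b ring" "self_module ring_of_type_algebra"
    by (rule cring.module_self_module[OF cring_ring_of_type_algebra])
  show ?thesis using M.minus_equality[of "-x" x] by simp
qed

lemma
  fixes v :: "'n::finite \<Rightarrow> int"
  shows graded_shifted: "graded (self_module (poly_ring :: ('n, 'a::idom) mpoly ring)) (shifted_grading v)"
    and hcomp_shifted: "hcomp (self_module (poly_ring :: ('n, 'a::idom) mpoly ring)) (shifted_grading v) f w
      = hpart f (\<lambda>k. w k - v k)"
proof -
  let ?M = "self_module (poly_ring :: ('n, 'a) mpoly ring)"
  interpret module "poly_ring :: ('n, 'a) mpoly ring" ?M
    by (rule cring.module_self_module[OF cring_ring_of_type_algebra])
  \<comment> \<open>This one equivalence yields existence and uniqueness of decompositions as well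
    as the value of \<open>hcomp\<close>.\<close>
  have dec: "(\<forall>u. c u \<in> shifted_grading v u) \<and> finite {u. c u \<noteq> \<zero>\<^bsub>?M\<^esub>} \<and>
      f = finsum ?M c {u. c u \<noteq> \<zero>\<^bsub>?M\<^esub>} \<longleftrightarrow> c = (\<lambda>w. hpart f (\<lambda>k. w k - v k))" for f c
  proof
    assume c: "c = (\<lambda>w. hpart f (\<lambda>k. w k - v k))"
    let ?D = "\<lambda>m k. int (Poly_Mapping.lookup m k) + v k"
    have sub: "{u. c u \<noteq> 0} \<subseteq> ?D ` Poly_Mapping.keys f"
    proof
      fix u assume "u \<in> {u. c u \<noteq> 0}"
      then obtain m where "Poly_Mapping.lookup (c u) m \<noteq> 0"
        by (metis (mono_tags) lookup_zero mem_Collect_eq poly_mapping_eqI)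
      then have "Poly_Mapping.lookup f m \<noteq> 0" "(\<lambda>k. int (Poly_Mapping.lookup m k)) = (\<lambda>k. u k - v k)"
        by (auto simp: c lookup_hpart split: if_splits)
      then have "m \<in> Poly_Mapping.keys f" "u = ?D m" by (auto simp: in_keys_iff fun_eq_iff)
      then show "u \<in> ?D ` Poly_Mapping.keys f" by blast
    qed
    then have fin: "finite {u. c u \<noteq> 0}" by (rule finite_subset) simp
    have "sum c {u. c u \<noteq> 0} = f"
    proof (rule poly_mapping_eqI)
      fix m
      have "(\<lambda>k. int (Poly_Mapping.lookup m k)) = (\<lambda>k. u k - v k) \<longleftrightarrow> u = ?D m" for u
        by (auto simp: fun_eq_iff algebra_simps)
      then have *: "Poly_Mapping.lookup (c u) m = (if u = ?D m then Poly_Mapping.lookup f m else 0)" for u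
        by (simp add: c lookup_hpart)
      then have "Poly_Mapping.lookup (sum c {u. c u \<noteq> 0}) m =
          (if ?D m \<in> {u. c u \<noteq> 0} then Poly_Mapping.lookup f m else 0)"
        using fin by (simp add: lookup_sum)
      also have "\<dots> = Poly_Mapping.lookup f m" using *[of "?D m"] by auto
      finally show "Poly_Mapping.lookup (sum c {u. c u \<noteq> 0}) m = Poly_Mapping.lookup f m" .
    qed
    then show "(\<forall>u. c u \<in> shifted_grading v u) \<and> finite {u. c u \<noteq> \<zero>\<^bsub>?M\<^esub>} \<and>
      f = finsum ?M c {u. c u \<noteq> \<zero>\<^bsub>?M\<^esub>}"
      using fin by (simp add: finsum_self_module) (simp add: c shifted_grading_def hpart_in)
  next
    assume c: "(\<forall>u. c u \<in> shifted_grading v u) \<and> finite {u. c u \<noteq> \<zero>\<^bsub>?M\<^esub>} \<and>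
      f = finsum ?M c {u. c u \<noteq> \<zero>\<^bsub>?M\<^esub>}"
    then have f: "f = sum c {u. c u \<noteq> 0}" and fin: "finite {u. c u \<noteq> 0}" by (auto simp: finsum_self_module)
    show "c = (\<lambda>w. hpart f (\<lambda>k. w k - v k))"
    proof (intro ext poly_mapping_eqI)
      fix w m
      let ?Dm = "\<lambda>k. int (Poly_Mapping.lookup m k) + v k"
      have *: "Poly_Mapping.lookup (c u) m = (if u = ?Dm then Poly_Mapping.lookup (c ?Dm) m else 0)" for u
      proof (cases "u = ?Dm")
        case False
        have "Poly_Mapping.lookup (c u) m = 0"
        proof (rule ccontr)
          assume "Poly_Mapping.lookup (c u) m \<noteq> 0"
          then have "(\<lambda>k. int (Poly_Mapping.lookup m k)) = (\<lambda>k. u k - v k)"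
            using c by (simp add: shifted_grading_def poly_component_iff)
          then have "u = ?Dm" by (auto simp: fun_eq_iff)
          then show False using False by simp
        qed
        then show ?thesis using False by simp
      qed simp
      have "Poly_Mapping.lookup f m = (\<Sum>u\<in>{u. c u \<noteq> 0}. if u = ?Dm then Poly_Mapping.lookup (c ?Dm) m else 0)"
        unfolding f lookup_sum by (rule sum.cong[OF refl *])
      also have "\<dots> = Poly_Mapping.lookup (c ?Dm) m" using fin by auto
      finally have "Poly_Mapping.lookup (c w) m = (if w = ?Dm then Poly_Mapping.lookup f m else 0)"
        using *[of w] by simp
      moreover have "w = ?Dm \<longleftrightarrow> (\<lambda>k. int (Poly_Mapping.lookup m k)) = (\<lambda>k. w k - v k)"
        by (auto simp: fun_eq_iff algebra_simps)
      ultimately show "Poly_Mapping.lookup (c w) m = Poly_Mapping.lookup (hpart f (\<lambda>k. w k - v k)) m"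
        by (simp add: lookup_hpart)
    qed
  qed
  show "hcomp ?M (shifted_grading v) f w = hpart f (\<lambda>k. w k - v k)"
    unfolding hcomp_def dec by simp
  show "graded ?M (shifted_grading v)"
    unfolding graded_def graded_module_def dec
  proof (intro conjI allI ballI)
    show "subgroup (shifted_grading v u) (add_monoid ?M)" for u
    proof (rule M.add.subgroupI)
      show "shifted_grading v u \<noteq> {}" unfolding shifted_grading_def using poly_component_zero by blast
    qed (auto simp: shifted_grading_def poly_component_add poly_component_uminus)
    fix w u and r x :: "('n, 'a) mpoly"
    assume "r \<in> poly_component w" "x \<in> shifted_grading v u"
    then show "r \<odot>\<^bsub>?M\<^esub> x \<in> shifted_grading v (\<lambda>k. w k + u k)"
      using poly_component_mult[of r w x "\<lambda>k. u k - v k"] by (simp add: shifted_grading_def algebra_simps)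
  qed (use module_axioms in auto)
qed

text \<open>The map r \<mapsto> r x is graded on R(-u), and graded maps commute with taking
  components.\<close>

lemma (in graded) hcomp_smult_homogeneous:
  assumes "x \<in> G u"
  shows "hcomp M G (r \<odot> x) w = hpart r (\<lambda>k. w k - u k) \<odot> x"
proof -
  have x: "x \<in> carrier M" using G_carrier assms .
  have "(\<lambda>r. r \<odot> x) \<in> graded_hom (self_module poly_ring) (shifted_grading u) M G"
    unfolding graded_hom_def
  proof (intro CollectI conjI allI mod_homI)
    show "(\<lambda>r. r \<odot> x) ` shifted_grading u w \<subseteq> G w" for w
      by (auto simp: shifted_grading_def intro: G_smult[OF _ assms])
  qed (use x in \<open>simp_all add: smult_plus smult_mult\<close>)
  from graded_hom_hcomp[OF graded_shifted graded_axioms this] show ?thesis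
    by (simp add: hcomp_shifted)
qed

section \<open>Divisibility of graded injective modules\<close>

lemma (in abelian_group) diff_add:
  "x \<in> carrier G \<Longrightarrow> y \<in> carrier G \<Longrightarrow> (x \<ominus> y) \<oplus> y = x"
  by (simp add: a_minus_def a_assoc l_neg)

lemma (in abelian_group) diff_zero_iff:
  "x \<in> carrier G \<Longrightarrow> y \<in> carrier G \<Longrightarrow> x \<ominus> y = \<zero> \<longleftrightarrow> x = y"
  using diff_add[of x y] by (auto simp: a_minus_def r_neg)

text \<open>Sums in \<open>N'\<close> and in N agree, so the decomposition in N serves in
  \<open>N'\<close> as soon as \<open>N'\<close> contains the components of its elements.\<close>

lemma graded_module_submodule:
  assumes "graded N H" "submodule N' poly_ring N"
    and homog: "\<And>n w. n \<in> N' \<Longrightarrow> hcomp N H n w \<in> N'"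
  shows "graded_module (N\<lparr>carrier := N'\<rparr>) (\<lambda>u. H u \<inter> N')"
proof -
  interpret N: graded N H by fact
  let ?K = "N\<lparr>carrier := N'\<rparr>"
  have Km: "module poly_ring ?K" by (rule submodule.submodule_is_module[OF assms(2) N.module_axioms])
  interpret K: module poly_ring ?K by (rule Km)
  note sub = N.submoduleE[OF assms(2)]
  have id: "id \<in> mod_hom poly_ring ?K N" using sub(1) by (intro mod_homI) auto
  have minus: "\<ominus>\<^bsub>?K\<^esub> a = \<ominus>\<^bsub>N\<^esub> a" if "a \<in> N'" for a
    using mod_hom_minus[OF Km N.module_axioms id, of a] that by simp
  have zero: "\<zero>\<^bsub>N\<^esub> \<in> N'" using subgroup.one_closed[OF submodule.axioms(1)[OF assms(2)]] by simp
  have fs: "finsum ?K c V = finsum N c V" if "\<And>v. v \<in> V \<Longrightarrow> c v \<in> N'" for c V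
    using mod_hom_finsum[OF Km N.module_axioms id, of c V] that by simp
  show ?thesis
    unfolding graded_module_def
  proof (intro conjI allI ballI)
    show "module poly_ring ?K" by (rule Km)
    show "subgroup (H u \<inter> N') (add_monoid ?K)" for u
    proof (rule K.M.add.subgroupI)
      show "H u \<inter> N' \<noteq> {}" using zero N.G_zero by blast
      show "\<ominus>\<^bsub>?K\<^esub> a \<in> H u \<inter> N'" if "a \<in> H u \<inter> N'" for a
        using that sub(3) N.G_uminus minus by simp
    qed (use sub(5) N.G_add in auto)
    show "r \<odot>\<^bsub>?K\<^esub> x \<in> H (\<lambda>k. w k + u k) \<inter> N'" if "r \<in> poly_component w" "x \<in> H u \<inter> N'" for r x w u
      using that sub(4)[of r x] N.G_smult[OF that(1), of x u] by simp
    fix x assume x: "x \<in> carrier ?K"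
    then have xN: "x \<in> N'" and xc: "x \<in> carrier N" using sub(1) by auto
    show "\<exists>!c. (\<forall>u. c u \<in> H u \<inter> N') \<and> finite {u. c u \<noteq> \<zero>\<^bsub>?K\<^esub>} \<and> x = finsum ?K c {u. c u \<noteq> \<zero>\<^bsub>?K\<^esub>}"
    proof (rule ex1I[of _ "hcomp N H x"])
      have "finsum ?K (hcomp N H x) {u. hcomp N H x u \<noteq> \<zero>\<^bsub>?K\<^esub>} = x"
        using fs[of "{u. hcomp N H x u \<noteq> \<zero>\<^bsub>?K\<^esub>}" "hcomp N H x"] homog[OF xN] N.hcomp(3)[OF xc] by simp
      then show "(\<forall>u. hcomp N H x u \<in> H u \<inter> N') \<and> finite {u. hcomp N H x u \<noteq> \<zero>\<^bsub>?K\<^esub>} \<and>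
          x = finsum ?K (hcomp N H x) {u. hcomp N H x u \<noteq> \<zero>\<^bsub>?K\<^esub>}"
        using homog[OF xN] N.hcomp(1,2)[OF xc] by simp
    next
      fix c assume c: "(\<forall>u. c u \<in> H u \<inter> N') \<and> finite {u. c u \<noteq> \<zero>\<^bsub>?K\<^esub>} \<and> x = finsum ?K c {u. c u \<noteq> \<zero>\<^bsub>?K\<^esub>}"
      then have "x = finsum N c {u. c u \<noteq> \<zero>\<^bsub>N\<^esub>}" using fs[of "{u. c u \<noteq> \<zero>\<^bsub>?K\<^esub>}" c] by simp
      then have "hcomp N H x = c" using c by (intro N.hcompI[of "{u. c u \<noteq> \<zero>\<^bsub>N\<^esub>}"]) auto
      then show "c = hcomp N H x" by simp
    qed
  qed
qed

lemma hpart_cases: "\<exists>m a. hpart r w = Poly_Mapping.single m a"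
  using poly_component_cases[OF hpart_in[of r w]] single_zero[of 0] by metis

text \<open>The annihilators of the elements f^t x form an ascending chain, and one t without growth
  is wanted. If at each t some term killed f^(t+1) x but not f^t x, these terms would violate the
  chain condition; so at some t no term is gained, and an arbitrary r reduces to terms through the
  components of f^t r x.\<close>

lemma (in graded) annihilator_stable:
  assumes "noetherian_ring (base_ring :: 'a ring)" "x \<in> G u" "f \<in> poly_component \<mu>"
  shows "\<exists>t. \<forall>r. f ^ Suc t \<odot> (r \<odot> x) = \<zero> \<longrightarrow> f ^ t \<odot> (r \<odot> x) = \<zero>"
proof -
  have x: "x \<in> carrier M" using G_carrier assms(2) .
  let ?Z = "\<lambda>t m a. f ^ t \<odot> (Poly_Mapping.single m a \<odot> x) = \<zero>"
  have "\<exists>t. \<forall>m a. ?Z (Suc t) m a \<longrightarrow> ?Z t m a"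
  proof (rule ccontr)
    assume "\<nexists>t. \<forall>m a. ?Z (Suc t) m a \<longrightarrow> ?Z t m a"
    then have "\<forall>t. \<exists>ma. ?Z (Suc t) (fst ma) (snd ma) \<and> \<not> ?Z t (fst ma) (snd ma)" by auto
    from choice[OF this] obtain ma where ma: "\<And>t. ?Z (Suc t) (fst (ma t)) (snd (ma t))" "\<And>t. \<not> ?Z t (fst (ma t)) (snd (ma t))"
      by blast
    obtain l where l: "\<And>J. ideal J poly_ring \<Longrightarrow> (\<forall>j<l. Poly_Mapping.single (fst (ma j)) (snd (ma j)) \<in> J) \<Longrightarrow>
        Poly_Mapping.single (fst (ma l)) (snd (ma l)) \<in> J"
      using monomial_sequence_noetherian[OF assms(1), of "\<lambda>j. fst (ma j)" "\<lambda>j. snd (ma j)"] by auto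
    \<comment> \<open>The annihilator of f^l x contains the terms with index j < l because f^(j+1)
      divides f^l; by the choice of l it also contains the term with index l, which was chosen
      outside.\<close>
    have "Poly_Mapping.single (fst (ma l)) (snd (ma l)) \<in> {r. r \<odot> (f ^ l \<odot> x) = \<zero>}"
    proof (intro l ideal_annihilator allI impI CollectI)
      fix j assume "j < l"
      then have "f ^ l = f ^ (l - Suc j) * f ^ Suc j" 
        by (simp add: Suc_diff_Suc flip: power_Suc power_add del: power_Suc)
      then have "Poly_Mapping.single (fst (ma j)) (snd (ma j)) \<odot> (f ^ l \<odot> x) =
        f ^ (l - Suc j) \<odot> (f ^ Suc j \<odot> (Poly_Mapping.single (fst (ma j)) (snd (ma j)) \<odot> x))"
        using x smult_mult smult_commute smult_closed_type by metis
      then show "Poly_Mapping.single (fst (ma j)) (snd (ma j)) \<odot> (f ^ l \<odot> x) = \<zero>"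
        using ma(1)[of j] by simp
    qed (use x in simp)
    then show False using ma(2)[of l] x smult_commute by simp
  qed
  then obtain t where t: "\<And>m a. ?Z (Suc t) m a \<Longrightarrow> ?Z t m a" by blast
  have "f ^ t \<odot> (r \<odot> x) = \<zero>" if r: "f ^ Suc t \<odot> (r \<odot> x) = \<zero>" for r
  proof (rule hcomp_eq_0)
    have comp: "hcomp M G (f ^ s \<odot> (r \<odot> x)) w =
      f ^ s \<odot> (hpart r (\<lambda>k. w k - int s * \<mu> k - u k) \<odot> x)" for s w
      using hcomp_smult[OF poly_component_power[OF assms(3)], of "r \<odot> x"] x
      by (simp add: hcomp_smult_homogeneous[OF assms(2)])
    fix w
    obtain m a where ma: "hpart r (\<lambda>k. w k - int t * \<mu> k - u k) = Poly_Mapping.single m a"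
      using hpart_cases by blast
    \<comment> \<open>The extra factor f shifts the degree by \<mu>. So degree w + \<mu> for the
      exponent t + 1 singles out the same component of r as degree w does for the exponent
      t.\<close>
    have "f ^ Suc t \<odot> (hpart r (\<lambda>k. (w k + \<mu> k) - int (Suc t) * \<mu> k - u k) \<odot> x) = \<zero>"
      using comp[of "Suc t" "\<lambda>k. w k + \<mu> k"] r hcomp_zero by simp
    moreover have "(\<lambda>k. (w k + \<mu> k) - int (Suc t) * \<mu> k - u k) = (\<lambda>k. w k - int t * \<mu> k - u k)"
      by (simp add: algebra_simps)
    ultimately have "?Z (Suc t) m a" using ma by simp
    then show "hcomp M G (f ^ t \<odot> (r \<odot> x)) w = \<zero>"
      using t[of m a] comp[of t w] ma by simp
  qed (use x in simp)
  then show ?thesis by blast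
qed

text \<open>On the ideal Ann(x) + (f^(t+1)) of R(-v), where v = u - \<mu>, send n to f^t r x
  whenever n x = f^(t+1) r x; stability of the annihilators at t makes this independent of r.
  Injectivity extends the map to R(-v), and y is the image of 1. Having Ann(x) in the domain forces
  y to inherit every annihilator of x, so that this division respects torsion.\<close>

lemma (in graded) graded_injective_divisible:
  assumes "noetherian_ring (base_ring :: 'a ring)" "graded_injective M G"
    and xG: "x \<in> G u" and f: "f \<in> poly_component \<mu>"
  shows "\<exists>t y. y \<in> G (\<lambda>k. u k - \<mu> k) \<and> f ^ Suc t \<odot> y = f ^ t \<odot> x \<and>
    (\<forall>r. r \<odot> x = \<zero> \<longrightarrow> r \<odot> y = \<zero>)"
proof -
  have x: "x \<in> carrier M" using G_carrier xG .
  obtain t where t: "\<And>r. f ^ Suc t \<odot> (r \<odot> x) = \<zero> \<Longrightarrow> f ^ t \<odot> (r \<odot> x) = \<zero>"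
    using annihilator_stable[OF assms(1) xG f] by blast
  let ?N = "self_module (poly_ring :: ('n, 'a) mpoly ring)"
  let ?v = "\<lambda>k. u k - \<mu> k"
  let ?H = "shifted_grading ?v"
  interpret N: graded ?N ?H by (rule graded_shifted)
  define rel where "rel n r \<longleftrightarrow> n \<odot> x = f ^ Suc t \<odot> (r \<odot> x)" for n r
  define N' where "N' = {n. \<exists>r. rel n r}"
  define \<phi> where "\<phi> n = f ^ t \<odot> ((SOME r. rel n r) \<odot> x)" for n
  have \<phi>: "\<phi> n = f ^ t \<odot> (r \<odot> x)" if "rel n r" for n r
  proof -
    define s where "s = (SOME r. rel n r)"
    have "rel n s" unfolding s_def using that by (rule someI)
    then have eq: "f ^ Suc t \<odot> (s \<odot> x) = f ^ Suc t \<odot> (r \<odot> x)" using that by (simp add: rel_def)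
    have diff: "(s - r) \<odot> x = s \<odot> x \<ominus> r \<odot> x"
      using smult_plus[OF x, of s "-r"] x by (simp add: a_minus_def minus_smult)
    have "f ^ Suc t \<odot> ((s - r) \<odot> x) = \<zero>"
      unfolding diff using x by (simp add: smult_diff eq del: power_Suc) (simp add: a_minus_def M.r_neg del: power_Suc)
    then have "f ^ t \<odot> ((s - r) \<odot> x) = \<zero>" by (rule t)
    then have "f ^ t \<odot> (s \<odot> x) \<ominus> f ^ t \<odot> (r \<odot> x) = \<zero>"
      unfolding diff using x by (simp add: smult_diff)
    then show ?thesis using x M.diff_zero_iff by (simp add: \<phi>_def s_def[symmetric])
  qed
  have rel_add: "rel (n + n') (r + r')" if "rel n r" "rel n' r'" for n n' r r'
    using that x by (simp add: rel_def smult_plus smult_add)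
  have rel_mult: "rel (s * n) (s * r)" if "rel n r" for n r s
    using that x by (simp add: rel_def smult_mult smult_commute)
  have rel_0: "rel 0 0" using x by (simp add: rel_def smult_0)
  \<comment> \<open>Compare the components of degree w + \<mu> on both sides of the relation; this
    makes the domain a graded ideal.\<close>
  have rel_hpart: "rel (hpart n (\<lambda>k. w k - ?v k)) (hpart r (\<lambda>k. w k - int t * \<mu> k - u k))"
    if "rel n r" for n r w
  proof -
    have "hcomp M G (n \<odot> x) (\<lambda>k. w k + \<mu> k) =
        hcomp M G (f ^ Suc t \<odot> (r \<odot> x)) (\<lambda>k. w k + \<mu> k)"
      using that by (simp add: rel_def)
    then have "hpart n (\<lambda>k. w k + \<mu> k - u k) \<odot> x =
        f ^ Suc t \<odot> (hpart r (\<lambda>k. w k + \<mu> k - int (Suc t) * \<mu> k - u k) \<odot> x)"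
      using hcomp_smult[OF poly_component_power[OF f], of "r \<odot> x" "Suc t"] x
      by (simp add: hcomp_smult_homogeneous[OF xG])
    then show ?thesis by (simp add: rel_def algebra_simps)
  qed
  have sub: "submodule N' poly_ring ?N"
  proof (rule N.submoduleI)
    show "\<ominus>\<^bsub>?N\<^esub> a \<in> N'" if "a \<in> N'" for a
      using that rel_mult[of a _ "-1"] by (auto simp: N'_def)
    show "a \<oplus>\<^bsub>?N\<^esub> b \<in> N'" if "a \<in> N'" "b \<in> N'" for a b
      using that rel_add unfolding N'_def by simp blast
    show "a \<odot>\<^bsub>?N\<^esub> b \<in> N'" if "b \<in> N'" for a b
      using that rel_mult unfolding N'_def by simp blast
  qed (use rel_0 in \<open>auto simp: N'_def\<close>)
  have gr: "graded_module (?N\<lparr>carrier := N'\<rparr>) (\<lambda>u. ?H u \<inter> N')"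
    by (rule graded_module_submodule[OF graded_shifted sub]) (use rel_hpart in \<open>auto simp: N'_def hcomp_shifted\<close>)
  have "\<phi> \<in> graded_hom (?N\<lparr>carrier := N'\<rparr>) (\<lambda>u. ?H u \<inter> N') M G"
    unfolding graded_hom_def
  proof (intro CollectI conjI allI mod_homI)
    fix n n' assume nn: "n \<in> carrier (?N\<lparr>carrier := N'\<rparr>)" "n' \<in> carrier (?N\<lparr>carrier := N'\<rparr>)"
    then obtain r r' where r: "rel n r" "rel n' r'" by (auto simp: N'_def)
    show "\<phi> (n \<oplus>\<^bsub>?N\<lparr>carrier := N'\<rparr>\<^esub> n') = \<phi> n \<oplus> \<phi> n'"
      using \<phi>[OF r(1)] \<phi>[OF r(2)] \<phi>[OF rel_add[OF r]] x by (simp add: smult_plus smult_add)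
    show "\<phi> n \<in> carrier M" using \<phi>[OF r(1)] x by simp
    show "\<phi> (s \<odot>\<^bsub>?N\<lparr>carrier := N'\<rparr>\<^esub> n) = s \<odot> \<phi> n" for s
      using \<phi>[OF r(1)] \<phi>[OF rel_mult[OF r(1)]] x by (simp add: smult_mult smult_commute)
  next
    fix w show "\<phi> ` (?H w \<inter> N') \<subseteq> G w"
    proof (rule image_subsetI)
      fix n assume n: "n \<in> ?H w \<inter> N'"
      then obtain r where r: "rel n r" by (auto simp: N'_def)
      have n': "hpart n (\<lambda>k. w k - ?v k) = n"
        using n N.hcomp_homogeneous[of n w] hcomp_shifted[of ?v n w] by simp
      have hp: "hpart r (\<lambda>k. w k - int t * \<mu> k - u k) \<odot> x \<in> G (\<lambda>k. w k - int t * \<mu> k)"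
        by (rule G_smult[OF hpart_in xG]) simp
      \<comment> \<open>Since n is its own component, r may be replaced by its component of matching
        degree; only then can the degree of \<phi> n be read off.\<close>
      have "\<phi> n = f ^ t \<odot> (hpart r (\<lambda>k. w k - int t * \<mu> k - u k) \<odot> x)"
        using n' \<phi>[OF rel_hpart[OF r, of w]] by simp
      moreover have "f ^ t \<odot> (hpart r (\<lambda>k. w k - int t * \<mu> k - u k) \<odot> x) \<in> G w"
        by (rule G_smult[OF poly_component_power[OF f] hp]) simp
      ultimately show "\<phi> n \<in> G w" by simp
    qed
  qed
  from assms(2)[unfolded graded_injective_def, rule_format, OF N.graded sub gr this]
  obtain \<psi> where \<psi>: "\<psi> \<in> graded_hom ?N ?H M G" "\<And>n. n \<in> N' \<Longrightarrow> \<psi> n = \<phi> n"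
    by blast
  have \<psi>m: "\<psi> (r * s) = r \<odot> \<psi> s" for r s
    using mod_homD(3)[of \<psi> poly_ring ?N M r s] \<psi>(1) by (simp add: graded_hom_def)
  have "(1 :: ('n, 'a) mpoly) \<in> ?H ?v" using poly_component_one by (simp add: shifted_grading_def)
  then have "\<psi> 1 \<in> G ?v" using \<psi>(1) by (auto simp: graded_hom_def)
  moreover have "f ^ Suc t \<odot> \<psi> 1 = f ^ t \<odot> x"
  proof -
    have r: "rel (f ^ Suc t) 1" using x by (simp add: rel_def smult_1)
    have "f ^ Suc t \<odot> \<psi> 1 = \<psi> (f ^ Suc t)" using \<psi>m[of "f ^ Suc t" 1] by simp
    also have "\<dots> = \<phi> (f ^ Suc t)" using r by (intro \<psi>(2)) (auto simp: N'_def)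
    also have "\<dots> = f ^ t \<odot> x" using \<phi>[OF r] x by (simp add: smult_1)
    finally show ?thesis .
  qed
  moreover have "r \<odot> \<psi> 1 = \<zero>" if "r \<odot> x = \<zero>" for r
  proof -
    \<comment> \<open>An annihilator of x lies in the domain with witness 0, so its image is
      0.\<close>
    have r: "rel r 0" using that x by (simp add: rel_def smult_0)
    have "r \<odot> \<psi> 1 = \<psi> r" using \<psi>m[of r 1] by simp
    also have "\<dots> = \<phi> r" using r by (intro \<psi>(2)) (auto simp: N'_def)
    also have "\<dots> = \<zero>" using \<phi>[OF r] x by (simp add: smult_0)
    finally show ?thesis .
  qed
  ultimately show ?thesis by blast
qed

section \<open>Straight subcomplexes and their power torsion\<close>

section \<open>Straightness\<close>

context abelian_group begin

lemma diff_zero: "x \<in> carrier G \<Longrightarrow> x \<ominus> \<zero> = x"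
  using diff_add[of x \<zero>] by simp

lemma diff_self: "x \<in> carrier G \<Longrightarrow> x \<ominus> x = \<zero>"
  by (simp add: diff_zero_iff)

lemma diff_right_commute:
  "x \<in> carrier G \<Longrightarrow> y \<in> carrier G \<Longrightarrow> z \<in> carrier G \<Longrightarrow> x \<ominus> y \<ominus> z = x \<ominus> z \<ominus> y"
  by (simp add: a_minus_def a_ac)

lemma diff_diff_cancel: "x \<in> carrier G \<Longrightarrow> y \<in> carrier G \<Longrightarrow> x \<ominus> (x \<ominus> y) = y"
  by (simp add: a_minus_def minus_add r_neg flip: a_assoc)

lemma diff_diff_right:
  "x \<in> carrier G \<Longrightarrow> y \<in> carrier G \<Longrightarrow> z \<in> carrier G \<Longrightarrow> x \<ominus> (y \<ominus> z) = (x \<ominus> y) \<oplus> z"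
  by (simp add: a_minus_def minus_add a_ac)

lemma diff_add_right:
  "x \<in> carrier G \<Longrightarrow> y \<in> carrier G \<Longrightarrow> z \<in> carrier G \<Longrightarrow> x \<ominus> (y \<oplus> z) = x \<ominus> y \<ominus> z"
  by (simp add: a_minus_def minus_add a_ac)

end

definition shift_up :: "('n \<Rightarrow> int) \<Rightarrow> 'n \<Rightarrow> 'n \<Rightarrow> int" where
  "shift_up u k = u(k := u k + 1)"

definition indet :: "'n \<Rightarrow> ('n, 'a::idom) mpoly" where
  "indet k = Poly_Mapping.single (Poly_Mapping.single k 1) 1"

lemma indet_in: "indet k \<in> poly_component (\<lambda>j. if j = k then 1 else 0)"
  unfolding indet_def by (rule poly_component_single) (auto simp: lookup_single when_def)

lemma shift_up_eq: "shift_up u k = (\<lambda>j. (if j = k then 1 else 0) + u j)"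
  by (auto simp: shift_up_def)

definition shift_by :: "('n \<Rightarrow> int) \<Rightarrow> ('n \<Rightarrow> int) \<Rightarrow> nat \<Rightarrow> 'n \<Rightarrow> int" where
  "shift_by \<mu> u s = (\<lambda>k. int s * \<mu> k + u k)"

lemma shift_by_shift_up: "shift_by \<mu> (shift_up u k) s = shift_up (shift_by \<mu> u s) k"
  by (auto simp: shift_by_def shift_up_def)

text \<open>
  A power of \<open>f\<close> used to clear a denominator can be chosen such that the shifted degree is again
  not exceptional for \<open>X\<^sub>k\<close>.
\<close>

lemma shift_by_avoid:
  assumes "u k \<noteq> -1"
  shows "\<exists>s\<ge>s0. shift_by \<mu> u s k \<noteq> -1"
proof (cases "shift_by \<mu> u s0 k = -1")
  case True
  then have "shift_by \<mu> u (Suc s0) k \<noteq> -1" using assms by (auto simp: shift_by_def algebra_simps)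
  then show ?thesis by (intro exI[of _ "Suc s0"]) simp
qed auto

locale graded_complex =
  fixes E :: "nat \<Rightarrow> (('n::finite, 'a::idom) mpoly, 'e) module" and G :: "nat \<Rightarrow> ('n \<Rightarrow> int) \<Rightarrow> 'e set"
    and d :: "nat \<Rightarrow> 'e \<Rightarrow> 'e"
  assumes graded_E: "graded (E j) (G j)"
    and d_hom: "d j \<in> graded_hom (E j) (G j) (E (Suc j)) (G (Suc j))"
    and dd: "x \<in> carrier (E j) \<Longrightarrow> d (Suc j) (d j x) = \<zero>\<^bsub>E (Suc (Suc j))\<^esub>"
begin

sublocale E: graded "E j" "G j" for j by (rule graded_E)

lemma d_mod_hom: "d j \<in> mod_hom poly_ring (E j) (E (Suc j))"
  using d_hom by (simp add: graded_hom_def)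

lemma d_carrier [simp]: "x \<in> carrier (E j) \<Longrightarrow> d j x \<in> carrier (E (Suc j))"
  by (rule mod_homD(1)[OF d_mod_hom])

lemma d_G: "x \<in> G j u \<Longrightarrow> d j x \<in> G (Suc j) u"
  using d_hom[of j] by (auto simp: graded_hom_def)

lemma d_diff: "x \<in> carrier (E j) \<Longrightarrow> y \<in> carrier (E j) \<Longrightarrow> d j (x \<ominus>\<^bsub>E j\<^esub> y) = d j x \<ominus>\<^bsub>E (Suc j)\<^esub> d j y"
  by (rule mod_hom_diff[OF E.module_axioms E.module_axioms d_mod_hom])

lemma d_add: "x \<in> carrier (E j) \<Longrightarrow> y \<in> carrier (E j) \<Longrightarrow> d j (x \<oplus>\<^bsub>E j\<^esub> y) = d j x \<oplus>\<^bsub>E (Suc j)\<^esub> d j y"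
  by (rule mod_homD(2)[OF d_mod_hom])

lemma d_smult: "x \<in> carrier (E j) \<Longrightarrow> d j (r \<odot>\<^bsub>E j\<^esub> x) = r \<odot>\<^bsub>E (Suc j)\<^esub> d j x"
  by (rule mod_homD(3)[OF d_mod_hom]) simp_all

lemma d_zero [simp]: "d j \<zero>\<^bsub>E j\<^esub> = \<zero>\<^bsub>E (Suc j)\<^esub>"
  by (rule mod_hom_zero[OF E.module_axioms E.module_axioms d_mod_hom])

lemma power_smult_add: "x \<in> carrier (E j) \<Longrightarrow> f ^ (s + t) \<odot>\<^bsub>E j\<^esub> x = f ^ s \<odot>\<^bsub>E j\<^esub> (f ^ t \<odot>\<^bsub>E j\<^esub> x)"
  by (simp add: power_add E.smult_mult)

lemma power_smult_zero_mono:
  assumes "x \<in> carrier (E j)" "f ^ s \<odot>\<^bsub>E j\<^esub> x = \<zero>\<^bsub>E j\<^esub>" "s \<le> t"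
  shows "f ^ t \<odot>\<^bsub>E j\<^esub> x = \<zero>\<^bsub>E j\<^esub>"
  using power_smult_add[OF assms(1), of f "t - s" s] assms by simp

text \<open>A graded subcomplex is recorded through its homogeneous elements alone: straightness
  speaks of single degrees and f is homogeneous, so inhomogeneous elements never enter.\<close>

definition family :: "(nat \<Rightarrow> ('n \<Rightarrow> int) \<Rightarrow> 'e set) \<Rightarrow> bool" where
  "family F \<longleftrightarrow> (\<forall>c u. F c u \<subseteq> G c u \<and> \<zero>\<^bsub>E c\<^esub> \<in> F c u \<and>
     (\<forall>x\<in>F c u. \<forall>y\<in>F c u. x \<oplus>\<^bsub>E c\<^esub> y \<in> F c u \<and> x \<ominus>\<^bsub>E c\<^esub> y \<in> F c u) \<and>
     (\<forall>x\<in>F c u. d c x \<in> F (Suc c) u) \<and>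
     (\<forall>w. \<forall>r\<in>poly_component w. \<forall>x\<in>F c u. r \<odot>\<^bsub>E c\<^esub> x \<in> F c (\<lambda>k. w k + u k)))"

definition homogeneous_bd :: "(nat \<Rightarrow> ('n \<Rightarrow> int) \<Rightarrow> 'e set) \<Rightarrow> nat \<Rightarrow> ('n \<Rightarrow> int) \<Rightarrow> 'e set" where
  "homogeneous_bd F c u = (case c of 0 \<Rightarrow> {\<zero>\<^bsub>E 0\<^esub>} | Suc j \<Rightarrow> d j ` F j u)"

lemma bd_0 [simp]: "homogeneous_bd F 0 u = {\<zero>\<^bsub>E 0\<^esub>}" and bd_Suc: "homogeneous_bd F (Suc j) u = d j ` F j u"
  by (simp_all add: homogeneous_bd_def)

text \<open>Multiplication by \<open>X\<^sub>k\<close> is bijective from \<open>H\<^sup>c(F)\<^sub>u\<close> to the component of degree \<open>u + e\<^sub>k\<close>.\<close>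

definition straight :: "(nat \<Rightarrow> ('n \<Rightarrow> int) \<Rightarrow> 'e set) \<Rightarrow> bool" where
  "straight F \<longleftrightarrow> (\<forall>c u k. u k \<noteq> -1 \<longrightarrow>
     (\<forall>z\<in>F c u. d c z = \<zero>\<^bsub>E (Suc c)\<^esub> \<longrightarrow> indet k \<odot>\<^bsub>E c\<^esub> z \<in> homogeneous_bd F c (shift_up u k) \<longrightarrow> z \<in> homogeneous_bd F c u) \<and>
     (\<forall>w\<in>F c (shift_up u k). d c w = \<zero>\<^bsub>E (Suc c)\<^esub> \<longrightarrow>
        (\<exists>z\<in>F c u. d c z = \<zero>\<^bsub>E (Suc c)\<^esub> \<and> w \<ominus>\<^bsub>E c\<^esub> indet k \<odot>\<^bsub>E c\<^esub> z \<in> homogeneous_bd F c (shift_up u k))))"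

lemma straight_inj:
  "straight F \<Longrightarrow> u k \<noteq> -1 \<Longrightarrow> z \<in> F c u \<Longrightarrow> d c z = \<zero>\<^bsub>E (Suc c)\<^esub> \<Longrightarrow>
   indet k \<odot>\<^bsub>E c\<^esub> z \<in> homogeneous_bd F c (shift_up u k) \<Longrightarrow> z \<in> homogeneous_bd F c u"
  by (simp add: straight_def)

lemma straight_surj:
  "straight F \<Longrightarrow> u k \<noteq> -1 \<Longrightarrow> w \<in> F c (shift_up u k) \<Longrightarrow> d c w = \<zero>\<^bsub>E (Suc c)\<^esub> \<Longrightarrow>
   \<exists>z\<in>F c u. d c z = \<zero>\<^bsub>E (Suc c)\<^esub> \<and> w \<ominus>\<^bsub>E c\<^esub> indet k \<odot>\<^bsub>E c\<^esub> z \<in> homogeneous_bd F c (shift_up u k)"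
  by (simp add: straight_def)

definition tors :: "('n, 'a) mpoly \<Rightarrow> (nat \<Rightarrow> ('n \<Rightarrow> int) \<Rightarrow> 'e set) \<Rightarrow> nat \<Rightarrow> ('n \<Rightarrow> int) \<Rightarrow> 'e set" where
  "tors f F c u = {x \<in> F c u. \<exists>s. f ^ s \<odot>\<^bsub>E c\<^esub> x = \<zero>\<^bsub>E c\<^esub>}"

context
  fixes F assumes fam: "family F"
begin

lemma F_G: "x \<in> F c u \<Longrightarrow> x \<in> G c u" and F_zero: "\<zero>\<^bsub>E c\<^esub> \<in> F c u"
  and F_add: "x \<in> F c u \<Longrightarrow> y \<in> F c u \<Longrightarrow> x \<oplus>\<^bsub>E c\<^esub> y \<in> F c u"
  and F_diff: "x \<in> F c u \<Longrightarrow> y \<in> F c u \<Longrightarrow> x \<ominus>\<^bsub>E c\<^esub> y \<in> F c u"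
  and F_d: "x \<in> F c u \<Longrightarrow> d c x \<in> F (Suc c) u"
  and F_smult: "r \<in> poly_component w \<Longrightarrow> x \<in> F c u \<Longrightarrow> r \<odot>\<^bsub>E c\<^esub> x \<in> F c (\<lambda>k. w k + u k)"
  using fam unfolding family_def by blast+

lemma F_carrier: "x \<in> F c u \<Longrightarrow> x \<in> carrier (E c)"
  using F_G E.G_carrier by blast

lemma F_indet: "x \<in> F c u \<Longrightarrow> indet k \<odot>\<^bsub>E c\<^esub> x \<in> F c (shift_up u k)"
  using F_smult[OF indet_in] by (simp add: shift_up_eq)

lemma bd_F: "x \<in> homogeneous_bd F c u \<Longrightarrow> x \<in> F c u"
  by (cases c) (auto simp: bd_Suc F_zero F_d)

lemma d_bd: "x \<in> homogeneous_bd F c u \<Longrightarrow> d c x = \<zero>\<^bsub>E (Suc c)\<^esub>"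
  by (cases c) (auto simp: bd_Suc dd F_carrier)

lemma bd_zero: "\<zero>\<^bsub>E c\<^esub> \<in> homogeneous_bd F c u"
  by (cases c) (auto simp: bd_Suc F_zero image_iff intro: bexI[OF _ F_zero])

lemma bd_add: "x \<in> homogeneous_bd F c u \<Longrightarrow> y \<in> homogeneous_bd F c u \<Longrightarrow> x \<oplus>\<^bsub>E c\<^esub> y \<in> homogeneous_bd F c u"
  by (cases c) (auto simp: bd_Suc F_carrier F_add simp flip: d_add)

lemma bd_diff: "x \<in> homogeneous_bd F c u \<Longrightarrow> y \<in> homogeneous_bd F c u \<Longrightarrow> x \<ominus>\<^bsub>E c\<^esub> y \<in> homogeneous_bd F c u"
  by (cases c) (auto simp: bd_Suc F_carrier F_diff E.M.diff_zero simp flip: d_diff)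

lemma bd_smult: "r \<in> poly_component w \<Longrightarrow> x \<in> homogeneous_bd F c u \<Longrightarrow> r \<odot>\<^bsub>E c\<^esub> x \<in> homogeneous_bd F c (\<lambda>k. w k + u k)"
  by (cases c) (auto simp: bd_Suc F_carrier F_smult simp flip: d_smult)

lemma bd_indet: "x \<in> homogeneous_bd F c u \<Longrightarrow> indet k \<odot>\<^bsub>E c\<^esub> x \<in> homogeneous_bd F c (shift_up u k)"
  using bd_smult[OF indet_in] by (simp add: shift_up_eq)

context
  fixes f \<mu>
  assumes f: "f \<in> poly_component \<mu>"
    and divis: "\<And>c u x. x \<in> F c u \<Longrightarrow> \<exists>t. \<exists>y\<in>F c (\<lambda>k. u k - \<mu> k). f ^ Suc t \<odot>\<^bsub>E c\<^esub> y = f ^ t \<odot>\<^bsub>E c\<^esub> x"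
begin

lemma F_power: "x \<in> F c u \<Longrightarrow> f ^ s \<odot>\<^bsub>E c\<^esub> x \<in> F c (shift_by \<mu> u s)"
  using F_smult[OF poly_component_power[OF f]] by (simp add: shift_by_def)

lemma bd_power: "x \<in> homogeneous_bd F c u \<Longrightarrow> f ^ s \<odot>\<^bsub>E c\<^esub> x \<in> homogeneous_bd F c (shift_by \<mu> u s)"
  using bd_smult[OF poly_component_power[OF f]] by (simp add: shift_by_def)

text \<open>The standing assumption on F reads x / f = y / 1 in the localization F_f, that is, F
  maps onto F_f. Iterating it removes the denominator f^s; the exponent t absorbs the f-torsion that
  fractions ignore.\<close>

lemma divis_iter:
  "x \<in> F c (shift_by \<mu> u s) \<Longrightarrow> \<exists>t. \<exists>y\<in>F c u. f ^ (t + s) \<odot>\<^bsub>E c\<^esub> y = f ^ t \<odot>\<^bsub>E c\<^esub> x"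
proof (induction s arbitrary: x)
  case 0
  then show ?case by (intro exI[of _ 0]) (auto simp: shift_by_def)
next
  case (Suc s)
  obtain t1 y1 where y1: "y1 \<in> F c (\<lambda>k. shift_by \<mu> u (Suc s) k - \<mu> k)" "f ^ Suc t1 \<odot>\<^bsub>E c\<^esub> y1 = f ^ t1 \<odot>\<^bsub>E c\<^esub> x"
    using divis[OF Suc.prems] by blast
  have "(\<lambda>k. shift_by \<mu> u (Suc s) k - \<mu> k) = shift_by \<mu> u s" by (simp add: shift_by_def algebra_simps)
  then obtain t2 y2 where y2: "y2 \<in> F c u" "f ^ (t2 + s) \<odot>\<^bsub>E c\<^esub> y2 = f ^ t2 \<odot>\<^bsub>E c\<^esub> y1"
    using Suc.IH[of y1] y1(1) by auto
  note car = F_carrier[OF y1(1)] F_carrier[OF y2(1)] F_carrier[OF Suc.prems]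
  have "f ^ (t2 + t1 + Suc s) \<odot>\<^bsub>E c\<^esub> y2 = f ^ Suc t1 \<odot>\<^bsub>E c\<^esub> (f ^ (t2 + s) \<odot>\<^bsub>E c\<^esub> y2)"
    using power_smult_add[OF car(2), of f "Suc t1" "t2 + s"] by (simp add: ac_simps)
  also have "\<dots> = f ^ t2 \<odot>\<^bsub>E c\<^esub> (f ^ Suc t1 \<odot>\<^bsub>E c\<^esub> y1)"
    unfolding y2(2) by (rule E.smult_commute[OF car(1)])
  also have "\<dots> = f ^ (t2 + t1) \<odot>\<^bsub>E c\<^esub> x"
    unfolding y1(2) by (rule power_smult_add[OF car(3), symmetric])
  finally show ?case using y2(1) by blast
qed

text \<open>Divide a preimage under the differential instead; linearity of the differential
  transports the relation.\<close>

lemma bd_divis: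
  assumes "b \<in> homogeneous_bd F c (shift_by \<mu> u s)"
  shows "\<exists>t. \<exists>b'\<in>homogeneous_bd F c u. f ^ (t + s) \<odot>\<^bsub>E c\<^esub> b' = f ^ t \<odot>\<^bsub>E c\<^esub> b"
proof (cases c)
  case 0
  then show ?thesis using assms by auto
next
  case (Suc j)
  then obtain w where w: "w \<in> F j (shift_by \<mu> u s)" "b = d j w" using assms by (auto simp: bd_Suc)
  obtain t y where y: "y \<in> F j u" "f ^ (t + s) \<odot>\<^bsub>E j\<^esub> y = f ^ t \<odot>\<^bsub>E j\<^esub> w"
    using divis_iter[OF w(1)] by blast
  have "f ^ (t + s) \<odot>\<^bsub>E c\<^esub> d j y = f ^ t \<odot>\<^bsub>E c\<^esub> b"
    using arg_cong[OF y(2), of "d j"] F_carrier[OF y(1)] F_carrier[OF w(1)] by (simp add: Suc w(2) d_smult)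
  then show ?thesis using y(1) Suc by (auto simp: bd_Suc)
qed

section \<open>Straightness of the f-power torsion\<close>

lemma tors_mono: "tors f F c u \<subseteq> F c u"
  by (auto simp: tors_def)

lemma bd_tors_mono: "x \<in> homogeneous_bd (tors f F) c u \<Longrightarrow> x \<in> homogeneous_bd F c u"
  using tors_mono by (cases c) (auto simp: bd_Suc)

lemma torsI: "x \<in> F c u \<Longrightarrow> f ^ s \<odot>\<^bsub>E c\<^esub> x = \<zero>\<^bsub>E c\<^esub> \<Longrightarrow> x \<in> tors f F c u"
  by (auto simp: tors_def)

lemma family_tors: "family (tors f F)"
  unfolding family_def
proof (intro allI conjI ballI)
  fix c u
  show "tors f F c u \<subseteq> G c u" using F_G by (auto simp: tors_def)
  show "\<zero>\<^bsub>E c\<^esub> \<in> tors f F c u" by (rule torsI[OF F_zero]) simp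
  fix x assume x: "x \<in> tors f F c u"
  then obtain s where s: "x \<in> F c u" "f ^ s \<odot>\<^bsub>E c\<^esub> x = \<zero>\<^bsub>E c\<^esub>" by (auto simp: tors_def)
  note xc = F_carrier[OF s(1)]
  have "f ^ s \<odot>\<^bsub>E (Suc c)\<^esub> d c x = \<zero>\<^bsub>E (Suc c)\<^esub>"
    using arg_cong[OF s(2), of "d c"] xc by (simp add: d_smult)
  then show "d c x \<in> tors f F (Suc c) u" by (rule torsI[OF F_d[OF s(1)]])
  show "r \<odot>\<^bsub>E c\<^esub> x \<in> tors f F c (\<lambda>k. w k + u k)" if "r \<in> poly_component w" for w r
    using s(2) E.smult_commute[OF xc, of "f ^ s" r] by (intro torsI[OF F_smult[OF that s(1)], of s]) simp
  fix y assume "y \<in> tors f F c u"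
  then obtain t where t: "y \<in> F c u" "f ^ t \<odot>\<^bsub>E c\<^esub> y = \<zero>\<^bsub>E c\<^esub>" by (auto simp: tors_def)
  note yc = F_carrier[OF t(1)]
  have z: "f ^ (s + t) \<odot>\<^bsub>E c\<^esub> x = \<zero>\<^bsub>E c\<^esub>" "f ^ (s + t) \<odot>\<^bsub>E c\<^esub> y = \<zero>\<^bsub>E c\<^esub>"
    using power_smult_zero_mono[OF xc s(2)] power_smult_zero_mono[OF yc t(2)] by simp_all
  show "x \<oplus>\<^bsub>E c\<^esub> y \<in> tors f F c u"
    using z xc yc by (intro torsI[OF F_add[OF s(1) t(1)], of "s + t"]) (simp add: E.smult_add)
  show "x \<ominus>\<^bsub>E c\<^esub> y \<in> tors f F c u"
    using z xc yc by (intro torsI[OF F_diff[OF s(1) t(1)], of "s + t"]) (simp add: E.smult_diff E.M.diff_zero)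
qed

text \<open>\<open>tors f F\<close> is the kernel of F -> F_f, and the long exact sequence shows
  what to do: z is the boundary of some x in F, and x has to be corrected by a cocycle and a
  boundary of F until it becomes f-torsion. Surjectivity for F in cohomological degree c - 1
  supplies the cocycle p, and injectivity there, after multiplication by f^s, supplies the boundary
  b.\<close>

lemma straight_tors_inj:
  assumes st: "straight F" and u: "u k \<noteq> -1" and z: "z \<in> tors f F c u" "d c z = \<zero>\<^bsub>E (Suc c)\<^esub>"
    and Xz: "indet k \<odot>\<^bsub>E c\<^esub> z \<in> homogeneous_bd (tors f F) c (shift_up u k)"
  shows "z \<in> homogeneous_bd (tors f F) c u"
proof -
  have zF: "z \<in> F c u" using z(1) tors_mono by blast
  have zB: "z \<in> homogeneous_bd F c u" by (rule straight_inj[OF st u zF z(2) bd_tors_mono[OF Xz]])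
  show ?thesis
  proof (cases c)
    case 0
    then show ?thesis using zB by simp
  next
    case (Suc j)
    obtain x where x: "x \<in> F j u" "z = d j x" using zB Suc by (auto simp: bd_Suc)
    obtain y where y: "y \<in> tors f F j (shift_up u k)" "indet k \<odot>\<^bsub>E c\<^esub> z = d j y"
      using Xz Suc by (auto simp: bd_Suc)
    have yF: "y \<in> F j (shift_up u k)" using y(1) tors_mono by blast
    note xc = F_carrier[OF x(1)] and yc = F_carrier[OF yF]
    \<comment> \<open>Both X_k x and y have the boundary X_k z, so q is a cocycle.\<close>
    define q where "q = indet k \<odot>\<^bsub>E j\<^esub> x \<ominus>\<^bsub>E j\<^esub> y"
    have q: "q \<in> F j (shift_up u k)" unfolding q_def by (intro F_diff F_indet x(1) yF)
    have dq: "d j q = \<zero>\<^bsub>E (Suc j)\<^esub>"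
      using y(2) xc yc by (simp add: q_def d_diff d_smult x(2) Suc E.M.diff_self)
    obtain s0 where s0: "f ^ s0 \<odot>\<^bsub>E j\<^esub> y = \<zero>\<^bsub>E j\<^esub>" using y(1) by (auto simp: tors_def)
    obtain s1 where s1: "f ^ s1 \<odot>\<^bsub>E c\<^esub> z = \<zero>\<^bsub>E c\<^esub>" using z(1) by (auto simp: tors_def)
    \<comment> \<open>The power has to annihilate y and z, and the shifted degree must avoid -1 so
      that straightness of F applies there.\<close>
    obtain s where s: "s \<ge> s0 + s1" "shift_by \<mu> u s k \<noteq> -1"
      using shift_by_avoid[of u k "s0 + s1" \<mu>] u by blast
    have fy: "f ^ s \<odot>\<^bsub>E j\<^esub> y = \<zero>\<^bsub>E j\<^esub>" using power_smult_zero_mono[OF yc s0] s(1) by simp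
    have fz: "f ^ s \<odot>\<^bsub>E c\<^esub> z = \<zero>\<^bsub>E c\<^esub>" using power_smult_zero_mono[OF F_carrier[OF zF] s1] s(1) by simp
    obtain p where p: "p \<in> F j u" "d j p = \<zero>\<^bsub>E (Suc j)\<^esub>"
      "q \<ominus>\<^bsub>E j\<^esub> indet k \<odot>\<^bsub>E j\<^esub> p \<in> homogeneous_bd F j (shift_up u k)"
      using straight_surj[OF st u q dq] by blast
    note pc = F_carrier[OF p(1)]
    define x2 where "x2 = f ^ s \<odot>\<^bsub>E j\<^esub> (x \<ominus>\<^bsub>E j\<^esub> p)"
    have x2: "x2 \<in> F j (shift_by \<mu> u s)" unfolding x2_def by (intro F_power F_diff x(1) p(1))
    have dx2: "d j x2 = \<zero>\<^bsub>E (Suc j)\<^esub>"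
      using fz xc pc by (simp add: x2_def d_smult d_diff p(2) x(2) Suc E.M.diff_zero)
    \<comment> \<open>X_k (x - p) and q - X_k p differ by y, which f^s kills; thus X_k x2 is a
      boundary, and so is x2 by injectivity.\<close>
    have "indet k \<odot>\<^bsub>E j\<^esub> x2 = f ^ s \<odot>\<^bsub>E j\<^esub> (q \<ominus>\<^bsub>E j\<^esub> indet k \<odot>\<^bsub>E j\<^esub> p)"
    proof -
      have "q \<ominus>\<^bsub>E j\<^esub> indet k \<odot>\<^bsub>E j\<^esub> p = indet k \<odot>\<^bsub>E j\<^esub> (x \<ominus>\<^bsub>E j\<^esub> p) \<ominus>\<^bsub>E j\<^esub> y"
        using xc yc pc by (simp add: q_def E.smult_diff E.M.diff_right_commute)
      then show ?thesis
        using xc yc pc fy by (simp add: x2_def E.smult_commute E.smult_diff E.M.diff_zero)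
    qed
    then have "indet k \<odot>\<^bsub>E j\<^esub> x2 \<in> homogeneous_bd F j (shift_up (shift_by \<mu> u s) k)"
      using bd_power[OF p(3), of s] by (simp add: shift_by_shift_up)
    then have "x2 \<in> homogeneous_bd F j (shift_by \<mu> u s)" by (rule straight_inj[OF st s(2) x2 dx2])
    then obtain t b where b: "b \<in> homogeneous_bd F j u" "f ^ (t + s) \<odot>\<^bsub>E j\<^esub> b = f ^ t \<odot>\<^bsub>E j\<^esub> x2"
      using bd_divis by blast
    note bF = bd_F[OF b(1)]
    note bc = F_carrier[OF bF]
    \<comment> \<open>A cocycle and a boundary are subtracted from x, so z is still the boundary;
      the choice of b makes the result f-torsion.\<close>
    define x3 where "x3 = x \<ominus>\<^bsub>E j\<^esub> p \<ominus>\<^bsub>E j\<^esub> b"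
    have "f ^ (t + s) \<odot>\<^bsub>E j\<^esub> x3 = f ^ (t + s) \<odot>\<^bsub>E j\<^esub> (x \<ominus>\<^bsub>E j\<^esub> p) \<ominus>\<^bsub>E j\<^esub> f ^ (t + s) \<odot>\<^bsub>E j\<^esub> b"
      unfolding x3_def using xc pc bc by (intro E.smult_diff) simp_all
    also have "f ^ (t + s) \<odot>\<^bsub>E j\<^esub> (x \<ominus>\<^bsub>E j\<^esub> p) = f ^ t \<odot>\<^bsub>E j\<^esub> x2"
      unfolding x2_def using xc pc by (intro power_smult_add) simp
    finally have "f ^ (t + s) \<odot>\<^bsub>E j\<^esub> x3 = \<zero>\<^bsub>E j\<^esub>"
      using b(2) F_carrier[OF x2] by (simp add: E.M.diff_self)
    moreover have "x3 \<in> F j u" unfolding x3_def by (intro F_diff x(1) p(1) bF)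
    ultimately have "x3 \<in> tors f F j u" by (rule torsI[rotated])
    moreover have "d j x3 = z"
      using xc pc bc by (simp add: x3_def d_diff p(2) d_bd[OF b(1)] x(2) E.M.diff_zero)
    ultimately show ?thesis using Suc by (auto simp: bd_Suc)
  qed
qed

text \<open>Straightness of F yields a preimage z0 of w modulo boundaries of F, and two corrections
  are needed. A boundary b' makes z0 torsion. Then w - X_k z1 is a boundary of F that has to bound a
  torsion element; this is achieved, at the cost of adding \<open>d j y2\<close> to z1, by
  surjectivity for F in cohomological degree c - 1 after multiplication by a power of f.\<close>

lemma straight_tors_surj:
  assumes st: "straight F" and u: "u k \<noteq> -1"
    and w: "w \<in> tors f F c (shift_up u k)" "d c w = \<zero>\<^bsub>E (Suc c)\<^esub>"
  shows "\<exists>z\<in>tors f F c u. d c z = \<zero>\<^bsub>E (Suc c)\<^esub> \<and> w \<ominus>\<^bsub>E c\<^esub> indet k \<odot>\<^bsub>E c\<^esub> z \<in> homogeneous_bd (tors f F) c (shift_up u k)"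
proof -
  have wF: "w \<in> F c (shift_up u k)" using w(1) tors_mono by blast
  note wc = F_carrier[OF wF]
  obtain z0 where z0: "z0 \<in> F c u" "d c z0 = \<zero>\<^bsub>E (Suc c)\<^esub>"
    "w \<ominus>\<^bsub>E c\<^esub> indet k \<odot>\<^bsub>E c\<^esub> z0 \<in> homogeneous_bd F c (shift_up u k)"
    using straight_surj[OF st u wF w(2)] by blast
  note z0c = F_carrier[OF z0(1)]
  define b where "b = w \<ominus>\<^bsub>E c\<^esub> indet k \<odot>\<^bsub>E c\<^esub> z0"
  have b: "b \<in> homogeneous_bd F c (shift_up u k)" using z0(3) by (simp add: b_def)
  note bc = F_carrier[OF bd_F[OF b]]
  obtain s0 where s0: "f ^ s0 \<odot>\<^bsub>E c\<^esub> w = \<zero>\<^bsub>E c\<^esub>" using w(1) by (auto simp: tors_def)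
  obtain s where s: "s \<ge> s0" "shift_by \<mu> u s k \<noteq> -1" using shift_by_avoid[of u k s0 \<mu>] u by blast
  have fw: "f ^ s \<odot>\<^bsub>E c\<^esub> w = \<zero>\<^bsub>E c\<^esub>" using power_smult_zero_mono[OF wc s0] s(1) by simp
  \<comment> \<open>f^s kills w, so X_k f^s z0 equals the boundary -f^s b, and injectivity for F
    makes f^s z0 a boundary as well.\<close>
  have "indet k \<odot>\<^bsub>E c\<^esub> (f ^ s \<odot>\<^bsub>E c\<^esub> z0) = f ^ s \<odot>\<^bsub>E c\<^esub> (w \<ominus>\<^bsub>E c\<^esub> b)"
    using z0c wc by (simp add: b_def E.M.diff_diff_cancel E.smult_commute)
  also have "\<dots> = \<zero>\<^bsub>E c\<^esub> \<ominus>\<^bsub>E c\<^esub> f ^ s \<odot>\<^bsub>E c\<^esub> b" using wc bc fw by (simp add: E.smult_diff)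
  finally have "indet k \<odot>\<^bsub>E c\<^esub> (f ^ s \<odot>\<^bsub>E c\<^esub> z0) \<in> homogeneous_bd F c (shift_up (shift_by \<mu> u s) k)"
    using bd_diff[OF bd_zero bd_power[OF b, of s]] by (simp add: shift_by_shift_up)
  moreover have "d c (f ^ s \<odot>\<^bsub>E c\<^esub> z0) = \<zero>\<^bsub>E (Suc c)\<^esub>" using z0(2) z0c by (simp add: d_smult)
  ultimately have "f ^ s \<odot>\<^bsub>E c\<^esub> z0 \<in> homogeneous_bd F c (shift_by \<mu> u s)"
    using straight_inj[OF st s(2) F_power[OF z0(1)]] by blast
  then obtain t b' where b': "b' \<in> homogeneous_bd F c u" "f ^ (t + s) \<odot>\<^bsub>E c\<^esub> b' = f ^ t \<odot>\<^bsub>E c\<^esub> (f ^ s \<odot>\<^bsub>E c\<^esub> z0)"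
    using bd_divis by blast
  note b'F = bd_F[OF b'(1)]
  note b'c = F_carrier[OF b'F]
  define z1 where "z1 = z0 \<ominus>\<^bsub>E c\<^esub> b'"
  have "f ^ (t + s) \<odot>\<^bsub>E c\<^esub> z1 = \<zero>\<^bsub>E c\<^esub>"
    using b'(2) z0c b'c by (simp add: z1_def E.smult_diff power_smult_add[OF z0c] E.M.diff_self)
  then have z1: "z1 \<in> tors f F c u" unfolding z1_def by (rule torsI[OF F_diff[OF z0(1) b'F]])
  have z1c: "z1 \<in> carrier (E c)" using z0c b'c by (simp add: z1_def)
  have dz1: "d c z1 = \<zero>\<^bsub>E (Suc c)\<^esub>"
    using z0c b'c by (simp add: z1_def d_diff z0(2) d_bd[OF b'(1)] E.M.diff_zero)
  \<comment> \<open>b1 is torsion and a boundary in F, but an element y with boundary b1 need not be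
    torsion itself.\<close>
  define b1 where "b1 = w \<ominus>\<^bsub>E c\<^esub> indet k \<odot>\<^bsub>E c\<^esub> z1"
  have "b1 = b \<oplus>\<^bsub>E c\<^esub> indet k \<odot>\<^bsub>E c\<^esub> b'"
    using wc z0c b'c by (simp add: b1_def z1_def b_def E.smult_diff E.M.diff_diff_right)
  then have b1: "b1 \<in> homogeneous_bd F c (shift_up u k)" using bd_add[OF b bd_indet[OF b'(1)]] by simp
  note b1c = F_carrier[OF bd_F[OF b1]]
  obtain s2 where s2: "f ^ s2 \<odot>\<^bsub>E c\<^esub> z1 = \<zero>\<^bsub>E c\<^esub>" using z1 by (auto simp: tors_def)
  have fb1: "f ^ (s + s2) \<odot>\<^bsub>E c\<^esub> b1 = \<zero>\<^bsub>E c\<^esub>"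
    using power_smult_zero_mono[OF wc fw, of "s + s2"] power_smult_zero_mono[OF z1c s2, of "s + s2"] wc z1c
      E.smult_commute[OF z1c, of "f ^ (s + s2)" "indet k"]
    by (simp add: b1_def E.smult_diff E.M.diff_zero)
  show ?thesis
  proof (cases c)
    \<comment> \<open>In cohomological degree 0 zero is the only boundary, for F as for its
      torsion.\<close>
    case 0
    then have "w \<ominus>\<^bsub>E c\<^esub> indet k \<odot>\<^bsub>E c\<^esub> z1 \<in> homogeneous_bd (tors f F) c (shift_up u k)" using b1 by (simp add: b1_def)
    then show ?thesis using z1 dz1 by blast
  next
    case (Suc j)
    obtain y where y: "y \<in> F j (shift_up u k)" "b1 = d j y" using b1 Suc by (auto simp: bd_Suc)
    note yc = F_carrier[OF y(1)]
    obtain s' where s': "s' \<ge> s + s2" "shift_by \<mu> u s' k \<noteq> -1"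
      using shift_by_avoid[of u k "s + s2" \<mu>] u by blast
    \<comment> \<open>This power of f kills the boundary b1 of y, so y' is a cocycle, and
      surjectivity for F splits it into X_k y1 and a boundary b2.\<close>
    define y' where "y' = f ^ s' \<odot>\<^bsub>E j\<^esub> y"
    have y': "y' \<in> F j (shift_up (shift_by \<mu> u s') k)" using F_power[OF y(1), of s'] by (simp add: y'_def shift_by_shift_up)
    note y'c = F_carrier[OF y']
    have "d j y' = \<zero>\<^bsub>E (Suc j)\<^esub>"
      using power_smult_zero_mono[OF b1c fb1 s'(1)] yc by (simp add: y'_def d_smult y(2) Suc)
    then obtain y1 where y1: "y1 \<in> F j (shift_by \<mu> u s')" "d j y1 = \<zero>\<^bsub>E (Suc j)\<^esub>"
      "y' \<ominus>\<^bsub>E j\<^esub> indet k \<odot>\<^bsub>E j\<^esub> y1 \<in> homogeneous_bd F j (shift_up (shift_by \<mu> u s') k)"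
      using straight_surj[OF st s'(2) y'] by blast
    note y1c = F_carrier[OF y1(1)]
    define b2 where "b2 = y' \<ominus>\<^bsub>E j\<^esub> indet k \<odot>\<^bsub>E j\<^esub> y1"
    have b2: "b2 \<in> homogeneous_bd F j (shift_by \<mu> (shift_up u k) s')" using y1(3) by (simp add: b2_def shift_by_shift_up)
    note b2c = F_carrier[OF bd_F[OF b2]]
    obtain t1 y2 where y2: "y2 \<in> F j u" "f ^ (t1 + s') \<odot>\<^bsub>E j\<^esub> y2 = f ^ t1 \<odot>\<^bsub>E j\<^esub> y1"
      using divis_iter[OF y1(1)] by blast
    note y2c = F_carrier[OF y2(1)]
    obtain t2 b3 where b3: "b3 \<in> homogeneous_bd F j (shift_up u k)" "f ^ (t2 + s') \<odot>\<^bsub>E j\<^esub> b3 = f ^ t2 \<odot>\<^bsub>E j\<^esub> b2"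
      using bd_divis[OF b2] by blast
    note b3F = bd_F[OF b3(1)]
    note b3c = F_carrier[OF b3F]
    \<comment> \<open>y2 and b3 arise from y1 and b2 by dividing by \<open>f ^ s'\<close> up to
      f-torsion, so subtracting them from y undoes the splitting of y' and leaves torsion.\<close>
    define y3 where "y3 = y \<ominus>\<^bsub>E j\<^esub> indet k \<odot>\<^bsub>E j\<^esub> y2 \<ominus>\<^bsub>E j\<^esub> b3"
    let ?T = "t1 + t2 + s'" and ?t = "t1 + t2"
    have 1: "f ^ ?T \<odot>\<^bsub>E j\<^esub> y = f ^ ?t \<odot>\<^bsub>E j\<^esub> y'"
      unfolding y'_def by (rule power_smult_add[OF yc])
    have 2: "f ^ ?T \<odot>\<^bsub>E j\<^esub> y2 = f ^ ?t \<odot>\<^bsub>E j\<^esub> y1"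
      using power_smult_add[OF y2c, of f t2 "t1 + s'", unfolded y2(2)] power_smult_add[OF y1c, of f t2 t1]
      by (simp add: ac_simps)
    have 3: "f ^ ?T \<odot>\<^bsub>E j\<^esub> b3 = f ^ ?t \<odot>\<^bsub>E j\<^esub> b2"
      using power_smult_add[OF b3c, of f t1 "t2 + s'", unfolded b3(2)] power_smult_add[OF b2c, of f t1 t2]
      by (simp add: ac_simps)
    have "f ^ ?T \<odot>\<^bsub>E j\<^esub> y3 =
        f ^ ?T \<odot>\<^bsub>E j\<^esub> y \<ominus>\<^bsub>E j\<^esub> indet k \<odot>\<^bsub>E j\<^esub> (f ^ ?T \<odot>\<^bsub>E j\<^esub> y2) \<ominus>\<^bsub>E j\<^esub> f ^ ?T \<odot>\<^bsub>E j\<^esub> b3"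
      using yc y2c b3c E.smult_commute[OF y2c, of "f ^ ?T" "indet k"] by (simp add: y3_def E.smult_diff)
    also have "\<dots> = f ^ ?t \<odot>\<^bsub>E j\<^esub> (y' \<ominus>\<^bsub>E j\<^esub> indet k \<odot>\<^bsub>E j\<^esub> y1) \<ominus>\<^bsub>E j\<^esub> f ^ ?t \<odot>\<^bsub>E j\<^esub> b2"
      unfolding 1 2 3 using y'c y1c E.smult_commute[OF y1c, of "f ^ ?t" "indet k"] by (simp add: E.smult_diff)
    also have "\<dots> = \<zero>\<^bsub>E j\<^esub>" using b2c by (simp add: E.M.diff_self flip: b2_def)
    finally have "f ^ ?T \<odot>\<^bsub>E j\<^esub> y3 = \<zero>\<^bsub>E j\<^esub>" .
    moreover have "y3 \<in> F j (shift_up u k)" unfolding y3_def by (intro F_diff F_indet y(1) y2(1) b3F)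
    ultimately have y3: "y3 \<in> tors f F j (shift_up u k)" by (rule torsI[rotated])
    have "f ^ (t1 + s') \<odot>\<^bsub>E (Suc j)\<^esub> d j y2 = \<zero>\<^bsub>E (Suc j)\<^esub>"
      using arg_cong[OF y2(2), of "d j"] y2c y1c by (simp add: d_smult y1(2))
    then have dy2: "d j y2 \<in> tors f F c u" unfolding Suc by (rule torsI[OF F_d[OF y2(1)]])
    \<comment> \<open>The boundary of y2 is torsion because y1 is a cocycle, so it can be absorbed
      into the preimage; what remains of w is the boundary of the torsion element y3.\<close>
    define z where "z = z1 \<oplus>\<^bsub>E c\<^esub> d j y2"
    have zt: "z \<in> tors f F c u"
      using family_tors z1 dy2 by (auto simp: family_def z_def)
    have dz: "d c z = \<zero>\<^bsub>E (Suc c)\<^esub>"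
      using z1c y2c by (simp add: z_def Suc d_add dd) (use dz1 Suc in simp)
    have dy2c: "d j y2 \<in> carrier (E c)" using y2c Suc by simp
    have "d j y3 = b1 \<ominus>\<^bsub>E c\<^esub> indet k \<odot>\<^bsub>E c\<^esub> d j y2"
      using yc y2c b3c by (simp add: y3_def d_diff d_smult d_bd[OF b3(1)] E.M.diff_zero Suc y(2))
    also have "\<dots> = w \<ominus>\<^bsub>E c\<^esub> indet k \<odot>\<^bsub>E c\<^esub> z"
      using wc z1c dy2c by (simp add: b1_def z_def E.smult_add E.M.diff_add_right)
    finally have "d j y3 = w \<ominus>\<^bsub>E c\<^esub> indet k \<odot>\<^bsub>E c\<^esub> z" .
    moreover have "d j y3 \<in> homogeneous_bd (tors f F) c (shift_up u k)" using y3 by (simp add: Suc bd_Suc)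
    ultimately have "w \<ominus>\<^bsub>E c\<^esub> indet k \<odot>\<^bsub>E c\<^esub> z \<in> homogeneous_bd (tors f F) c (shift_up u k)" by simp
    then show ?thesis using zt dz by blast
  qed
qed

lemma straight_tors: "straight F \<Longrightarrow> straight (tors f F)"
  unfolding straight_def[of "tors f F"] using straight_tors_inj straight_tors_surj by blast

end

end

end

section \<open>Torsion with respect to the monomial ideal, degree by degree\<close>

section \<open>Ideal powers and the torsion functor\<close>

lemma ideal_pow_simps:
  "I [^]\<^bsub>ideals_set (ring_of_type_algebra :: 'b::comm_ring_1 ring)\<^esub> (0::nat) = UNIV"
  "I [^]\<^bsub>ideals_set (ring_of_type_algebra :: 'b::comm_ring_1 ring)\<^esub> (Suc n) =
     ideal_prod ring_of_type_algebra (I [^]\<^bsub>ideals_set (ring_of_type_algebra :: 'b::comm_ring_1 ring)\<^esub> n) I"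
  by (simp_all add: nat_pow_def ideals_set_def)

lemma power_in_ideal_pow:
  "g \<in> I \<Longrightarrow> g ^ t \<in> I [^]\<^bsub>ideals_set (ring_of_type_algebra :: 'b::comm_ring_1 ring)\<^esub> (t::nat)"
proof (induction t)
  case (Suc t)
  then show ?case
    using ideal_prod.prod[of "g ^ t" _ g I ring_of_type_algebra]
    unfolding ideal_pow_simps power_Suc2 by simp
next
  case 0
  show ?case unfolding ideal_pow_simps by simp
qed

lemma ideal_prod_subset:
  fixes J :: "'b::comm_ring_1 set"
  assumes "ideal J ring_of_type_algebra" "\<And>i j. i \<in> A \<Longrightarrow> j \<in> B \<Longrightarrow> i * j \<in> J"
  shows "ideal_prod ring_of_type_algebra A B \<subseteq> J"
proof
  fix x assume "x \<in> ideal_prod ring_of_type_algebra A B"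
  then show "x \<in> J"
    using assms by (induction x rule: ideal_prod.induct) (auto simp: ideal_ring_of_type_algebra_iff)
qed

text \<open>Pigeonhole: among sufficiently many factors from Q some g occurs \<open>e g\<close>
  times. The induction peels off one factor g and passes from J to the colon ideal (J : g), for
  which the exponent of g drops by one and with it the bound T; therefore J and e vary.\<close>

lemma ideal_pow_subset:
  fixes Q :: "'b::comm_ring_1 set"
  assumes "finite Q" "ideal J ring_of_type_algebra" "(\<Sum>g\<in>Q. e g) \<le> T"
    and "\<And>g. g \<in> Q \<Longrightarrow> g ^ e g \<in> J"
  shows "genideal ring_of_type_algebra Q [^]\<^bsub>ideals_set ring_of_type_algebra\<^esub> Suc T \<subseteq> J"
  using assms(2-)
proof (induction T arbitrary: J e)
  case (0 J e)
  interpret R: cring "ring_of_type_algebra :: 'b ring" by (rule cring_ring_of_type_algebra)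
  have J: "r * x \<in> J" if "x \<in> J" for r x using 0(1) that by (auto simp: ideal_ring_of_type_algebra_iff)
  have "Q \<subseteq> J"
  proof
    fix g assume g: "g \<in> Q"
    then have "e g = 0" using 0(2) assms(1) by simp
    then have "1 \<in> J" using 0(3)[OF g] by simp
    then show "g \<in> J" using J[of 1 g] by simp
  qed
  then have "genideal ring_of_type_algebra Q \<subseteq> J" by (rule R.genideal_minimal[OF 0(1)])
  then show ?case
    unfolding ideal_pow_simps using J by (intro ideal_prod_subset[OF 0(1)]) auto
next
  case (Suc T J e)
  interpret R: cring "ring_of_type_algebra :: 'b ring" by (rule cring_ring_of_type_algebra)
  note J = Suc.prems(1)[unfolded ideal_ring_of_type_algebra_iff]
  let ?P = "genideal ring_of_type_algebra Q [^]\<^bsub>ideals_set ring_of_type_algebra\<^esub> Suc T"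
  have Pg: "r * g \<in> J" if g: "g \<in> Q" and r: "r \<in> ?P" for g r
  proof (cases "e g = 0")
    case True
    then have "1 \<in> J" using Suc.prems(3)[OF g] by simp
    then have "(r * g) * 1 \<in> J" using J by blast
    then show ?thesis by simp
  next
    case False
    have idl: "ideal {r. r * g \<in> J} ring_of_type_algebra"
      unfolding ideal_ring_of_type_algebra_iff using J by (auto simp: distrib_right mult.assoc)
    define e' where "e' = e(g := e g - 1)"
    have "(\<Sum>h\<in>Q. e h) = e g + (\<Sum>h\<in>Q - {g}. e h)" "(\<Sum>h\<in>Q. e' h) = (e g - 1) + (\<Sum>h\<in>Q - {g}. e h)"
      by (simp_all add: sum.remove[OF assms(1) g] e'_def)
    then have "(\<Sum>h\<in>Q. e' h) \<le> T" using Suc.prems(2) False by simp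
    moreover have "h ^ e' h \<in> {r. r * g \<in> J}" if h: "h \<in> Q" for h
    proof (cases "h = g")
      case True
      have "g ^ (e g - 1) * g = g ^ e g" by (rule power_minus_mult) (use False in simp)
      then show ?thesis using True Suc.prems(3)[OF g] by (simp add: e'_def)
    next
      case False
      have "g * h ^ e h \<in> J" using Suc.prems(3)[OF h] J by blast
      then show ?thesis using False by (simp add: e'_def mult.commute)
    qed
    ultimately have "?P \<subseteq> {r. r * g \<in> J}" by (intro Suc.IH[OF idl])
    then show ?thesis using r by blast
  qed
  \<comment> \<open>The elements that multiply \<open>?P\<close> into J form an ideal, so it is
    enough that Q lies in it.\<close>
  define K where "K = {j. \<forall>r\<in>?P. r * j \<in> J}"
  have "ideal K ring_of_type_algebra"
    unfolding ideal_ring_of_type_algebra_iff K_def using J by (auto simp: distrib_left mult.left_commute)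
  moreover have "Q \<subseteq> K" using Pg by (auto simp: K_def)
  ultimately have "genideal ring_of_type_algebra Q \<subseteq> K" by (rule R.genideal_minimal)
  then show ?case
    unfolding ideal_pow_simps(2)[of _ "Suc T"]
    by (intro ideal_prod_subset[OF Suc.prems(1)]) (auto simp: K_def)
qed

text \<open>By the pigeonhole bound, applied to the annihilator of x, some power of I kills x once
  powers of all generators do. Hence \<Gamma>_I can be built up one generator at a time.\<close>

lemma (in graded) mem_torsion_functor:
  assumes "finite Q" "I = genideal poly_ring Q"
  shows "x \<in> carrier (torsion_functor I M) \<longleftrightarrow>
    x \<in> carrier M \<and> (\<forall>g\<in>Q. \<exists>s. g ^ s \<odot> x = \<zero>)"
proof
  assume "x \<in> carrier (torsion_functor I M)"
  then obtain t :: nat where t: "x \<in> carrier M" "\<forall>r\<in>I [^]\<^bsub>ideals_set poly_ring\<^esub> t. r \<odot> x = \<zero>"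
    by (auto simp: torsion_functor_def)
  have "Q \<subseteq> I" using genideal_self[of Q] assms(2) by simp
  then show "x \<in> carrier M \<and> (\<forall>g\<in>Q. \<exists>s. g ^ s \<odot> x = \<zero>)"
    using t power_in_ideal_pow by blast
next
  assume x: "x \<in> carrier M \<and> (\<forall>g\<in>Q. \<exists>s. g ^ s \<odot> x = \<zero>)"
  then obtain e where e: "\<And>g. g \<in> Q \<Longrightarrow> g ^ e g \<odot> x = \<zero>" by metis
  have "I [^]\<^bsub>ideals_set poly_ring\<^esub> Suc (\<Sum>g\<in>Q. e g) \<subseteq> {r. r \<odot> x = \<zero>}"
    unfolding assms(2) using e x by (intro ideal_pow_subset[OF assms(1), where e = e] ideal_annihilator) auto
  then have "\<exists>t::nat. \<forall>r\<in>I [^]\<^bsub>ideals_set poly_ring\<^esub> t. r \<odot> x = \<zero>" by blast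
  then show "x \<in> carrier (torsion_functor I M)" using x by (simp add: torsion_functor_def)
qed

lemma torsion_functor_simps [simp]:
  "add (torsion_functor I M) = add M" "\<zero>\<^bsub>torsion_functor I M\<^esub> = \<zero>\<^bsub>M\<^esub>"
  "module.smult (torsion_functor I M) = module.smult M"
  by (simp_all add: torsion_functor_def)

lemma (in module) submoduleI_smult:
  assumes "H \<subseteq> carrier M" "\<zero>\<^bsub>M\<^esub> \<in> H"
    "\<And>a b. a \<in> H \<Longrightarrow> b \<in> H \<Longrightarrow> a \<oplus>\<^bsub>M\<^esub> b \<in> H"
    "\<And>r a. r \<in> carrier R \<Longrightarrow> a \<in> H \<Longrightarrow> r \<odot>\<^bsub>M\<^esub> a \<in> H"
  shows "submodule H R M"
proof (rule submoduleI[OF assms(1,2) _ assms(3,4)])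
  fix a assume a: "a \<in> H"
  then have "\<ominus>\<^bsub>M\<^esub> a = (\<ominus> \<one>) \<odot>\<^bsub>M\<^esub> a" using assms(1) by (simp add: smult_l_minus subset_iff)
  then show "\<ominus>\<^bsub>M\<^esub> a \<in> H" using assms(4)[of "\<ominus> \<one>" a] a by simp
qed

lemma (in graded) submodule_torsion:
  assumes "finite Q" "I = genideal poly_ring Q"
  shows "submodule (carrier (torsion_functor I M)) poly_ring M"
proof (rule submoduleI_smult)
  note mem = mem_torsion_functor[OF assms]
  fix a b assume a: "a \<in> carrier (torsion_functor I M)" and b: "b \<in> carrier (torsion_functor I M)"
  show "a \<oplus> b \<in> carrier (torsion_functor I M)"
    unfolding mem
  proof (intro conjI ballI)
    fix g assume "g \<in> Q"
    then obtain s t where st: "g ^ s \<odot> a = \<zero>" "g ^ t \<odot> b = \<zero>" using a b unfolding mem by blast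
    have ab: "a \<in> carrier M" "b \<in> carrier M" using a b unfolding mem by blast+
    have "g ^ (t + s) \<odot> a = \<zero>" "g ^ (s + t) \<odot> b = \<zero>"
      unfolding power_add using ab st by (simp_all add: smult_mult)
    then have "g ^ (s + t) \<odot> (a \<oplus> b) = \<zero>"
      using ab by (simp add: smult_add add.commute)
    then show "\<exists>s. g ^ s \<odot> (a \<oplus> b) = \<zero>" by blast
  qed (use a b in \<open>simp add: mem\<close>)
next
  note mem = mem_torsion_functor[OF assms]
  fix r a assume a: "a \<in> carrier (torsion_functor I M)"
  show "r \<odot> a \<in> carrier (torsion_functor I M)"
    unfolding mem
  proof (intro conjI ballI)
    fix g assume "g \<in> Q"
    then obtain s where s: "g ^ s \<odot> a = \<zero>" using a unfolding mem by blast
    have "a \<in> carrier M" using a unfolding mem by blast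
    then have "g ^ s \<odot> (r \<odot> a) = \<zero>" using s smult_commute[of a "g ^ s" r] by simp
    then show "\<exists>s. g ^ s \<odot> (r \<odot> a) = \<zero>" by blast
  qed (use a in \<open>simp add: mem\<close>)
next
  show "carrier (torsion_functor I M) \<subseteq> carrier M" "\<zero> \<in> carrier (torsion_functor I M)"
    using mem_torsion_functor[OF assms] by auto
qed

section \<open>Constancy on blocks\<close>

text \<open>The one step that is not allowed, from u_k = -1 to u_k = 0, is the one that leaves a
  block. So every point of the block can be moved to its corner, with entry 0 on U and -1 elsewhere,
  while the sum \<nu> of the coordinate distances to the corner decreases.\<close>

lemma constant_on_block:
  fixes f :: "('n::finite \<Rightarrow> int) \<Rightarrow> 'z"
  assumes step: "\<And>u k. u k \<noteq> -1 \<Longrightarrow> f (shift_up u k) = f u"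
    and "u \<in> block U" "v \<in> block U"
  shows "f u = f v"
proof -
  define o' :: "'n \<Rightarrow> int" where "o' k = (if k \<in> U then 0 else -1)" for k
  define \<nu> where "\<nu> u = (\<Sum>k\<in>UNIV. nat \<bar>u k - o' k\<bar>)" for u :: "'n \<Rightarrow> int"
  have dec: "\<nu> w < \<nu> u" if "\<And>j. j \<noteq> k \<Longrightarrow> w j = u j" "\<bar>w k - o' k\<bar> < \<bar>u k - o' k\<bar>" for u w k
    unfolding \<nu>_def
  proof (rule sum_strict_mono_ex1)
    show "\<forall>j\<in>UNIV. nat \<bar>w j - o' j\<bar> \<le> nat \<bar>u j - o' j\<bar>"
    proof
      fix j show "nat \<bar>w j - o' j\<bar> \<le> nat \<bar>u j - o' j\<bar>" using that by (cases "j = k") auto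
    qed
    show "\<exists>j\<in>UNIV. nat \<bar>w j - o' j\<bar> < nat \<bar>u j - o' j\<bar>" using that(2) by (intro bexI[of _ k]) auto
  qed simp
  have "f u = f o'" if "u \<in> block U" for u
    using that
  proof (induction "\<nu> u" arbitrary: u rule: less_induct)
    case less
    show ?case
    proof (cases "u = o'")
      case False
      then obtain k where k: "u k \<noteq> o' k" by auto
      show ?thesis
      proof (cases "k \<in> U")
        case True
        then have pos: "u k > 0" using k less.prems by (force simp: block_def o'_def)
        \<comment> \<open>A positive coordinate has to be lowered, so the step is used backwards,
          from w to u.\<close>
        define w where "w = u(k := u k - 1)"
        have "\<nu> w < \<nu> u" using True pos by (intro dec[of k]) (auto simp: w_def o'_def)
        moreover have "w \<in> block U" using less.prems pos True by (auto simp: w_def block_def)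
        ultimately have "f w = f o'" by (rule less.hyps)
        moreover have "shift_up w k = u" "w k \<noteq> -1" using pos by (auto simp: w_def shift_up_def)
        ultimately show ?thesis using step[of w k] by simp
      next
        case False
        then have neg: "u k < -1" using k less.prems by (force simp: block_def o'_def)
        have "\<nu> (shift_up u k) < \<nu> u" using False neg by (intro dec[of k]) (auto simp: shift_up_def o'_def)
        moreover have "shift_up u k \<in> block U" using less.prems neg False by (auto simp: shift_up_def block_def)
        ultimately have "f (shift_up u k) = f o'" by (rule less.hyps)
        then show ?thesis using step[of u k] neg by simp
      qed
    qed simp
  qed
  then show ?thesis using assms(2,3) by simp
qed

section \<open>Local cohomology\<close>

lemma graded_complex_resolution:
  assumes "graded_injective_resolution E G d (\<eta> :: ('n::finite, 'a::idom) mpoly \<Rightarrow> 'e)"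
  shows "graded_complex E G d"
proof
  note res = assms[unfolded graded_injective_resolution_def]
  show "graded_module (E j) (G j)" for j using res by blast
  then have mod: "module poly_ring (E j)" for j by (simp add: graded_module_def)
  have G: "subgroup (G j u) (add_monoid (E j))" for j u
    using res by (simp add: graded_module_def)
  show d: "d j \<in> graded_hom (E j) (G j) (E (Suc j)) (G (Suc j))" for j using res by blast
  show "d (Suc j) (d j x) = \<zero>\<^bsub>E (Suc (Suc j))\<^esub>" if "x \<in> carrier (E j)" for j x
    using res that unfolding a_kernel_eq by blast
qed

lemma (in graded_complex) family_G: "family G"
  unfolding family_def
  by (auto simp: E.G_add E.G_diff d_G intro: E.G_smult[OF _ _ refl])

text \<open>In positive cohomological degree every homogeneous cocycle is the boundary of a
  homogeneous element, so both conditions are trivial. In degree 0 the cocycles are the image of R,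
  where X_k is a nonzerodivisor and every term of degree u + e_k is divisible by X_k unless u_k =
  -1.\<close>

lemma straight_resolution:
  fixes \<eta> :: "('n::finite, 'a::idom) mpoly \<Rightarrow> 'e"
  assumes "graded_injective_resolution E G d \<eta>"
  shows "graded_complex.straight E d G"
proof -
  interpret graded_complex E G d by (rule graded_complex_resolution[OF assms])
  note res = assms[unfolded graded_injective_resolution_def]
  \<comment> \<open>Exactness gives some preimage y; its component of degree u is again a
    preimage.\<close>
  have ex: "z \<in> homogeneous_bd G (Suc j) u" if z: "z \<in> G (Suc j) u" "d (Suc j) z = \<zero>\<^bsub>E (Suc (Suc j))\<^esub>" for z j u
  proof -
    have "z \<in> a_kernel (E (Suc j)) (E (Suc (Suc j))) (d (Suc j))"
      using z E.G_carrier by (auto simp: a_kernel_eq)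
    then obtain y where y: "y \<in> carrier (E j)" "z = d j y" using res by blast
    have "z = hcomp (E (Suc j)) (G (Suc j)) z u" using E.hcomp_homogeneous[OF z(1)] by simp
    also have "\<dots> = d j (hcomp (E j) (G j) y u)"
      unfolding y(2) by (rule graded_hom_hcomp[OF graded_E graded_E d_hom y(1)])
    finally show ?thesis unfolding bd_Suc using E.hcomp(1)[OF y(1)] by blast
  qed
  let ?S = "self_module (poly_ring :: ('n, 'a) mpoly ring)"
  have sg0: "shifted_grading (\<lambda>k. 0) = (poly_component :: ('n \<Rightarrow> int) \<Rightarrow> ('n, 'a) mpoly set)"
    by (simp add: shifted_grading_def fun_eq_iff)
  interpret S: graded ?S poly_component unfolding sg0[symmetric] by (rule graded_shifted)
  have \<eta>: "\<eta> \<in> graded_hom ?S poly_component (E 0) (G 0)" "inj \<eta>" using res by blast+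
  have \<eta>m: "\<eta> \<in> mod_hom poly_ring ?S (E 0)" using \<eta>(1) by (simp add: graded_hom_def)
  have \<eta>s: "\<eta> (r * s) = r \<odot>\<^bsub>E 0\<^esub> \<eta> s" for r s using mod_homD(3)[OF \<eta>m, of r s] by simp
  have \<eta>0: "\<eta> 0 = \<zero>\<^bsub>E 0\<^esub>" using mod_hom_zero[OF S.module_axioms E.module_axioms \<eta>m] by simp
  have ker0: "\<exists>r\<in>poly_component u. z = \<eta> r" if z: "z \<in> G 0 u" "d 0 z = \<zero>\<^bsub>E (Suc 0)\<^esub>" for z u
  proof -
    have "z \<in> a_kernel (E 0) (E 1) (d 0)" using z E.G_carrier by (auto simp: a_kernel_eq)
    then obtain r where r: "z = \<eta> r" using res by auto
    have "z = hcomp (E 0) (G 0) z u" using E.hcomp_homogeneous[OF z(1)] by simp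
    also have "\<dots> = \<eta> (hcomp ?S poly_component r u)"
      unfolding r by (rule graded_hom_hcomp[OF S.graded_axioms graded_E \<eta>(1)]) simp
    finally show ?thesis using S.hcomp(1)[of r u] by auto
  qed
  have cancel: "r = 0" if r: "r \<in> poly_component u" "indet k * r = 0" for r :: "('n, 'a) mpoly" and u k
    using poly_component_cases[OF r(1)]
  proof (elim disjE exE conjE)
    fix m a assume m: "r = Poly_Mapping.single m a"
    then have "Poly_Mapping.single (Poly_Mapping.single k 1 + m) a = 0"
      using r(2) by (simp add: indet_def mult_single)
    then have "Poly_Mapping.lookup (Poly_Mapping.single (Poly_Mapping.single k 1 + m) a) (Poly_Mapping.single k 1 + m) = 0"
      by simp
    then show "r = 0" by (simp add: m lookup_single)
  qed
  show ?thesis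
    unfolding straight_def
  proof (intro allI impI conjI ballI)
    fix c u k z
    assume u: "u k \<noteq> -1" and z: "z \<in> G c u" "d c z = \<zero>\<^bsub>E (Suc c)\<^esub>"
      "indet k \<odot>\<^bsub>E c\<^esub> z \<in> homogeneous_bd G c (shift_up u k)"
    show "z \<in> homogeneous_bd G c u"
    proof (cases c)
      case 0
      obtain r where r: "r \<in> poly_component u" "z = \<eta> r" using ker0[of z u] z 0 by blast
      then have "\<eta> (indet k * r) = \<eta> 0" using z(3) 0 by (simp add: \<eta>s \<eta>0)
      then have "indet k * r = 0" using \<eta>(2) by (simp add: inj_eq)
      then have "r = 0" by (rule cancel[OF r(1)])
      then show ?thesis using r(2) 0 \<eta>0 by simp
    qed (use ex z in simp)
  next
    fix c u k w
    assume u: "u k \<noteq> -1" and w: "w \<in> G c (shift_up u k)" "d c w = \<zero>\<^bsub>E (Suc c)\<^esub>"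
    show "\<exists>z\<in>G c u. d c z = \<zero>\<^bsub>E (Suc c)\<^esub> \<and> w \<ominus>\<^bsub>E c\<^esub> indet k \<odot>\<^bsub>E c\<^esub> z \<in> homogeneous_bd G c (shift_up u k)"
    proof (cases c)
      case 0
      obtain r where r: "r \<in> poly_component (shift_up u k)" "w = \<eta> r" using ker0[of w "shift_up u k"] w 0 by blast
      have "\<exists>s\<in>poly_component u. r = indet k * s"
        using poly_component_cases[OF r(1)]
      proof (elim disjE exE conjE)
        assume "r = 0" then show ?thesis by (intro bexI[of _ 0]) auto
      next
        fix m a assume m: "r = Poly_Mapping.single m a" "(\<lambda>j. int (Poly_Mapping.lookup m j)) = shift_up u k"
        have mj: "int (Poly_Mapping.lookup m j) = shift_up u k j" for j using m(2) by metis
        have "int (Poly_Mapping.lookup m k) = u k + 1" using mj[of k] by (simp add: shift_up_def)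
        \<comment> \<open>The exponent of X_k in m is u_k + 1, so the condition u_k \<noteq> -1 says
          precisely that X_k divides the monomial.\<close>
        then have "Poly_Mapping.lookup m k \<noteq> 0" using u by linarith
        then have eq: "Poly_Mapping.single k 1 + (m - Poly_Mapping.single k 1) = m"
          by (intro poly_mapping_eqI) (auto simp: lookup_add lookup_minus lookup_single when_def)
        have "int (Poly_Mapping.lookup (m - Poly_Mapping.single k 1) j) = u j" for j
          using mj[of j] \<open>Poly_Mapping.lookup m k \<noteq> 0\<close>
          by (auto simp: lookup_minus lookup_single when_def shift_up_def split: if_splits)
        then have "Poly_Mapping.single (m - Poly_Mapping.single k 1) a \<in> poly_component u"
          by (intro poly_component_single) auto
        moreover have "r = indet k * Poly_Mapping.single (m - Poly_Mapping.single k 1) a"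
          unfolding indet_def mult_single eq m(1) by simp
        ultimately show ?thesis by blast
      qed
      then obtain s where s: "s \<in> poly_component u" "r = indet k * s" by blast
      have "\<eta> s \<in> G 0 u" using \<eta>(1) s(1) by (auto simp: graded_hom_def)
      moreover have "\<eta> s \<in> a_kernel (E 0) (E 1) (d 0)" using res by blast
      moreover have "w \<ominus>\<^bsub>E 0\<^esub> indet k \<odot>\<^bsub>E 0\<^esub> \<eta> s = \<zero>\<^bsub>E 0\<^esub>"
        using E.G_carrier[of w] w(1) 0 by (simp add: r(2) s(2) \<eta>s E.M.diff_self)
      ultimately show ?thesis using 0 by (intro bexI[of _ "\<eta> s"]) (auto simp: a_kernel_eq)
    next
      case (Suc j)
      \<comment> \<open>Here w is itself a boundary, so 0 serves as its preimage under X_k.\<close>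
      have wc: "w \<in> carrier (E c)" using w(1) E.G_carrier by blast
      then show ?thesis
        using ex[of w j "shift_up u k"] w Suc by (intro bexI[of _ "\<zero>\<^bsub>E c\<^esub>"]) (simp_all add: E.M.diff_zero)
    qed
  qed
qed

text \<open>By \<open>mem_torsion_functor\<close>, these are the homogeneous elements of \<Gamma>_I
  of the module \<open>E c\<close> if I is generated by the finite set Q.\<close>

definition (in graded_complex) powtors :: "('n, 'a) mpoly set \<Rightarrow> nat \<Rightarrow> ('n \<Rightarrow> int) \<Rightarrow> 'e set" where
  "powtors Q c u = {x \<in> G c u. \<forall>g\<in>Q. \<exists>s. g ^ s \<odot>\<^bsub>E c\<^esub> x = \<zero>\<^bsub>E c\<^esub>}"

lemma (in graded_complex) powtors_insert: "powtors (insert f Q) = tors f (powtors Q)"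
  by (auto simp: powtors_def tors_def fun_eq_iff)

text \<open>Adjoining one generator f means passing to the f-power torsion, so induction on Q
  reduces the claim to division by f inside \<open>powtors Q\<close>. The generators are terms,
  which makes f homogeneous.\<close>

lemma straight_powtors:
  fixes \<eta> :: "('n::finite, 'a::idom) mpoly \<Rightarrow> 'e"
  assumes "noetherian_ring (base_ring :: 'a ring)"
    and "graded_injective_resolution E G d \<eta>"
    and "finite Q" "Q \<subseteq> {Poly_Mapping.single m a | m a. True}"
  shows "graded_complex.family E G d (graded_complex.powtors E G Q) \<and>
    graded_complex.straight E d (graded_complex.powtors E G Q)"
  using assms(3,4)
proof (induction Q)
  case empty
  interpret graded_complex E G d by (rule graded_complex_resolution[OF assms(2)])
  have "powtors {} = G" by (simp add: powtors_def fun_eq_iff)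
  then show ?case using family_G straight_resolution[OF assms(2)] by simp
next
  case (insert f Q)
  interpret graded_complex E G d by (rule graded_complex_resolution[OF assms(2)])
  obtain m a where "f = Poly_Mapping.single m a" using insert.prems by auto
  then have f: "f \<in> poly_component (\<lambda>k. int (Poly_Mapping.lookup m k))" (is "_ \<in> poly_component ?\<mu>")
    by (simp add: poly_component_single)
  have IH: "family (powtors Q)" "straight (powtors Q)" using insert by auto
  have "\<exists>t. \<exists>y\<in>powtors Q c (\<lambda>k. u k - ?\<mu> k). f ^ Suc t \<odot>\<^bsub>E c\<^esub> y = f ^ t \<odot>\<^bsub>E c\<^esub> x"
    if x: "x \<in> powtors Q c u" for c u x
  proof -
    have "graded_injective (E c) (G c)" using assms(2) by (simp add: graded_injective_resolution_def)
    moreover have "x \<in> G c u" using x by (simp add: powtors_def)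
    ultimately obtain t y where y: "y \<in> G c (\<lambda>k. u k - ?\<mu> k)" "f ^ Suc t \<odot>\<^bsub>E c\<^esub> y = f ^ t \<odot>\<^bsub>E c\<^esub> x"
      "\<And>r. r \<odot>\<^bsub>E c\<^esub> x = \<zero>\<^bsub>E c\<^esub> \<Longrightarrow> r \<odot>\<^bsub>E c\<^esub> y = \<zero>\<^bsub>E c\<^esub>"
      using E.graded_injective_divisible[OF assms(1) _ _ f] by blast
    \<comment> \<open>Each power of a generator that kills x kills y too, so the division does not
      leave the torsion with respect to Q.\<close>
    have "y \<in> powtors Q c (\<lambda>k. u k - ?\<mu> k)"
      using x y(1,3) unfolding powtors_def by blast
    then show ?thesis using y(2) by blast
  qed
  then show ?case
    unfolding powtors_insert
    using family_tors[OF IH(1) f] straight_tors[OF IH(1) f _ IH(2)] by blast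
qed

lemma (in graded_complex) torsion_cochain_complex:
  assumes "finite Q" "I = genideal poly_ring Q"
  shows "cochain_complex poly_ring (\<lambda>j. torsion_functor I (E j)) d"
  unfolding cochain_complex_def
proof (intro allI conjI ballI)
  note mem = E.mem_torsion_functor[OF assms]
  fix j
  have "torsion_functor I (E j) = (E j)\<lparr>carrier := carrier (torsion_functor I (E j))\<rparr>"
    by (simp add: torsion_functor_def)
  then show "module poly_ring (torsion_functor I (E j))"
    using submodule.submodule_is_module[OF E.submodule_torsion[OF assms] E.module_axioms, of j] by simp
  show "d j \<in> mod_hom poly_ring (torsion_functor I (E j)) (torsion_functor I (E (Suc j)))"
  proof (rule mod_homI)
    fix x assume x: "x \<in> carrier (torsion_functor I (E j))"
    then have xc: "x \<in> carrier (E j)" by (simp add: mem)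
    show "d j x \<in> carrier (torsion_functor I (E (Suc j)))"
      unfolding mem
    proof (intro conjI ballI)
      fix g assume "g \<in> Q"
      then obtain s where "g ^ s \<odot>\<^bsub>E j\<^esub> x = \<zero>\<^bsub>E j\<^esub>" using x unfolding mem by blast
      from arg_cong[OF this, of "d j"] have "g ^ s \<odot>\<^bsub>E (Suc j)\<^esub> d j x = \<zero>\<^bsub>E (Suc j)\<^esub>"
        using xc by (simp add: d_smult)
      then show "\<exists>s. g ^ s \<odot>\<^bsub>E (Suc j)\<^esub> d j x = \<zero>\<^bsub>E (Suc j)\<^esub>" by blast
    qed (use xc in simp)
    show "d j (r \<odot>\<^bsub>torsion_functor I (E j)\<^esub> x) = r \<odot>\<^bsub>torsion_functor I (E (Suc j))\<^esub> d j x" for r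
      using d_smult[OF xc] by simp
    fix y assume "y \<in> carrier (torsion_functor I (E j))"
    then show "d j (x \<oplus>\<^bsub>torsion_functor I (E j)\<^esub> y) = d j x \<oplus>\<^bsub>torsion_functor I (E (Suc j))\<^esub> d j y"
      using d_add[OF xc] by (simp add: mem)
  qed
  fix x assume "x \<in> carrier (torsion_functor I (E j))"
  then show "d (Suc j) (d j x) = \<zero>\<^bsub>torsion_functor I (E (Suc (Suc j)))\<^esub>" by (simp add: mem dd)
qed

lemma ring_hom_constants: "Poly_Mapping.single 0 \<in> ring_hom (base_ring :: 'a::idom ring) (poly_ring :: ('n, 'a) mpoly ring)"
  by (rule ring_hom_memI) (simp_all add: mult_single single_add)

text \<open>Multiplication by X_k commutes with constants, so it is A-linear between the components.
  Straightness of \<open>powtors Q\<close> makes it bijective once boundaries are compared: B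
  consists of boundaries of arbitrary torsion elements, whereas straightness only knows boundaries
  of homogeneous ones.\<close>

lemma local_cohomology_component_shift:
  fixes \<eta> :: "('n::finite, 'a::idom) mpoly \<Rightarrow> 'e"
  assumes noeth: "noetherian_ring (base_ring :: 'a ring)"
    and "C_monomial_ideal I" "graded_injective_resolution E G d \<eta>" and u: "u k \<noteq> -1"
  shows "module base_ring (local_cohomology_component I E G d c v)"
    and "\<exists>f. f \<in> mod_iso base_ring (local_cohomology_component I E G d c u)
           (local_cohomology_component I E G d c (shift_up u k))"
proof -
  interpret graded_complex E G d by (rule graded_complex_resolution[OF assms(3)])
  obtain Q where Q: "finite Q" "Q \<subseteq> {Poly_Mapping.single m a | m a. True}" and I: "I = genideal poly_ring Q"
    using C_monomial_ideal_finite_gens[OF noeth assms(2)] by blast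
  let ?C = "\<lambda>j. torsion_functor I (E j)"
  let ?F = "powtors Q"
  note mem = E.mem_torsion_functor[OF Q(1) I]
  have fam: "family ?F" and st: "straight ?F"
    using straight_powtors[OF noeth assms(3) Q] by blast+
  have cc: "cochain_complex poly_ring ?C d" by (rule torsion_cochain_complex[OF Q(1) I])
  then have Cm: "module poly_ring (?C c)" by (simp add: cochain_complex_def)
  define H where "H = cohomology ?C d c"
  define Z where "Z = cocycles ?C d c"
  define B where "B = coboundaries ?C d c"
  have Hm: "module poly_ring H" unfolding H_def by (rule module_cohomology[OF cc])
  interpret H: module "poly_ring :: ('n, 'a) mpoly ring" H by (rule Hm)
  have ZC: "Z \<subseteq> carrier (?C c)" by (auto simp: Z_def cocycles_eq)
  have Zu: "z \<in> Z \<inter> G c u \<longleftrightarrow> z \<in> ?F c u \<and> d c z = \<zero>\<^bsub>E (Suc c)\<^esub>" for z u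
    using E.G_carrier by (auto simp: Z_def cocycles_eq mem powtors_def)
  \<comment> \<open>For a homogeneous boundary take the component of degree u of any torsion
    preimage; it is torsion again because the generators are homogeneous.\<close>
  have B_bd: "z \<in> B \<longleftrightarrow> z \<in> homogeneous_bd ?F c u" if z: "z \<in> G c u" for z u
  proof (cases c)
    case 0
    then show ?thesis by (simp add: B_def coboundaries_def)
  next
    case (Suc j)
    show ?thesis
    proof
      assume "z \<in> B"
      then obtain y where y: "y \<in> carrier (?C j)" "z = d j y" by (auto simp: B_def coboundaries_def Suc)
      have yc: "y \<in> carrier (E j)" using y(1) by (simp add: mem)
      have "z = hcomp (E c) (G c) z u" using E.hcomp_homogeneous[OF z] by simp
      also have "\<dots> = d j (hcomp (E j) (G j) y u)"
        unfolding y(2) Suc by (rule graded_hom_hcomp[OF graded_E graded_E d_hom yc])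
      finally have eq: "z = d j (hcomp (E j) (G j) y u)" .
      have "hcomp (E j) (G j) y u \<in> ?F j u"
        unfolding powtors_def
      proof (intro CollectI conjI ballI)
        show "hcomp (E j) (G j) y u \<in> G j u" by (rule E.hcomp(1)[OF yc])
        fix g assume g: "g \<in> Q"
        then obtain s where s: "g ^ s \<odot>\<^bsub>E j\<^esub> y = \<zero>\<^bsub>E j\<^esub>" using y(1) unfolding mem by blast
        obtain m a where "g = Poly_Mapping.single m a" using g Q(2) by blast
        then have gc: "g \<in> poly_component (\<lambda>k. int (Poly_Mapping.lookup m k))" by (simp add: poly_component_single)
        \<comment> \<open>The product of g^s with the component of degree u is the component of g^s
          y whose degree is raised by s times the degree of g, and it vanishes with g^s y.\<close>
        have "g ^ s \<odot>\<^bsub>E j\<^esub> hcomp (E j) (G j) y u = \<zero>\<^bsub>E j\<^esub>"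
          using E.hcomp_smult[OF poly_component_power[OF gc] yc, of s "\<lambda>k. u k + int s * int (Poly_Mapping.lookup m k)"]
          by (simp add: s E.hcomp_zero)
        then show "\<exists>s. g ^ s \<odot>\<^bsub>E j\<^esub> hcomp (E j) (G j) y u = \<zero>\<^bsub>E j\<^esub>" by blast
      qed
      then show "z \<in> homogeneous_bd ?F c u" using eq by (simp add: Suc bd_Suc)
    next
      assume "z \<in> homogeneous_bd ?F c u"
      then obtain y where y: "y \<in> ?F j u" "z = d j y" by (auto simp: Suc bd_Suc)
      then have "y \<in> carrier (?C j)" using E.G_carrier by (auto simp: mem powtors_def)
      then show "z \<in> B" using y(2) by (simp add: B_def coboundaries_def Suc)
    qed
  qed
  have coset: "B +>\<^bsub>E c\<^esub> z = B +>\<^bsub>?C c\<^esub> z" for z by (simp add: a_r_coset_def')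
  have Hadd: "(B +>\<^bsub>E c\<^esub> x) \<oplus>\<^bsub>H\<^esub> (B +>\<^bsub>E c\<^esub> y) = B +>\<^bsub>E c\<^esub> (x \<oplus>\<^bsub>E c\<^esub> y)" if "x \<in> Z" "y \<in> Z" for x y
    using cohomology_add[OF cc, of x c y] that by (simp add: H_def B_def Z_def coset[unfolded B_def])
  have Hsm: "r \<odot>\<^bsub>H\<^esub> (B +>\<^bsub>E c\<^esub> x) = B +>\<^bsub>E c\<^esub> (r \<odot>\<^bsub>E c\<^esub> x)" if "x \<in> Z" for x r
    using cohomology_smult[OF cc, of r x c] that by (simp add: H_def B_def Z_def coset[unfolded B_def])
  have Hz: "\<zero>\<^bsub>H\<^esub> = B" by (simp add: H_def B_def cohomology_def)
  have Hc: "B +>\<^bsub>E c\<^esub> z \<in> carrier H" if "z \<in> Z" for z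
  proof -
    have "B +>\<^bsub>?C c\<^esub> z \<in> carrier H"
      using that by (auto simp: H_def carrier_cohomology B_def Z_def)
    then show ?thesis by (simp only: coset)
  qed
  have Beq: "B +>\<^bsub>E c\<^esub> x = B +>\<^bsub>E c\<^esub> y \<longleftrightarrow> x \<ominus>\<^bsub>E c\<^esub> y \<in> B" if "x \<in> Z" "y \<in> Z" for x y
  proof -
    have "x \<ominus>\<^bsub>?C c\<^esub> y = x \<ominus>\<^bsub>E c\<^esub> y"
    proof -
      interpret C: module "poly_ring :: ('n, 'a) mpoly ring" "?C c" by (rule Cm)
      have "id \<in> mod_hom poly_ring (?C c) (E c)" by (rule mod_homI) (simp_all add: mem)
      from mod_hom_diff[OF Cm E.module_axioms this] show ?thesis using that ZC by auto
    qed
    then show ?thesis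
      using coset_eq_iff[OF Cm submodule_coboundaries[OF cc], of x y] that ZC
      unfolding coset unfolding B_def by auto
  qed
  define S where "S u = {B +>\<^bsub>E c\<^esub> z | z. z \<in> Z \<inter> G c u}" for u
  have SI: "B +>\<^bsub>E c\<^esub> z \<in> S u" if "z \<in> Z" "z \<in> G c u" for z u using that by (auto simp: S_def)
  have SE: "\<exists>z. Q = B +>\<^bsub>E c\<^esub> z \<and> z \<in> Z \<and> z \<in> G c u" if "Q \<in> S u" for Q u using that by (auto simp: S_def)
  let ?M = "\<lambda>u. local_cohomology_component I E G d c u"
  have M: "?M u = (restrict_scalars (Poly_Mapping.single 0) H)\<lparr>carrier := S u\<rparr>" for u
    by (simp add: local_cohomology_component_def local_cohomology_def restrict_scalars_def H_def S_def B_def Z_def)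
  let ?HA = "restrict_scalars (Poly_Mapping.single 0) H"
  have HA: "module base_ring ?HA"
    by (rule module_restrict_scalars[OF cring_ring_of_type_algebra Hm ring_hom_constants])
  interpret HA: module "base_ring :: 'a ring" ?HA by (rule HA)
  have Zs: "r \<odot>\<^bsub>E c\<^esub> z \<in> Z" if "z \<in> Z" for r z
    using submodule.smult_closed[OF submodule_cocycles[OF cc, of c], of r z] that by (simp add: Z_def)
  have const: "Poly_Mapping.single 0 a \<in> poly_component (\<lambda>k. 0)" for a :: 'a
    by (rule poly_component_single) simp
  have SH: "submodule (S u) base_ring ?HA" for u
  proof (rule HA.submoduleI_smult)
    show "S u \<subseteq> carrier ?HA" using Hc by (auto simp: S_def)
    have "\<zero>\<^bsub>E c\<^esub> \<in> Z"
      using subgroup.one_closed[OF submodule.axioms(1)[OF submodule_cocycles[OF cc, of c]]] by (simp add: Z_def)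
    moreover have "B +>\<^bsub>E c\<^esub> \<zero>\<^bsub>E c\<^esub> = \<zero>\<^bsub>H\<^esub>"
    proof -
      have "B +>\<^bsub>E c\<^esub> \<zero>\<^bsub>E c\<^esub> = 0 \<odot>\<^bsub>H\<^esub> (B +>\<^bsub>E c\<^esub> \<zero>\<^bsub>E c\<^esub>)"
        using Hsm[OF \<open>\<zero>\<^bsub>E c\<^esub> \<in> Z\<close>, of 0] by simp
      also have "\<dots> = \<zero>\<^bsub>H\<^esub>" using H.smult_l_null[OF Hc[OF \<open>\<zero>\<^bsub>E c\<^esub> \<in> Z\<close>]] by simp
      finally show ?thesis .
    qed
    ultimately show "\<zero>\<^bsub>?HA\<^esub> \<in> S u" using SI[of "\<zero>\<^bsub>E c\<^esub>" u] by simp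
    fix P assume "P \<in> S u"
    then obtain x where x: "P = B +>\<^bsub>E c\<^esub> x" "x \<in> Z" "x \<in> G c u" using SE by blast
    show "r \<odot>\<^bsub>?HA\<^esub> P \<in> S u" for r
      using SI[OF Zs[OF x(2)] E.G_smult[OF const x(3)]] by (simp add: x(1) Hsm[OF x(2)])
    fix P' assume "P' \<in> S u"
    then obtain y where y: "P' = B +>\<^bsub>E c\<^esub> y" "y \<in> Z" "y \<in> G c u" using SE by blast
    have "x \<oplus>\<^bsub>E c\<^esub> y \<in> Z"
      using subgroup.m_closed[OF submodule.axioms(1)[OF submodule_cocycles[OF cc, of c]], of x y] x(2) y(2)
      by (simp add: Z_def)
    then show "P \<oplus>\<^bsub>?HA\<^esub> P' \<in> S u"
      using SI[OF _ E.G_add[OF x(3) y(3)]] by (simp add: x(1) y(1) Hadd[OF x(2) y(2)])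
  qed
  show "module base_ring (?M v)"
    unfolding M by (rule submodule.submodule_is_module[OF SH HA])
  let ?f = "\<lambda>P. indet k \<odot>\<^bsub>H\<^esub> P"
  have "?f \<in> mod_iso base_ring (?M u) (?M (shift_up u k))"
  proof (rule mod_isoI[OF mod_homI])
    have SH': "P \<in> carrier H" if "P \<in> S u" for P u using SE[OF that] Hc by blast
    fix P assume P: "P \<in> carrier (?M u)"
    then have PS: "P \<in> S u" by (simp add: M)
    then obtain x where x: "P = B +>\<^bsub>E c\<^esub> x" "x \<in> Z" "x \<in> G c u" using SE by blast
    have "indet k \<odot>\<^bsub>E c\<^esub> x \<in> G c (shift_up u k)"
      by (rule E.G_smult[OF indet_in x(3)]) (simp add: shift_up_eq)
    from SI[OF Zs[OF x(2)] this] show "?f P \<in> carrier (?M (shift_up u k))"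
      by (simp add: M x(1) Hsm[OF x(2)])
    show "?f (r \<odot>\<^bsub>?M u\<^esub> P) = r \<odot>\<^bsub>?M (shift_up u k)\<^esub> ?f P" for r
      using H.smult_assoc1[of "indet k" "Poly_Mapping.single 0 r" P]
        H.smult_assoc1[of "Poly_Mapping.single 0 r" "indet k" P] SH'[OF PS]
      by (simp add: M mult.commute)
    fix P' assume "P' \<in> carrier (?M u)"
    then have "P' \<in> S u" by (simp add: M)
    then show "?f (P \<oplus>\<^bsub>?M u\<^esub> P') = ?f P \<oplus>\<^bsub>?M (shift_up u k)\<^esub> ?f P'"
      using H.smult_r_distr[of "indet k" P P'] SH'[OF PS] SH' by (simp add: M)
  next
    show "inj_on ?f (carrier (?M u))"
    proof (rule inj_onI)
      fix P P' assume "P \<in> carrier (?M u)" "P' \<in> carrier (?M u)" and eq: "?f P = ?f P'"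
      then have "P \<in> S u" "P' \<in> S u" by (simp_all add: M)
      then obtain x y where x: "P = B +>\<^bsub>E c\<^esub> x" "x \<in> Z" "x \<in> G c u"
        and y: "P' = B +>\<^bsub>E c\<^esub> y" "y \<in> Z" "y \<in> G c u" using SE by meson
      note xc = E.G_carrier[OF x(3)] and yc = E.G_carrier[OF y(3)]
      have xF: "x \<in> ?F c u" "d c x = \<zero>\<^bsub>E (Suc c)\<^esub>" using Zu x(2,3) by blast+
      have yF: "y \<in> ?F c u" "d c y = \<zero>\<^bsub>E (Suc c)\<^esub>" using Zu y(2,3) by blast+
      define q where "q = x \<ominus>\<^bsub>E c\<^esub> y"
      have q: "q \<in> ?F c u" "d c q = \<zero>\<^bsub>E (Suc c)\<^esub>" "q \<in> G c u"
        using F_diff[OF fam xF(1) yF(1)] x(3) y(3) xc yc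
        by (simp_all add: q_def d_diff xF(2) yF(2) E.M.diff_zero E.G_diff)
      have "indet k \<odot>\<^bsub>E c\<^esub> x \<ominus>\<^bsub>E c\<^esub> indet k \<odot>\<^bsub>E c\<^esub> y \<in> B"
        using eq Beq[OF Zs[OF x(2)] Zs[OF y(2)]] by (simp add: x(1) y(1) Hsm x(2) y(2))
      then have "indet k \<odot>\<^bsub>E c\<^esub> q \<in> B" using xc yc by (simp add: q_def E.smult_diff)
      moreover have "indet k \<odot>\<^bsub>E c\<^esub> q \<in> G c (shift_up u k)"
        by (rule E.G_smult[OF indet_in q(3)]) (simp add: shift_up_eq)
      ultimately have "indet k \<odot>\<^bsub>E c\<^esub> q \<in> homogeneous_bd ?F c (shift_up u k)" using B_bd by blast
      then have "q \<in> homogeneous_bd ?F c u" by (rule straight_inj[OF st u q(1,2)])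
      then have "q \<in> B" using B_bd[OF q(3)] by blast
      then show "P = P'" using Beq[OF x(2) y(2)] by (simp add: x(1) y(1) q_def)
    qed
    show "carrier (?M (shift_up u k)) \<subseteq> ?f ` carrier (?M u)"
    proof
      fix P assume "P \<in> carrier (?M (shift_up u k))"
      then have "P \<in> S (shift_up u k)" by (simp add: M)
      then obtain w where w: "P = B +>\<^bsub>E c\<^esub> w" "w \<in> Z" "w \<in> G c (shift_up u k)" using SE by blast
      have wF: "w \<in> ?F c (shift_up u k)" "d c w = \<zero>\<^bsub>E (Suc c)\<^esub>" using Zu w(2,3) by blast+
      obtain z where z: "z \<in> ?F c u" "d c z = \<zero>\<^bsub>E (Suc c)\<^esub>"
        "w \<ominus>\<^bsub>E c\<^esub> indet k \<odot>\<^bsub>E c\<^esub> z \<in> homogeneous_bd ?F c (shift_up u k)"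
        using straight_surj[OF st u wF] by blast
      have zZ: "z \<in> Z" "z \<in> G c u" using Zu z(1,2) by blast+
      have "w \<ominus>\<^bsub>E c\<^esub> indet k \<odot>\<^bsub>E c\<^esub> z \<in> G c (shift_up u k)" using F_G[OF fam bd_F[OF fam z(3)]] .
      then have "w \<ominus>\<^bsub>E c\<^esub> indet k \<odot>\<^bsub>E c\<^esub> z \<in> B" using B_bd z(3) by blast
      then have "P = ?f (B +>\<^bsub>E c\<^esub> z)"
        using Beq[OF w(2) Zs[OF zZ(1)]] by (simp add: w(1) Hsm[OF zZ(1)])
      then show "P \<in> ?f ` carrier (?M u)" using SI[OF zZ] by (simp add: M)
    qed
  qed
  then show "\<exists>f. f \<in> mod_iso base_ring (?M u) (?M (shift_up u k))" by blast
qed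

theorem theoremE:
  fixes I :: "('n::finite, 'a::{idom, ring_char_0}) mpoly set"
    and E :: "nat \<Rightarrow> (('n, 'a) mpoly, 'e) module"
    and G :: "nat \<Rightarrow> ('n \<Rightarrow> int) \<Rightarrow> 'e set"
    and d :: "nat \<Rightarrow> 'e \<Rightarrow> 'e"
    and \<eta> :: "('n, 'a) mpoly \<Rightarrow> 'e"
    and c i :: nat
    and p :: "'a set"
    and U :: "'n set"
  assumes "dedekind_domain TYPE('a)"
    and "\<And>q. height_one_prime q (base_ring :: 'a ring) \<Longrightarrow>
           mixed_characteristic_at (base_ring :: 'a ring) q \<and>
           finite (carrier (residue_field (base_ring :: 'a ring) q))"
    and "C_monomial_ideal I"
    and "graded_injective_resolution E G d \<eta>"
    and "primeideal p (base_ring :: 'a ring)"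
  shows "\<forall>u\<in>block U. \<forall>v\<in>block U.
           bass_number base_ring p i (local_cohomology_component I E G d c u) =
           bass_number base_ring p i (local_cohomology_component I E G d c v)"
proof (intro ballI)
  fix u v assume uv: "u \<in> block U" "v \<in> block U"
  have noeth: "noetherian_ring (base_ring :: 'a ring)"
    using assms(1) by (simp add: dedekind_domain_def noetherian_domain_def)
  show "bass_number base_ring p i (local_cohomology_component I E G d c u) =
           bass_number base_ring p i (local_cohomology_component I E G d c v)"
  proof (rule constant_on_block[of "\<lambda>u. bass_number base_ring p i (local_cohomology_component I E G d c u)",
        OF _ uv])
    fix u :: "'n \<Rightarrow> int" and k assume "u k \<noteq> -1"
    note shift = local_cohomology_component_shift[OF noeth assms(3,4),
        where u = u and k = k and c = c, OF this]
    obtain f where f: "f \<in> mod_iso base_ring (local_cohomology_component I E G d c u)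
        (local_cohomology_component I E G d c (shift_up u k))" using shift(2) by blast
    show "bass_number base_ring p i (local_cohomology_component I E G d c (shift_up u k)) =
        bass_number base_ring p i (local_cohomology_component I E G d c u)"
      by (rule bass_number_iso[OF noeth assms(5) shift(1) shift(1) f, symmetric])
  qed
qed

end
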